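(* Let $\mathcal{M}$ be a graded $E_1$-module over an $E_2$-algebra with stabilising object $X$. Suppose that the canonical resolution of $\mathcal{M}$ is graded $\left(\frac{g_{\mathcal{M}}-2+k}{k}\right)$-connected in degrees $\ge1$ for some rational number $k\ge 2$. Then the fundamental groupoid $\Pi(\mathcal{M})$ is $X$-cancellative for objects of positive (finite) degree, i.e. for points $A$ and $A'$ of $\mathcal{M}$ of positive finite degree, $A\oplus X\cong A'\oplus X$ in $\Pi(\mathcal{M})$ implies $A\cong A'$ in $\Pi(\mathcal{M})$.
   Context: Conventions. Spaces are compactly generated; paths are Moore paths; $\omega(\mu)$ is the endpoint of a path $\mu$; $\mu\cdot\nu$ is concatenation ($\mu$ first); $\mathrm{Path}\,Y$ is the space of Moore paths in $Y$ and $\mathrm{Path}_yY$ the subspace of those starting at $y$. A map is $k$-connected if its homotopy fibres are $(k-1)$-connected. Gradings. $\bar{\mathbf{N}}=\mathbf{N}_0\cup\{\infty\}$ is the discrete monoid with $k+\infty=\infty$. A graded space is a space $Y$ with a continuous map $g_Y\colon Y\to\bar{\mathbf{N}}$; $Y_n=g_Y^{-1}(n)$; products are graded by the sum of the gradings. Modules. Operads are symmetric coloured operads in spaces. The operad $\mathcal{SC}_n$ has two colours $\mathfrak m,\mathfrak a$: $\mathcal{SC}_n(\mathfrak a^l;\mathfrak a)$ is the space of $l$-tuples of little $n$-discs in $D^n$ (embeddings $D^n\to D^n$ that are compositions of scalings and translations, with disjoint interiors); $\mathcal{SC}_n(\mathfrak m,\mathfrak a^l;\mathfrak m)$ is the space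 of pairs $(s,\phi)$ with $s\in[0,\infty)$ and $\phi=(\phi_1,\dots,\phi_l)$ embeddings $D^n\to(0,s)\times(-1,1)^{n-1}$ that are compositions of scalings and translations, with disjoint interiors (for $l=0$ the element $(0,\emptyset)$ is allowed); all other spaces of operations are empty. On colour $\mathfrak a$ the composition is that of the little $n$-discs operad; the composition of $(s,\phi)\in\mathcal{SC}_n(\mathfrak m,\mathfrak a^l;\mathfrak m)$ with $(s',\psi)\in\mathcal{SC}_n(\mathfrak m,\mathfrak a^k;\mathfrak m)$ and $\varphi^j\in\mathcal{SC}_n(\mathfrak a^{i_j};\mathfrak a)$ is $(s'+s,(\psi,(\phi_1\circ\varphi^1)+s',\dots,(\phi_l\circ\varphi^l)+s'))$, where $+s'$ is translation in the first coordinate. An $E_{1,n}$-operad is an operad connected to $\mathcal{SC}_n$ by a zig-zag of operad morphisms that are weak homotopy equivalences on all spaces of operations. A graded $E_1$-module $\mathcal M$ over an $E_n$-algebra $\mathcal A$ is an algebra $(\mathcal M,\mathcal A)$ in graded spaces over an $E_{1,n}$-operad $\mathcal O$ (with $\mathcal M$ in colour $\mathfrak m$, $\mathcal A$ in colour $\mathfrak a$, and operations of degree $0$); its structure maps are denoted $\theta$ and operadic composition $\gamma$. Now let $n=2$. Put $\mathcal O(k)=\mathcal O(\mathfrak m,\mathfrak a^k;\mathfrak m)/\Sigma_k$; it is a standing assumption that $\mathcal O(\mathfrak m,\mathfrak a^k;\mathfrak m)\to\mathcal O(k)$ is a covering space. A stabilising object is a point $X\in\mathcal A$ of degree $1$.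 Fix once and for all $c\in\mathcal O(\mathfrak m,\mathfrak a;\mathfrak m)$; the stabilisation map is $s=(-\oplus X)=\theta(c;-,X)\colon\mathcal M\to\mathcal M$, restricting to $s\colon\mathcal M_n\to\mathcal M_{n+1}$. Let $c_0=1_{\mathfrak m}$, $c_{k+1}=\gamma(c;c_k,1_{\mathfrak a})\in\mathcal O(k+1)$, so $s^k=\theta(c_k;-,X^k)$. Canonical resolution. $U\mathcal O$ is the topologically enriched category with objects $[0],[1],\dots$ and $U\mathcal O([q],[p])=\{(d,\mu)\in\mathcal O(p-q)\times\mathrm{Path}_{c_{p+1}}\mathcal O(p+1)\mid\omega(\mu)=\gamma(c_{q+1};d,1_{\mathfrak a}^{q+1})\}$ (empty for $q>p$); the composite of $(e,\zeta)\in U\mathcal O([l],[q])$ with $(d,\mu)\in U\mathcal O([q],[p])$ is $(\gamma(e;d,1_{\mathfrak a}^{q-l}),\mu\cdot\gamma(\zeta;d,1_{\mathfrak a}^{q+1}))$. $U\mathcal B$ is the category with objects $[0],[1],\dots$ and $U\mathcal B([q],[p])=B_{p+1}/B_{p-q}$ for $q\le p$ (empty otherwise), where $B_i$ is the braid group on $i$ strands and $B_{p-q}$ acts from the right via the first $p-q$ strands; composition $([b],[b'])\mapsto[b'(1^{p-q}\oplus b)]$ for $[b]\in U\mathcal B([l],[q])$, $[b']\in U\mathcal B([q],[p])$, where $1^{p-q}\oplus b$ inserts $p-q$ trivial strands to the left. $U\mathcal O$ has homotopy discrete morphism spaces and $\pi_0(U\mathcal O)\cong U\mathcal B$; one such isomorphism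 is fixed, in particular $\pi_1(\mathcal O(p+1),c_{p+1})\cong B_{p+1}$. Let $\Delta_{\mathrm{inj}}$ be the category of the ordered sets $[p]=\{0,\dots,p\}$ and order-preserving injections. Regarding $\coprod_nB_n$ as the free braided monoidal category on one object $X$ with braiding $b$, there is a functor $\Delta_{\mathrm{inj}}\to U\mathcal B$ sending the face $d_i\colon[p-1]\to[p]$ to $[b_{X^{\oplus i},X}^{-1}\oplus X^{\oplus p-i}]$. Let $\widetilde\Delta_{\mathrm{inj}}\subseteq U\mathcal O$ be the subcategory on all objects consisting of the path components of morphism spaces hit by $\Delta_{\mathrm{inj}}\to U\mathcal B\cong\pi_0(U\mathcal O)$; it maps to $\Delta_{\mathrm{inj}}$ by a functor that is the identity on objects and a weak equivalence on morphism spaces. The canonical resolution $R_\bullet(\mathcal M)\to\mathcal M$ is the augmented enriched functor on $\widetilde\Delta_{\mathrm{inj}}^{\mathrm{op}}$ with $R_p(\mathcal M)=\{(A,\zeta)\in\mathcal M\times\mathrm{Path}\,\mathcal M\mid\omega(\zeta)=s^{p+1}(A)\}$, a morphism $(d,\mu)\colon[q]\to[p]$ acting by $(A,\zeta)\mapsto(\theta(d;A,X^{p-q}),\zeta\cdot\theta(\mu;A,X^{p+1}))$, augmented by $(A,\zeta)\mapsto\zeta(0)$. Its realisation $|R_\bullet(\mathcal M)|\to\mathcal M$ is its homotopy colimit over $\mathcal C=\widetilde\Delta_{\mathrm{inj}}^{\mathrm{op}}$, i.e. the geometric realisation of the semi-simplicial space with $p$-simplices $\coprod_{C_0,\dots,C_p}R_{C_0}(\mathcal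 M)\times\mathcal C(C_0,C_1)\times\dots\times\mathcal C(C_{p-1},C_p)$ (bar construction). It is graded by pulling back $g_{\mathcal M}$. For $\varphi\colon\bar{\mathbf N}\to\mathbf Q\cup\{\infty\}$ with $\varphi(\infty)=\infty$, the canonical resolution is graded $\varphi(g_{\mathcal M})$-connected in degrees $\ge m$ if $|R_\bullet(\mathcal M)|_n\to\mathcal M_n$ is $\lfloor\varphi(n)\rfloor$-connected for all $m\le n<\infty$. *)

theory Defs
  imports
    "HOL-Homology.Homology"
    "HOL-Algebra.Coset"
    "HOL-Combinatorics.Permutations"
    "HOL-Library.Extended_Nat"
begin

section \<open>Compactly generated spaces\<close>

text \<open>
  A set is open in the compactly generated topology iff its preimage under every continuous map
  from a compact Hausdorff space is open. HOL cannot quantify over compact Hausdorff spaces of all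
  types. It is enough, however, to test on spaces with points in \<^typ>\<open>('a + nat) set set set\<close>.
  Indeed, suppose \<open>u\<close> is a test map on a space of any type for which the preimage of \<open>U\<close> is not
  open. We may take its domain to be the Stone-Cech compactification of a discrete set \<open>D\<close>, with
  \<open>D\<close> mapped outside \<open>U\<close> and an ultrafilter \<open>F\<close> mapped to some \<open>y\<close> in \<open>U\<close>.
  A Loewenheim-Skolem argument gives a subset \<open>D'\<close> of \<open>D\<close> of cardinality at most that of
  \<^typ>\<open>('a + nat) set\<close> and a non-principal ultrafilter \<open>F'\<close> on it whose image lies in every
  neighbourhood of \<open>y\<close>, and such that every neighbourhood of \<open>y\<close> has a preimage that is a
  neighbourhood of \<open>F'\<close>. Changing the value of the restricted map at \<open>F'\<close> to \<open>y\<close>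
  keeps it continuous and gives a test map on the ultrafilters on \<open>D'\<close> which detects \<open>U\<close>.
  The summand \<^typ>\<open>nat\<close> takes care of finite \<^typ>\<open>'a\<close>.
\<close>

definition k_open :: "'a topology \<Rightarrow> 'a set \<Rightarrow> bool" where
  "k_open X U \<longleftrightarrow> U \<subseteq> topspace X \<and>
     (\<forall>K :: ('a + nat) set set set topology. \<forall>u. compact_space K \<and> Hausdorff_space K \<and>
        continuous_map K X u \<longrightarrow> openin K {x \<in> topspace K. u x \<in> U})"

definition kify :: "'a topology \<Rightarrow> 'a topology" where
  "kify X = topology (k_open X)"

lemma istopology_k_open: "istopology (k_open X)"
  unfolding istopology_def
proof (intro conjI allI impI)
  fix S T assume S: "k_open X S" and T: "k_open X T"
  show "k_open X (S \<inter> T)"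
    unfolding k_open_def
  proof (intro conjI allI impI)
    show "S \<inter> T \<subseteq> topspace X" using S by (auto simp: k_open_def)
    fix K :: "('a + nat) set set set topology" and u
    assume "compact_space K \<and> Hausdorff_space K \<and> continuous_map K X u"
    then have "openin K ({x \<in> topspace K. u x \<in> S} \<inter> {x \<in> topspace K. u x \<in> T})"
      using S T unfolding k_open_def by blast
    then show "openin K {x \<in> topspace K. u x \<in> S \<inter> T}"
      by (rule back_subst) auto
  qed
next
  fix \<U> assume \<U>: "\<forall>S\<in>\<U>. k_open X S"
  show "k_open X (\<Union>\<U>)"
    unfolding k_open_def
  proof (intro conjI allI impI)
    show "\<Union>\<U> \<subseteq> topspace X" using \<U> by (auto simp: k_open_def)
    fix K :: "('a + nat) set set set topology" and u
    assume "compact_space K \<and> Hausdorff_space K \<and> continuous_map K X u"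
    then have "openin K (\<Union>S\<in>\<U>. {x \<in> topspace K. u x \<in> S})"
      using \<U> unfolding k_open_def by blast
    then show "openin K {x \<in> topspace K. u x \<in> \<Union>\<U>}"
      by (rule back_subst) auto
  qed
qed

lemma openin_kify: "openin (kify X) U \<longleftrightarrow> k_open X U"
  by (simp add: kify_def istopology_k_open)

definition compactly_generated :: "'a topology \<Rightarrow> bool" where
  "compactly_generated X \<longleftrightarrow> kify X = X"

abbreviation kprod :: "'a topology \<Rightarrow> 'b topology \<Rightarrow> ('a \<times> 'b) topology" where
  "kprod X Y \<equiv> kify (prod_topology X Y)"

abbreviation kPi :: "('i \<Rightarrow> 'a topology) \<Rightarrow> 'i set \<Rightarrow> ('i \<Rightarrow> 'a) topology" where
  "kPi X I \<equiv> kify (product_topology X I)"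

abbreviation ksub :: "'a topology \<Rightarrow> 'a set \<Rightarrow> 'a topology" where
  "ksub X S \<equiv> kify (subtopology X S)"

definition quotient_topology :: "'a topology \<Rightarrow> 'a rel \<Rightarrow> 'a set topology" where
  "quotient_topology X r =
     topology (\<lambda>\<V>. \<V> \<subseteq> topspace X // r \<and> openin X {x \<in> topspace X. r `` {x} \<in> \<V>})"

lemma openin_quotient_topology:
  "openin (quotient_topology X r) \<V> \<longleftrightarrow>
     \<V> \<subseteq> topspace X // r \<and> openin X {x \<in> topspace X. r `` {x} \<in> \<V>}"
proof -
  have "istopology (\<lambda>\<V>. \<V> \<subseteq> topspace X // r \<and> openin X {x \<in> topspace X. r `` {x} \<in> \<V>})"
    unfolding istopology_def
  proof (rule conjI; intro allI impI)
    fix S T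
    assume "S \<subseteq> topspace X // r \<and> openin X {x \<in> topspace X. r `` {x} \<in> S}"
      and "T \<subseteq> topspace X // r \<and> openin X {x \<in> topspace X. r `` {x} \<in> T}"
    moreover have "{x \<in> topspace X. r `` {x} \<in> S \<inter> T} =
        {x \<in> topspace X. r `` {x} \<in> S} \<inter> {x \<in> topspace X. r `` {x} \<in> T}"
      by auto
    ultimately show "S \<inter> T \<subseteq> topspace X // r \<and> openin X {x \<in> topspace X. r `` {x} \<in> S \<inter> T}"
      by auto
  next
    fix \<U>
    assume *: "\<forall>S\<in>\<U>. S \<subseteq> topspace X // r \<and> openin X {x \<in> topspace X. r `` {x} \<in> S}"
    have "{x \<in> topspace X. r `` {x} \<in> \<Union>\<U>} = (\<Union>S\<in>\<U>. {x \<in> topspace X. r `` {x} \<in> S})"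
      by auto
    with * show "\<Union>\<U> \<subseteq> topspace X // r \<and> openin X {x \<in> topspace X. r `` {x} \<in> \<Union>\<U>}"
      by auto
  qed
  then show ?thesis
    by (simp add: quotient_topology_def)
qed

definition covering_map :: "'a topology \<Rightarrow> 'b topology \<Rightarrow> ('a \<Rightarrow> 'b) \<Rightarrow> bool" where
  "covering_map X Y p \<longleftrightarrow> continuous_map X Y p \<and> p ` topspace X = topspace Y \<and>
     (\<forall>y \<in> topspace Y. \<exists>U. openin Y U \<and> y \<in> U \<and>
        (\<exists>\<V>. \<Union>\<V> = {x \<in> topspace X. p x \<in> U} \<and> (\<forall>V \<in> \<V>. openin X V) \<and> disjoint \<V> \<and>
           (\<forall>V \<in> \<V>. homeomorphic_map (subtopology X V) (subtopology Y U) p)))"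


section \<open>Moore paths\<close>

text \<open>
  A Moore path is a pair of a length \<open>l\<close> and a map defined on the whole real line which is constant
  on \<open>t \<le> 0\<close> and on \<open>t \<ge> l\<close>. This makes the representation of a path unique. The path
  space carries the topology as a subspace of the product with the compact-open topology.
\<close>

type_synonym 'a moore = "real \<times> (real \<Rightarrow> 'a)"

definition compact_open_line :: "'a topology \<Rightarrow> (real \<Rightarrow> 'a) topology" where
  "compact_open_line Y = topology_generated_by
     {{f. continuous_map euclideanreal Y f \<and> f ` C \<subseteq> U} | C U. compact C \<and> openin Y U}"

definition Path :: "'a topology \<Rightarrow> 'a moore topology" where
  "Path Y = ksub (prod_topology euclideanreal (compact_open_line Y))
     {(l, f). 0 \<le> l \<and> continuous_map euclideanreal Y f \<and>
        (\<forall>t\<le>0. f t = f 0) \<and> (\<forall>t\<ge>l. f t = f l)}"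

definition mstart :: "'a moore \<Rightarrow> 'a" where "mstart \<mu> = snd \<mu> 0"

definition mend :: "'a moore \<Rightarrow> 'a" where "mend \<mu> = snd \<mu> (fst \<mu>)"

definition mconst :: "'a \<Rightarrow> 'a moore" where "mconst y = (0, \<lambda>_. y)"

definition mcat :: "'a moore \<Rightarrow> 'a moore \<Rightarrow> 'a moore" where
  "mcat \<mu> \<nu> = (fst \<mu> + fst \<nu>, \<lambda>t. if t \<le> fst \<mu> then snd \<mu> t else snd \<nu> (t - fst \<mu>))"

definition mmap :: "('a \<Rightarrow> 'b) \<Rightarrow> 'a moore \<Rightarrow> 'b moore" where
  "mmap h \<mu> = (fst \<mu>, h \<circ> snd \<mu>)"

definition Path_from :: "'a topology \<Rightarrow> 'a \<Rightarrow> 'a moore topology" where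
  "Path_from Y y = ksub (Path Y) {\<mu>. mstart \<mu> = y}"


section \<open>Connectivity and weak equivalences\<close>

definition sphere_base :: "nat \<Rightarrow> real" where
  "sphere_base = (\<lambda>i. if i = 0 then 1 else 0)"

definition pointed_map :: "nat \<Rightarrow> 'a topology \<Rightarrow> 'a \<Rightarrow> ((nat \<Rightarrow> real) \<Rightarrow> 'a) \<Rightarrow> bool" where
  "pointed_map i Y y g \<longleftrightarrow> continuous_map (nsphere i) Y g \<and> g sphere_base = y"

abbreviation pointed_homotopic ::
    "nat \<Rightarrow> 'a topology \<Rightarrow> 'a \<Rightarrow> ((nat \<Rightarrow> real) \<Rightarrow> 'a) \<Rightarrow> ((nat \<Rightarrow> real) \<Rightarrow> 'a) \<Rightarrow> bool" where
  "pointed_homotopic i Y y \<equiv> homotopic_with (\<lambda>g. g sphere_base = y) (nsphere i) Y"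

text \<open>Bijectivity on homotopy sets \<open>\<pi>\<^sub>i\<close> for all \<open>i \<ge> 0\<close> and all base points.\<close>

definition weak_homotopy_equivalence :: "'a topology \<Rightarrow> 'b topology \<Rightarrow> ('a \<Rightarrow> 'b) \<Rightarrow> bool" where
  "weak_homotopy_equivalence X Y f \<longleftrightarrow>
     continuous_map X Y f \<and> (topspace X = {} \<longrightarrow> topspace Y = {}) \<and>
     (\<forall>i. \<forall>x \<in> topspace X.
        (\<forall>g h. pointed_map i X x g \<and> pointed_map i X x h \<and>
           pointed_homotopic i Y (f x) (f \<circ> g) (f \<circ> h) \<longrightarrow> pointed_homotopic i X x g h) \<and>
        (\<forall>h. pointed_map i Y (f x) h \<longrightarrow>
           (\<exists>g. pointed_map i X x g \<and> pointed_homotopic i Y (f x) (f \<circ> g) h)))"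

text \<open>Non-empty for \<open>k \<ge> -1\<close> and \<open>\<pi>\<^sub>i\<close> trivial for \<open>i \<le> k\<close>; no condition for \<open>k < -1\<close>.\<close>

definition k_connected_space :: "int \<Rightarrow> 'a topology \<Rightarrow> bool" where
  "k_connected_space k Y \<longleftrightarrow> (-1 \<le> k \<longrightarrow> topspace Y \<noteq> {}) \<and>
     (\<forall>i y g. int i \<le> k \<and> y \<in> topspace Y \<and> pointed_map i Y y g \<longrightarrow>
        pointed_homotopic i Y y g (\<lambda>_. y))"

definition homotopy_fibre ::
    "'a topology \<Rightarrow> 'b topology \<Rightarrow> ('a \<Rightarrow> 'b) \<Rightarrow> 'b \<Rightarrow> ('a \<times> 'b moore) topology" where
  "homotopy_fibre X Y f y =
     ksub (kprod X (Path Y)) {(x, \<zeta>). mstart \<zeta> = f x \<and> mend \<zeta> = y}"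

definition k_connected_map :: "int \<Rightarrow> 'a topology \<Rightarrow> 'b topology \<Rightarrow> ('a \<Rightarrow> 'b) \<Rightarrow> bool" where
  "k_connected_map k X Y f \<longleftrightarrow>
     (\<forall>y \<in> topspace Y. k_connected_space (k - 1) (homotopy_fibre X Y f y))"


section \<open>Fundamental groupoid\<close>

definition path_between :: "'a topology \<Rightarrow> 'a \<Rightarrow> 'a \<Rightarrow> (real \<Rightarrow> 'a) \<Rightarrow> bool" where
  "path_between X a b p \<longleftrightarrow> pathin X p \<and> p 0 = a \<and> p 1 = b"

definition path_class :: "'a topology \<Rightarrow> 'a \<Rightarrow> 'a \<Rightarrow> (real \<Rightarrow> 'a) \<Rightarrow> (real \<Rightarrow> 'a) set" where
  "path_class X a b p = {q. path_between X a b q \<and>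
     homotopic_with (\<lambda>r. r 0 = a \<and> r 1 = b) (top_of_set {0..1}) X p q}"

definition Pi_hom :: "'a topology \<Rightarrow> 'a \<Rightarrow> 'a \<Rightarrow> (real \<Rightarrow> 'a) set set" where
  "Pi_hom X a b = path_class X a b ` {p. path_between X a b p}"

definition Pi_id :: "'a topology \<Rightarrow> 'a \<Rightarrow> (real \<Rightarrow> 'a) set" where
  "Pi_id X a = path_class X a a (\<lambda>_. a)"

text \<open>The composite of \<open>f\<close> from \<open>a\<close> to \<open>b\<close> (first) and \<open>g\<close> from \<open>b\<close> to \<open>d\<close>.\<close>

definition Pi_comp :: "'a topology \<Rightarrow> 'a \<Rightarrow> 'a \<Rightarrow>
    (real \<Rightarrow> 'a) set \<Rightarrow> (real \<Rightarrow> 'a) set \<Rightarrow> (real \<Rightarrow> 'a) set" where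
  "Pi_comp X a d f g = path_class X a d
     (\<lambda>t. if t \<le> 1/2 then (SOME p. p \<in> f) (2 * t) else (SOME q. q \<in> g) (2 * t - 1))"

definition Pi_iso :: "'a topology \<Rightarrow> 'a \<Rightarrow> 'a \<Rightarrow> bool" where
  "Pi_iso X a b \<longleftrightarrow> (\<exists>f \<in> Pi_hom X a b. \<exists>g \<in> Pi_hom X b a.
     Pi_comp X a a f g = Pi_id X a \<and> Pi_comp X b b g f = Pi_id X b)"


section \<open>Two-coloured operads\<close>

datatype colour = \<mm> | \<aa>

text \<open>
  For a list of input colours \<open>cs\<close> and an output colour \<open>c\<close>, the space of operations is
  \<open>ops P cs c\<close>. Tuples of operations are extensional functions on \<open>{..<n}\<close>.
  \<open>gam P cs c dss x y\<close> is \<open>\<gamma>(x; y\<^sub>0, y\<^sub>1, \<dots>)\<close> with \<open>x\<close> in \<open>ops P cs c\<close> and \<open>y i\<close> in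
  \<open>ops P (dss ! i) (cs ! i)\<close>. \<open>perm P \<sigma> cs c\<close> is the right action of the permutation \<open>\<sigma>\<close>,
  from \<open>ops P cs c\<close> to \<open>ops P (permute_list \<sigma> cs) c\<close>.
\<close>

record 'o operad_data =
  ops :: "colour list \<Rightarrow> colour \<Rightarrow> 'o topology"
  opid :: "colour \<Rightarrow> 'o"
  gam :: "colour list \<Rightarrow> colour \<Rightarrow> colour list list \<Rightarrow> 'o \<Rightarrow> (nat \<Rightarrow> 'o) \<Rightarrow> 'o"
  perm :: "(nat \<Rightarrow> nat) \<Rightarrow> colour list \<Rightarrow> colour \<Rightarrow> 'o \<Rightarrow> 'o"

text \<open>Position in \<open>concat dss\<close> of the \<open>j\<close>-th entry of the \<open>i\<close>-th list, and its inverse.\<close>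

definition pos :: "'a list list \<Rightarrow> nat \<Rightarrow> nat \<Rightarrow> nat" where
  "pos dss i j = (\<Sum>i'<i. length (dss ! i')) + j"

definition slot :: "'a list list \<Rightarrow> nat \<Rightarrow> nat \<times> nat" where
  "slot dss t = concat (map (\<lambda>i. map (Pair i) [0..<length (dss ! i)]) [0..<length dss]) ! t"

definition op_tuples ::
    "('o, 'e) operad_data_scheme \<Rightarrow> colour list list \<Rightarrow> colour list \<Rightarrow> (nat \<Rightarrow> 'o) topology" where
  "op_tuples P dss cs = kPi (\<lambda>i. ops P (dss ! i) (cs ! i)) {..<length cs}"

definition operad_assoc :: "'o operad_data \<Rightarrow> bool" where
  "operad_assoc P \<longleftrightarrow> (\<forall>cs c dss ess x y z.
     length dss = length cs \<and> length ess = length (concat dss) \<and> x \<in> topspace (ops P cs c) \<and>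
     y \<in> topspace (op_tuples P dss cs) \<and> z \<in> topspace (op_tuples P ess (concat dss)) \<longrightarrow>
     (let E = (\<lambda>i. map (\<lambda>j. ess ! pos dss i j) [0..<length (dss ! i)]) in
      gam P (concat dss) c ess (gam P cs c dss x y) z =
      gam P cs c (map (\<lambda>i. concat (E i)) [0..<length cs]) x
        (\<lambda>i\<in>{..<length cs}. gam P (dss ! i) (cs ! i) (E i) (y i)
           (\<lambda>j\<in>{..<length (dss ! i)}. z (pos dss i j)))))"

definition operad_unital :: "'o operad_data \<Rightarrow> bool" where
  "operad_unital P \<longleftrightarrow>
     (\<forall>c. opid P c \<in> topspace (ops P [c] c)) \<and>
     (\<forall>cs c. \<forall>x \<in> topspace (ops P cs c).
        gam P [c] c [cs] (opid P c) (\<lambda>i\<in>{..<1}. x) = x \<and>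
        gam P cs c (map (\<lambda>d. [d]) cs) x (\<lambda>i\<in>{..<length cs}. opid P (cs ! i)) = x)"

definition operad_symmetric :: "'o operad_data \<Rightarrow> bool" where
  "operad_symmetric P \<longleftrightarrow>
     (\<forall>cs c \<sigma>. \<sigma> permutes {..<length cs} \<longrightarrow>
        continuous_map (ops P cs c) (ops P (permute_list \<sigma> cs) c) (perm P \<sigma> cs c)) \<and>
     (\<forall>cs c. \<forall>x \<in> topspace (ops P cs c). perm P id cs c x = x \<and>
        (\<forall>\<sigma> \<tau>. \<sigma> permutes {..<length cs} \<and> \<tau> permutes {..<length cs} \<longrightarrow>
           perm P (\<sigma> \<circ> \<tau>) cs c x = perm P \<tau> (permute_list \<sigma> cs) c (perm P \<sigma> cs c x)))"

text \<open>
  In both equivariance axioms the hypothesis on \<open>\<rho>\<close> determines it: in the first it is the block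
  permutation induced by \<open>\<sigma>\<close>, in the second the block sum of the \<open>\<tau> i\<close>.
\<close>

definition operad_equivariant :: "'o operad_data \<Rightarrow> bool" where
  "operad_equivariant P \<longleftrightarrow> (\<forall>cs c dss x y \<rho>.
     length dss = length cs \<and> x \<in> topspace (ops P cs c) \<and> y \<in> topspace (op_tuples P dss cs) \<and>
     \<rho> permutes {..<length (concat dss)} \<longrightarrow>
     (\<forall>\<sigma>. \<sigma> permutes {..<length cs} \<and>
        (\<forall>i<length cs. \<forall>j<length (dss ! \<sigma> i).
           \<rho> (pos (permute_list \<sigma> dss) i j) = pos dss (\<sigma> i) j) \<longrightarrow>
        gam P (permute_list \<sigma> cs) c (permute_list \<sigma> dss) (perm P \<sigma> cs c x)
            (\<lambda>i\<in>{..<length cs}. y (\<sigma> i)) =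
        perm P \<rho> (concat dss) c (gam P cs c dss x y)) \<and>
     (\<forall>\<tau>. (\<forall>i<length cs. \<tau> i permutes {..<length (dss ! i)} \<and>
        (\<forall>j<length (dss ! i). \<rho> (pos dss i j) = pos dss i (\<tau> i j))) \<longrightarrow>
        gam P cs c (map (\<lambda>i. permute_list (\<tau> i) (dss ! i)) [0..<length cs]) x
            (\<lambda>i\<in>{..<length cs}. perm P (\<tau> i) (dss ! i) (cs ! i) (y i)) =
        perm P \<rho> (concat dss) c (gam P cs c dss x y)))"

definition operad :: "'o operad_data \<Rightarrow> bool" where
  "operad P \<longleftrightarrow>
     (\<forall>cs c. compactly_generated (ops P cs c)) \<and>
     (\<forall>cs c dss. length dss = length cs \<longrightarrow>
        continuous_map (kprod (ops P cs c) (op_tuples P dss cs)) (ops P (concat dss) c)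
          (\<lambda>(x, y). gam P cs c dss x y)) \<and>
     operad_assoc P \<and> operad_unital P \<and> operad_symmetric P \<and> operad_equivariant P"

definition operad_morphism ::
    "'o operad_data \<Rightarrow> 'p operad_data \<Rightarrow> (colour list \<Rightarrow> colour \<Rightarrow> 'o \<Rightarrow> 'p) \<Rightarrow> bool" where
  "operad_morphism P Q F \<longleftrightarrow>
     (\<forall>cs c. continuous_map (ops P cs c) (ops Q cs c) (F cs c)) \<and>
     (\<forall>c. F [c] c (opid P c) = opid Q c) \<and>
     (\<forall>cs c dss x y. length dss = length cs \<and> x \<in> topspace (ops P cs c) \<and>
        y \<in> topspace (op_tuples P dss cs) \<longrightarrow>
        F (concat dss) c (gam P cs c dss x y) =
        gam Q cs c dss (F cs c x) (\<lambda>i\<in>{..<length cs}. F (dss ! i) (cs ! i) (y i))) \<and>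
     (\<forall>cs c \<sigma>. \<forall>x \<in> topspace (ops P cs c). \<sigma> permutes {..<length cs} \<longrightarrow>
        F (permute_list \<sigma> cs) c (perm P \<sigma> cs c x) = perm Q \<sigma> cs c (F cs c x))"

definition operad_weak_equivalence ::
    "'o operad_data \<Rightarrow> 'p operad_data \<Rightarrow> (colour list \<Rightarrow> colour \<Rightarrow> 'o \<Rightarrow> 'p) \<Rightarrow> bool" where
  "operad_weak_equivalence P Q F \<longleftrightarrow> operad_morphism P Q F \<and>
     (\<forall>cs c. weak_homotopy_equivalence (ops P cs c) (ops Q cs c) (F cs c))"

definition we_linked :: "'o operad_data \<Rightarrow> 'p operad_data \<Rightarrow> bool" where
  "we_linked P Q \<longleftrightarrow>
     (\<exists>F. operad_weak_equivalence P Q F) \<or> (\<exists>F. operad_weak_equivalence Q P F)"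


section \<open>The operad \<open>\<S>\<C>\<^sub>2\<close>\<close>

text \<open>
  The plane is \<^typ>\<open>complex\<close>, with the real part as first coordinate. The embedding
  \<open>z \<mapsto> r z + v\<close> of the unit disc is the pair \<open>(r, v)\<close>. An operation is a pair of \<open>s\<close>
  and a tuple of discs indexed by the positions of the inputs of colour \<open>\<aa>\<close>; for output
  colour \<open>\<aa>\<close> the component \<open>s\<close> is \<open>0\<close>. The input of colour \<open>\<mm>\<close> may be in any position:
  these operation spaces are the images under the symmetric group of the ones where it comes first.
\<close>

type_synonym disc = "real \<times> complex"
type_synonym sc = "real \<times> (nat \<Rightarrow> disc)"

definition disc_comp :: "disc \<Rightarrow> disc \<Rightarrow> disc" where
  "disc_comp e e' = (fst e * fst e', snd e + of_real (fst e) * snd e')"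

definition disc_shift :: "real \<Rightarrow> disc \<Rightarrow> disc" where
  "disc_shift s e = (fst e, of_real s + snd e)"

definition alg_inputs :: "colour list \<Rightarrow> nat set" where
  "alg_inputs cs = {i. i < length cs \<and> cs ! i = \<aa>}"

definition little_discs_in :: "complex set \<Rightarrow> nat set \<Rightarrow> (nat \<Rightarrow> disc) set" where
  "little_discs_in D I = {\<phi> \<in> extensional I.
     (\<forall>i\<in>I. 0 < fst (\<phi> i) \<and> cball (snd (\<phi> i)) (fst (\<phi> i)) \<subseteq> D) \<and>
     disjoint_family_on (\<lambda>i. ball (snd (\<phi> i)) (fst (\<phi> i))) I}"

definition sc_set :: "colour list \<Rightarrow> colour \<Rightarrow> sc set" where
  "sc_set cs c = (case c of
     \<aa> \<Rightarrow> if \<mm> \<in> set cs then {} else {0} \<times> little_discs_in (cball 0 1) (alg_inputs cs)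
   | \<mm> \<Rightarrow> if count_list cs \<mm> \<noteq> 1 then {} else
       {(s, \<phi>). 0 \<le> s \<and>
          \<phi> \<in> little_discs_in {z. 0 < Re z \<and> Re z < s \<and> -1 < Im z \<and> Im z < 1} (alg_inputs cs)})"

text \<open>
  In the composition, \<open>s'\<close> is the first component of the operation inserted at the input of colour
  \<open>\<mm>\<close>. If the output has colour \<open>\<aa>\<close>, there is no such input and the sum is empty.
\<close>

definition sc_comp :: "colour list \<Rightarrow> colour \<Rightarrow> colour list list \<Rightarrow> sc \<Rightarrow> (nat \<Rightarrow> sc) \<Rightarrow> sc" where
  "sc_comp cs c dss x y =
     (let s' = \<Sum>i | i < length cs \<and> cs ! i = \<mm>. fst (y i) in
      (s' + fst x,
       \<lambda>t\<in>alg_inputs (concat dss). case slot dss t of (i, j) \<Rightarrow>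
         if cs ! i = \<mm> then snd (y i) j
         else disc_shift s' (disc_comp (snd x i) (snd (y i) j))))"

definition SC2 :: "sc operad_data" where
  "SC2 = \<lparr>
     ops = (\<lambda>cs c. subtopology
       (prod_topology euclideanreal (product_topology (\<lambda>_. euclidean) (alg_inputs cs))) (sc_set cs c)),
     opid = (\<lambda>c. (0, \<lambda>i\<in>alg_inputs [c]. (1, 0))),
     gam = sc_comp,
     perm = (\<lambda>\<sigma> cs c x. (fst x, \<lambda>i\<in>alg_inputs (permute_list \<sigma> cs). snd x (\<sigma> i)))\<rparr>"

text \<open>
  The type parameter \<open>'z\<close> is the one in which the intermediate operads of the zig-zag have their
  operations. A statement about all \<open>E12_operad TYPE('z) P\<close> with \<open>'z\<close> a free type variable covers
  every zig-zag, since its finitely many types embed into a common one.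
\<close>

definition E12_operad :: "'z itself \<Rightarrow> 'o operad_data \<Rightarrow> bool" where
  "E12_operad _ P \<longleftrightarrow> operad P \<and>
     (\<exists>Q Q' :: 'z operad_data. operad Q \<and> we_linked P Q \<and>
        (\<lambda>A B. operad B \<and> we_linked A B)\<^sup>*\<^sup>* Q Q' \<and> we_linked Q' SC2)"


section \<open>Graded modules\<close>

text \<open>
  Both spaces of the algebra are given on one type: \<open>sp M \<mm>\<close> is the module, \<open>sp M \<aa>\<close> the
  \<open>E\<^sub>2\<close>-algebra. Nothing is assumed about the intersection of their point sets.
  \<^typ>\<open>enat\<close> is used with the discrete topology.
\<close>

record ('o, 'x) algebra_data =
  sp :: "colour \<Rightarrow> 'x topology"
  theta :: "colour list \<Rightarrow> colour \<Rightarrow> 'o \<Rightarrow> (nat \<Rightarrow> 'x) \<Rightarrow> 'x"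
  grd :: "colour \<Rightarrow> 'x \<Rightarrow> enat"

definition sp_tuples :: "('o, 'x) algebra_data \<Rightarrow> colour list \<Rightarrow> (nat \<Rightarrow> 'x) topology" where
  "sp_tuples M cs = kPi (\<lambda>i. sp M (cs ! i)) {..<length cs}"

definition graded_algebra :: "'o operad_data \<Rightarrow> ('o, 'x) algebra_data \<Rightarrow> bool" where
  "graded_algebra P M \<longleftrightarrow>
     (\<forall>c. compactly_generated (sp M c) \<and>
        continuous_map (sp M c) (discrete_topology UNIV) (grd M c)) \<and>
     (\<forall>cs c. continuous_map (kprod (ops P cs c) (sp_tuples M cs)) (sp M c)
        (\<lambda>(d, x). theta M cs c d x)) \<and>
     (\<forall>c. \<forall>A \<in> topspace (sp M c). theta M [c] c (opid P c) (\<lambda>i\<in>{..<1}. A) = A) \<and>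
     (\<forall>cs c dss x y z. length dss = length cs \<and> x \<in> topspace (ops P cs c) \<and>
        y \<in> topspace (op_tuples P dss cs) \<and> z \<in> topspace (sp_tuples M (concat dss)) \<longrightarrow>
        theta M (concat dss) c (gam P cs c dss x y) z =
        theta M cs c x (\<lambda>i\<in>{..<length cs}. theta M (dss ! i) (cs ! i) (y i)
          (\<lambda>j\<in>{..<length (dss ! i)}. z (pos dss i j)))) \<and>
     (\<forall>cs c \<sigma> x z. \<sigma> permutes {..<length cs} \<and> x \<in> topspace (ops P cs c) \<and>
        z \<in> topspace (sp_tuples M cs) \<longrightarrow>
        theta M (permute_list \<sigma> cs) c (perm P \<sigma> cs c x) (\<lambda>i\<in>{..<length cs}. z (\<sigma> i)) =
        theta M cs c x z) \<and>
     (\<forall>cs c. \<forall>x \<in> topspace (ops P cs c). \<forall>z \<in> topspace (sp_tuples M cs).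
        grd M c (theta M cs c x z) = (\<Sum>i<length cs. grd M (cs ! i) (z i)))"


section \<open>The operation spaces \<open>\<O>(k)\<close> and stabilisation\<close>

definition mprof :: "nat \<Rightarrow> colour list" where
  "mprof k = \<mm> # replicate k \<aa>"

definition orbit_rel :: "'o operad_data \<Rightarrow> nat \<Rightarrow> 'o rel" where
  "orbit_rel P k = {(x, perm P \<sigma> (mprof k) \<mm> x) | x \<sigma>.
     x \<in> topspace (ops P (mprof k) \<mm>) \<and> \<sigma> permutes {1..k}}"

definition orbit :: "'o operad_data \<Rightarrow> nat \<Rightarrow> 'o \<Rightarrow> 'o set" where
  "orbit P k x = orbit_rel P k `` {x}"

definition orbit_space :: "'o operad_data \<Rightarrow> nat \<Rightarrow> 'o set topology" where
  "orbit_space P k = quotient_topology (ops P (mprof k) \<mm>) (orbit_rel P k)"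

definition orbit_maps_covering :: "'o operad_data \<Rightarrow> bool" where
  "orbit_maps_covering P \<longleftrightarrow>
     (\<forall>k. covering_map (ops P (mprof k) \<mm>) (orbit_space P k) (orbit P k))"

text \<open>The operation \<open>\<gamma>(e; d, 1\<^sub>\<aa>\<^sup>k)\<close> for \<open>e\<close> with \<open>k\<close> and \<open>d\<close> with \<open>j\<close> inputs of colour \<open>\<aa>\<close>.\<close>

definition gam_left :: "'o operad_data \<Rightarrow> nat \<Rightarrow> nat \<Rightarrow> 'o \<Rightarrow> 'o \<Rightarrow> 'o" where
  "gam_left P j k e d = gam P (mprof k) \<mm> (mprof j # replicate k [\<aa>]) e
     (\<lambda>i\<in>{..k}. if i = 0 then d else opid P \<aa>)"

text \<open>The map it induces on orbits.\<close>

definition gam_orbit :: "'o operad_data \<Rightarrow> nat \<Rightarrow> nat \<Rightarrow> 'o set \<Rightarrow> 'o set \<Rightarrow> 'o set" where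
  "gam_orbit P j k e d = orbit P (j + k) (gam_left P j k (SOME x. x \<in> e) (SOME y. y \<in> d))"

primrec cpow :: "'o operad_data \<Rightarrow> 'o \<Rightarrow> nat \<Rightarrow> 'o" where
  "cpow P c 0 = opid P \<mm>"
| "cpow P c (Suc k) = gam_left P k 1 c (cpow P c k)"

abbreviation cpt :: "'o operad_data \<Rightarrow> 'o \<Rightarrow> nat \<Rightarrow> 'o set" where
  "cpt P c k \<equiv> orbit P k (cpow P c k)"

definition stab :: "('o, 'x) algebra_data \<Rightarrow> 'o \<Rightarrow> 'x \<Rightarrow> 'x \<Rightarrow> 'x" where
  "stab M c X A = theta M (mprof 1) \<mm> c (\<lambda>i\<in>{..1}. if i = 0 then A else X)"

text \<open>The map \<open>\<theta>(d; A, X\<^sup>k)\<close> for an orbit \<open>d\<close> in \<open>\<O>(k)\<close>.\<close>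

definition theta_orbit :: "('o, 'x) algebra_data \<Rightarrow> 'x \<Rightarrow> nat \<Rightarrow> 'o set \<Rightarrow> 'x \<Rightarrow> 'x" where
  "theta_orbit M X k d A =
     theta M (mprof k) \<mm> (SOME x. x \<in> d) (\<lambda>i\<in>{..k}. if i = 0 then A else X)"


section \<open>The category \<open>U\<O>\<close>\<close>

type_synonym 'o umor = "'o set \<times> 'o set moore"

definition UO :: "'o operad_data \<Rightarrow> 'o \<Rightarrow> nat \<Rightarrow> nat \<Rightarrow> 'o umor topology" where
  "UO P c q p = ksub
     (kprod (orbit_space P (p - q)) (Path_from (orbit_space P (p + 1)) (cpt P c (p + 1))))
     {(d, \<mu>). q \<le> p \<and> mend \<mu> = gam_orbit P (p - q) (q + 1) (cpt P c (q + 1)) d}"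

text \<open>The composite of \<open>f\<close> from \<open>[l]\<close> to \<open>[q]\<close> (first) and \<open>g\<close> from \<open>[q]\<close> to \<open>[p]\<close>.\<close>

definition UO_comp :: "'o operad_data \<Rightarrow> nat \<Rightarrow> nat \<Rightarrow> nat \<Rightarrow> 'o umor \<Rightarrow> 'o umor \<Rightarrow> 'o umor" where
  "UO_comp P l q p f g =
     (gam_orbit P (p - q) (q - l) (fst f) (fst g),
      mcat (snd g) (mmap (\<lambda>e. gam_orbit P (p - q) (q + 1) e (fst g)) (snd f)))"

definition UO_id :: "'o operad_data \<Rightarrow> 'o \<Rightarrow> nat \<Rightarrow> 'o umor" where
  "UO_id P c p = (cpt P c 0, mconst (cpt P c (p + 1)))"


section \<open>Braid groups and the category \<open>U\<B>\<close>\<close>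

text \<open>
  Artin's presentation: the letter \<open>(i, True)\<close> is the generator \<open>\<sigma>\<^sub>i\<close>, which crosses
  the strands \<open>i\<close> and \<open>i + 1\<close> (counted from \<open>1\<close>), and \<open>(i, False)\<close> is its inverse.
\<close>

type_synonym braid_word = "(nat \<times> bool) list"
type_synonym braid = "braid_word set"

definition braid_words :: "nat \<Rightarrow> braid_word set" where
  "braid_words n = lists ({1..<n} \<times> UNIV)"

inductive braid_eq :: "nat \<Rightarrow> braid_word \<Rightarrow> braid_word \<Rightarrow> bool" for n where
  refl: "u \<in> braid_words n \<Longrightarrow> braid_eq n u u"
| sym: "braid_eq n u v \<Longrightarrow> braid_eq n v u"
| trans: "braid_eq n u v \<Longrightarrow> braid_eq n v w \<Longrightarrow> braid_eq n u w"
| cong: "braid_eq n u v \<Longrightarrow> a \<in> braid_words n \<Longrightarrow> b \<in> braid_words n \<Longrightarrow>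
    braid_eq n (a @ u @ b) (a @ v @ b)"
| cancel: "i \<in> {1..<n} \<Longrightarrow> braid_eq n [(i, e), (i, \<not> e)] []"
| commute: "i \<in> {1..<n} \<Longrightarrow> j \<in> {1..<n} \<Longrightarrow> i + 2 \<le> j \<Longrightarrow>
    braid_eq n [(i, True), (j, True)] [(j, True), (i, True)]"
| braid: "i \<in> {1..<n} \<Longrightarrow> Suc i \<in> {1..<n} \<Longrightarrow>
    braid_eq n [(i, True), (Suc i, True), (i, True)] [(Suc i, True), (i, True), (Suc i, True)]"

definition braid_class :: "nat \<Rightarrow> braid_word \<Rightarrow> braid" where
  "braid_class n u = {v. braid_eq n u v}"

definition braid_group :: "nat \<Rightarrow> braid monoid" where
  "braid_group n = \<lparr>carrier = braid_class n ` braid_words n,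
     monoid.mult = (\<lambda>a b. braid_class n ((SOME u. u \<in> a) @ (SOME v. v \<in> b))),
     one = braid_class n []\<rparr>"

text \<open>The image in \<open>B\<^sub>n\<close> of \<open>B\<^sub>j\<close> acting on the first \<open>j \<le> n\<close> strands.\<close>

definition first_strands :: "nat \<Rightarrow> nat \<Rightarrow> braid set" where
  "first_strands j n = braid_class n ` braid_words j"

text \<open>\<open>1\<^sup>j \<oplus> b\<close> in \<open>B\<^sub>n\<close>.\<close>

definition insert_left :: "nat \<Rightarrow> nat \<Rightarrow> braid \<Rightarrow> braid" where
  "insert_left j n b = braid_class n (map (\<lambda>(i, e). (j + i, e)) (SOME u. u \<in> b))"

text \<open>The coset of \<open>b\<close> as a morphism from \<open>[q]\<close> to \<open>[p]\<close>.\<close>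

definition UB_class :: "nat \<Rightarrow> nat \<Rightarrow> braid \<Rightarrow> braid set" where
  "UB_class q p b = b <#\<^bsub>braid_group (p + 1)\<^esub> first_strands (p - q) (p + 1)"

definition UB :: "nat \<Rightarrow> nat \<Rightarrow> braid set set" where
  "UB q p = (if q \<le> p then UB_class q p ` carrier (braid_group (p + 1)) else {})"

text \<open>The composite of \<open>f\<close> from \<open>[l]\<close> to \<open>[q]\<close> (first) and \<open>g\<close> from \<open>[q]\<close> to \<open>[p]\<close>.\<close>

definition UB_comp :: "nat \<Rightarrow> nat \<Rightarrow> nat \<Rightarrow> braid set \<Rightarrow> braid set \<Rightarrow> braid set" where
  "UB_comp l q p f g = UB_class l p
     ((SOME b. b \<in> g) \<otimes>\<^bsub>braid_group (p + 1)\<^esub> insert_left (p - q) (p + 1) (SOME b. b \<in> f))"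

definition UB_id :: "nat \<Rightarrow> braid set" where
  "UB_id p = UB_class p p \<one>\<^bsub>braid_group (p + 1)\<^esub>"

text \<open>
  In the groupoid of braid groups, products are composites with the right factor first. With
  \<open>b\<^sub>X\<^sub>,\<^sub>X = \<sigma>\<^sub>1\<close> the hexagon identity
  \<open>b\<^bsub>Y\<oplus>X,X\<^esub> = (b\<^bsub>Y,X\<^esub> \<oplus> X) (Y \<oplus> b\<^bsub>X,X\<^esub>)\<close> gives \<open>\<sigma>\<^sub>1 \<sigma>\<^sub>2 \<dots> \<sigma>\<^sub>i\<close> for the braiding of
  \<open>X\<^sup>i\<close> and \<open>X\<close>. Its inverse moves the first strand to position \<open>i\<close> (counted from \<open>0\<close>).
\<close>

definition braiding :: "nat \<Rightarrow> braid_word" where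
  "braiding i = map (\<lambda>j. (j, True)) [1..<Suc i]"

definition UB_face :: "nat \<Rightarrow> nat \<Rightarrow> braid set" where
  "UB_face p i = UB_class (p - 1) p
     (inv\<^bsub>braid_group (p + 1)\<^esub> (braid_class (p + 1) (braiding i)))"

text \<open>
  \<open>Delta_UB q p f u\<close>: the functor on \<open>\<Delta>\<^sub>i\<^sub>n\<^sub>j\<close> given on faces by \<^const>\<open>UB_face\<close> sends
  the order-preserving injection \<open>f\<close> from \<open>{0..q}\<close> to \<open>{0..p}\<close> to \<open>u\<close>. Every such \<open>f\<close> is a composite
  of faces.
\<close>

definition coface :: "nat \<Rightarrow> nat \<Rightarrow> nat" where
  "coface i j = (if j < i then j else Suc j)"

inductive Delta_UB :: "nat \<Rightarrow> nat \<Rightarrow> (nat \<Rightarrow> nat) \<Rightarrow> braid set \<Rightarrow> bool" where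
  id: "Delta_UB p p (\<lambda>j\<in>{..p}. j) (UB_id p)"
| face: "Delta_UB q p f u \<Longrightarrow> i \<le> Suc p \<Longrightarrow>
    Delta_UB q (Suc p) (\<lambda>j\<in>{..q}. coface i (f j)) (UB_comp q p (Suc p) u (UB_face (Suc p) i))"

text \<open>
  An isomorphism of categories from \<open>\<pi>\<^sub>0(U\<O>)\<close> to \<open>U\<B>\<close> which is the identity on objects.
\<close>

definition UO_UB_iso ::
    "'o operad_data \<Rightarrow> 'o \<Rightarrow> (nat \<Rightarrow> nat \<Rightarrow> 'o umor set \<Rightarrow> braid set) \<Rightarrow> bool" where
  "UO_UB_iso P c \<Phi> \<longleftrightarrow>
     (\<forall>q p. bij_betw (\<Phi> q p) (path_components_of (UO P c q p)) (UB q p)) \<and>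
     (\<forall>p. \<Phi> p p (path_component_of_set (UO P c p p) (UO_id P c p)) = UB_id p) \<and>
     (\<forall>l q p. \<forall>f \<in> topspace (UO P c l q). \<forall>g \<in> topspace (UO P c q p).
        \<Phi> l p (path_component_of_set (UO P c l p) (UO_comp P l q p f g)) =
        UB_comp l q p (\<Phi> l q (path_component_of_set (UO P c l q) f))
          (\<Phi> q p (path_component_of_set (UO P c q p) g)))"

definition Delta_tilde :: "'o operad_data \<Rightarrow> 'o \<Rightarrow> (nat \<Rightarrow> nat \<Rightarrow> 'o umor set \<Rightarrow> braid set) \<Rightarrow>
    nat \<Rightarrow> nat \<Rightarrow> 'o umor topology" where
  "Delta_tilde P c \<Phi> q p = ksub (UO P c q p)
     {f. \<exists>h. Delta_UB q p h (\<Phi> q p (path_component_of_set (UO P c q p) f))}"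


section \<open>Realisation of semi-simplicial spaces\<close>

definition simplex_topology :: "nat \<Rightarrow> (nat \<Rightarrow> real) topology" where
  "simplex_topology n = subtopology (powertop_real UNIV) (standard_simplex n)"

definition simplices :: "(nat \<Rightarrow> 'b topology) \<Rightarrow> (nat \<times> 'b \<times> (nat \<Rightarrow> real)) topology" where
  "simplices B = sum_topology (\<lambda>n. kprod (B n) (simplex_topology n)) UNIV"

text \<open>\<open>fc n i\<close> is the \<open>i\<close>-th face map from \<open>B n\<close> to \<open>B (n - 1)\<close>.\<close>

definition face_rel :: "(nat \<Rightarrow> 'b topology) \<Rightarrow> (nat \<Rightarrow> nat \<Rightarrow> 'b \<Rightarrow> 'b) \<Rightarrow>
    (nat \<times> 'b \<times> (nat \<Rightarrow> real)) rel" where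
  "face_rel B fc = {((Suc n, x, simplical_face i t), (n, fc (Suc n) i x, t)) | n i x t.
     i \<le> Suc n \<and> x \<in> topspace (B (Suc n)) \<and> t \<in> standard_simplex n}"

definition realisation :: "(nat \<Rightarrow> 'b topology) \<Rightarrow> (nat \<Rightarrow> nat \<Rightarrow> 'b \<Rightarrow> 'b) \<Rightarrow>
    (nat \<times> 'b \<times> (nat \<Rightarrow> real)) set topology" where
  "realisation B fc =
     quotient_topology (simplices B) ((face_rel B fc \<union> (face_rel B fc)\<inverse>)\<^sup>*)"


section \<open>The canonical resolution\<close>

type_synonym 'x rpoint = "'x \<times> 'x moore"

definition res_space :: "('o, 'x) algebra_data \<Rightarrow> 'o \<Rightarrow> 'x \<Rightarrow> nat \<Rightarrow> 'x rpoint topology" where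
  "res_space M c X p = ksub (kprod (sp M \<mm>) (Path (sp M \<mm>)))
     {(A, \<zeta>). mend \<zeta> = (stab M c X ^^ (p + 1)) A}"

text \<open>The action of a morphism \<open>(d, \<mu>)\<close> from \<open>[q]\<close> to \<open>[p]\<close>, from \<open>R\<^sub>p\<close> to \<open>R\<^sub>q\<close>.\<close>

definition res_act :: "('o, 'x) algebra_data \<Rightarrow> 'x \<Rightarrow> nat \<Rightarrow> nat \<Rightarrow> 'o umor \<Rightarrow> 'x rpoint \<Rightarrow> 'x rpoint" where
  "res_act M X q p f r = (case f of (d, \<mu>) \<Rightarrow> case r of (A, \<zeta>) \<Rightarrow>
     (theta_orbit M X (p - q) d A,
      mcat \<zeta> (mmap (\<lambda>e. theta_orbit M X (p + 1) e A) \<mu>)))"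

text \<open>
  Bar construction over the opposite \<open>\<C>\<close> of \<^const>\<open>Delta_tilde\<close>: a \<open>p\<close>-simplex is
  \<open>(C, r, f)\<close> with a list \<open>C\<close> of \<open>p + 1\<close> objects, a point \<open>r\<close> of the resolution at the object \<open>C\<^sub>0\<close>, and
  \<open>f i\<close> in \<open>\<C>(C\<^sub>i, C\<^sub>i\<^sub>+\<^sub>1)\<close> for \<open>i < p\<close>, i.e. a morphism from \<open>[C\<^sub>i\<^sub>+\<^sub>1]\<close> to \<open>[C\<^sub>i]\<close>.
\<close>

type_synonym ('o, 'x) bar = "nat list \<times> 'x rpoint \<times> (nat \<Rightarrow> 'o umor)"

definition bar_space :: "'o operad_data \<Rightarrow> ('o, 'x) algebra_data \<Rightarrow> 'o \<Rightarrow> 'x \<Rightarrow>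
    (nat \<Rightarrow> nat \<Rightarrow> 'o umor set \<Rightarrow> braid set) \<Rightarrow> nat \<Rightarrow> ('o, 'x) bar topology" where
  "bar_space P M c X \<Phi> p = sum_topology
     (\<lambda>C. kprod (res_space M c X (C ! 0)) (kPi (\<lambda>i. Delta_tilde P c \<Phi> (C ! Suc i) (C ! i)) {..<p}))
     {C. length C = Suc p}"

definition bar_face :: "'o operad_data \<Rightarrow> ('o, 'x) algebra_data \<Rightarrow> 'x \<Rightarrow>
    nat \<Rightarrow> nat \<Rightarrow> ('o, 'x) bar \<Rightarrow> ('o, 'x) bar" where
  "bar_face P M X p i b = (case b of (C, r, f) \<Rightarrow>
     (take i C @ drop (Suc i) C,
      if i = 0 then res_act M X (C ! 1) (C ! 0) (f 0) r else r,
      \<lambda>j\<in>{..<p - 1}.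
        if Suc j < i then f j
        else if Suc j = i
          then UO_comp P (C ! Suc (Suc j)) (C ! Suc j) (C ! j) (f (Suc j)) (f j)
        else f (Suc j)))"

definition canonical_resolution :: "'o operad_data \<Rightarrow> ('o, 'x) algebra_data \<Rightarrow> 'o \<Rightarrow> 'x \<Rightarrow>
    (nat \<Rightarrow> nat \<Rightarrow> 'o umor set \<Rightarrow> braid set) \<Rightarrow>
    (nat \<times> ('o, 'x) bar \<times> (nat \<Rightarrow> real)) set topology" where
  "canonical_resolution P M c X \<Phi> = realisation (bar_space P M c X \<Phi>) (bar_face P M X)"

text \<open>The augmentation is constant on equivalence classes; it sends \<open>(A, \<zeta>)\<close> to \<open>\<zeta>(0)\<close>.\<close>

definition augmentation :: "(nat \<times> ('o, 'x) bar \<times> (nat \<Rightarrow> real)) set \<Rightarrow> 'x" where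
  "augmentation \<xi> = (case SOME z. z \<in> \<xi> of (p, (C, (A, \<zeta>), f), t) \<Rightarrow> mstart \<zeta>)"

definition degree_part :: "'a topology \<Rightarrow> ('a \<Rightarrow> enat) \<Rightarrow> nat \<Rightarrow> 'a topology" where
  "degree_part Y g n = ksub Y {y. g y = enat n}"

text \<open>
  The function \<open>\<phi>\<close> takes values in the rationals and \<open>\<infinity>\<close>, which is represented by \<^const>\<open>None\<close>;
  a map is \<open>\<infinity>\<close>-connected if it is \<open>k\<close>-connected for all \<open>k\<close>.
\<close>

definition resolution_graded_connected :: "'o operad_data \<Rightarrow> ('o, 'x) algebra_data \<Rightarrow> 'o \<Rightarrow> 'x \<Rightarrow>
    (nat \<Rightarrow> nat \<Rightarrow> 'o umor set \<Rightarrow> braid set) \<Rightarrow> (enat \<Rightarrow> rat option) \<Rightarrow> nat \<Rightarrow> bool" where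
  "resolution_graded_connected P M c X \<Phi> \<phi> m \<longleftrightarrow> \<phi> \<infinity> = None \<and>
     (\<forall>n\<ge>m. \<forall>k. (case \<phi> (enat n) of None \<Rightarrow> True | Some r \<Rightarrow> k = \<lfloor>r\<rfloor>) \<longrightarrow>
        k_connected_map k
          (degree_part (canonical_resolution P M c X \<Phi>) (grd M \<mm> \<circ> augmentation) n)
          (degree_part (sp M \<mm>) (grd M \<mm>) n)
          augmentation)"

end

theory Submission
  imports Defs "HOL-Analysis.Abstract_Topological_Spaces"
begin

text \<open>
  Suppose that \<open>A \<oplus> X\<close> and \<open>A' \<oplus> X\<close> are joined by a path, where \<open>A\<close> has degree \<open>m \<ge> 1\<close>, and put
  \<open>B = A \<oplus> X\<close>. In degree \<open>m + 1\<close> the augmentation of the canonical resolution is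
  \<open>1\<close>-connected, because \<open>((m + 1) - 2 + k) / k \<ge> 1\<close>. Its homotopy fibre over \<open>B\<close> is therefore path
  connected. Two of its points are vertices of the realisation: \<open>A\<close> with the constant path at \<open>B\<close>,
  and \<open>A'\<close> with the given path from \<open>B\<close> to \<open>A' \<oplus> X\<close>. So there is a path between these two vertices
  in the realisation, and the claim is that such a path forces \<open>A\<close> and \<open>A'\<close> into the same path
  component of \<open>\<M>\<close>.

  The reason is an invariant. To a point \<open>(A, \<zeta>)\<close> of the resolution at \<open>[p]\<close> assign \<open>A \<oplus> X\<^sup>p\<close>, which
  is \<open>A\<close> itself for \<open>p = 0\<close>. A morphism \<open>(d, \<mu>)\<close> from \<open>[q]\<close> to \<open>[p]\<close> replaces \<open>A\<close> by
  \<open>\<theta>(d; A, X\<^bsup>p-q\<^esup>)\<close>, and adding \<open>q\<close> further copies of \<open>X\<close> to that gives \<open>\<theta>(e; A, X\<^sup>p)\<close> for some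
  operation \<open>e\<close>. As the operations of this kind form a path connected space, the
  path component of \<open>A \<oplus> X\<^sup>p\<close> is the same for all vertices of a simplex
  (\<open>path_component_stab_iter\<close>). Path connectedness passes along the zig-zag to
  \<open>\<S>\<C>\<^sub>2\<close>, where it says that little discs in a strip can be moved into any position
  (\<open>configurations_path\<close>).

  Two points need care, since \<open>\<M>\<close> is an arbitrary compactly generated space. The invariant is not
  locally constant on the spaces of simplices, because path components need not be open; instead a
  path in the realisation is followed, locally in time, by a path of vertices
  (\<open>path_component_of_realisation\<close>). And continuity of the action requires maps into \<open>k\<close>-ified
  products, hence the fact that a \<open>k\<close>-open set has open preimage under maps from compact Hausdorff
  spaces of every size (\<open>k_open_preimage\<close>).
\<close>

section \<open>Compact generation\<close>

lemma topspace_kify [simp]: "topspace (kify Y) = topspace Y"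
proof (rule antisym)
  show "topspace (kify Y) \<subseteq> topspace Y"
    using openin_topspace[of "kify Y"] unfolding openin_kify k_open_def by blast
  have "k_open Y (topspace Y)"
    unfolding k_open_def
  proof (intro conjI allI impI)
    fix K :: "('a + nat) set set set topology" and u
    assume "compact_space K \<and> Hausdorff_space K \<and> continuous_map K Y u"
    then have "{x \<in> topspace K. u x \<in> topspace Y} = topspace K"
      by (auto simp: continuous_map_def)
    then show "openin K {x \<in> topspace K. u x \<in> topspace Y}"
      by simp
  qed simp
  then show "topspace Y \<subseteq> topspace (kify Y)"
    by (metis openin_kify openin_subset)
qed

lemma openin_imp_openin_kify: "openin Y U \<Longrightarrow> openin (kify Y) U"
  unfolding openin_kify k_open_def
  by (auto dest: openin_subset openin_continuous_map_preimage)

lemma continuous_map_from_kify: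
  assumes "continuous_map Y Z f"
  shows "continuous_map (kify Y) Z f"
  using assms unfolding continuous_map_def by (simp add: openin_imp_openin_kify)

text \<open>
  The image of \<open>K\<close> under \<open>e\<close>, with the topology transported along \<open>e\<close>, is
  one of the test spaces in the definition of \<^const>\<open>k_open\<close>.
\<close>

lemma k_open_preimage_if_inj:
  fixes K :: "'k topology" and e :: "'k \<Rightarrow> ('a + nat) set set set" and Y :: "'a topology"
  assumes V: "k_open Y V" and K: "compact_space K" "Hausdorff_space K"
    and u: "continuous_map K Y u" and e: "inj_on e (topspace K)"
  shows "openin K {x \<in> topspace K. u x \<in> V}"
proof -
  define g where "g = inv_into (topspace K) e"
  define L where "L = pullback_topology (e ` topspace K) g K"
  have ge: "g (e x) = x" if "x \<in> topspace K" for x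
    using that e by (simp add: g_def)
  have topL: "topspace L = e ` topspace K"
    unfolding L_def topspace_pullback_topology using ge by auto
  have cg: "continuous_map L K g"
    unfolding continuous_map_def
  proof (intro conjI allI impI)
    show "g \<in> topspace L \<rightarrow> topspace K" using ge topL by auto
    fix U assume "openin K U"
    then show "openin L {x \<in> topspace L. g x \<in> U}"
      unfolding L_def openin_pullback_topology topL[unfolded L_def]
      by (intro exI[of _ U]) auto
  qed
  have ce: "continuous_map K L e"
    unfolding continuous_map_def
  proof (intro conjI allI impI)
    show "e \<in> topspace K \<rightarrow> topspace L" using topL by auto
    fix U assume "openin L U"
    then obtain W where W: "openin K W" "U = g -` W \<inter> e ` topspace K"
      unfolding L_def openin_pullback_topology by blast
    then have "{x \<in> topspace K. e x \<in> U} = W"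
      using ge openin_subset[OF W(1)] by auto
    then show "openin K {x \<in> topspace K. e x \<in> U}" using W by simp
  qed
  have "homeomorphic_maps K L e g"
    unfolding homeomorphic_maps_def using cg ce ge topL by auto
  then have "K homeomorphic_space L"
    by (auto simp: homeomorphic_space_def)
  then have L: "compact_space L" "Hausdorff_space L"
    using K homeomorphic_compact_space homeomorphic_Hausdorff_space by blast+
  have "continuous_map L Y (u \<circ> g)"
    using cg u continuous_map_compose by blast
  then have "openin L {x \<in> topspace L. (u \<circ> g) x \<in> V}"
    using V L unfolding k_open_def by blast
  then have "openin K {x \<in> topspace K. e x \<in> {x \<in> topspace L. (u \<circ> g) x \<in> V}}"
    using ce openin_continuous_map_preimage by blast
  moreover have "{x \<in> topspace K. e x \<in> {x \<in> topspace L. (u \<circ> g) x \<in> V}} = {x \<in> topspace K. u x \<in> V}"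
    using ge topL by auto
  ultimately show ?thesis by simp
qed

lemma real_embeds: "\<exists>e :: real \<Rightarrow> ('a + nat) set set set. inj e"
proof
  let ?q = "\<lambda>r::real. {n. real_of_rat (from_nat n) < r}"
  let ?e = "\<lambda>r. {{Inr ` ?q r}} :: ('a + nat) set set set"
  show "inj ?e"
  proof (rule injI)
    fix r r' :: real assume "?e r = ?e r'"
    then have eq: "?q r = ?q r'" by (simp add: inj_image_eq_iff)
    show "r = r'"
    proof (rule ccontr)
      assume "r \<noteq> r'"
      then have "min r r' < max r r'" by auto
      then obtain q where q: "min r r' < real_of_rat q" "real_of_rat q < max r r'"
        using of_rat_dense by blast
      have "(to_nat q \<in> ?q r) = (to_nat q \<in> ?q r')" using eq by simp
      then show False using q by (auto simp: min_def max_def split: if_splits)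
    qed
  qed
qed

text \<open>
  A list of sets is coded by the pairs of an element and a position, together with its length; pairs are coded
  by single elements since \<^typ>\<open>'a + nat\<close> is infinite.
\<close>

lemma lists_embed: "\<exists>e :: 'a set list \<Rightarrow> ('a + nat) set. inj e"
proof -
  have "infinite (UNIV :: ('a + nat) set)"
    by (metis UNIV_I finite_Plus_iff UNIV_Plus_UNIV infinite_UNIV_nat empty_iff)
  then obtain g :: "('a + nat) \<times> ('a + nat) \<Rightarrow> 'a + nat" where "bij_betw g (UNIV \<times> UNIV) UNIV"
    using card_of_Times_same_infinite card_of_ordIso by blast
  then have g: "inj g"
    by (simp add: bij_betw_def)
  define e :: "'a set list \<Rightarrow> ('a + nat) set" where
    "e os = g ` ({(Inl a, Inr i) | a i. i < length os \<and> a \<in> os ! i} \<union> {(Inr (length os), Inr 0)})" for os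
  have "inj e"
  proof (rule injI)
    fix os os' assume "e os = e os'"
    then have eq: "{(Inl a :: 'a + nat, Inr i :: 'a + nat) | a i. i < length os \<and> a \<in> os ! i} \<union> {(Inr (length os), Inr 0)} =
      {(Inl a, Inr i) | a i. i < length os' \<and> a \<in> os' ! i} \<union> {(Inr (length os'), Inr 0)}" (is "?S = ?S'")
      unfolding e_def inj_image_eq_iff[OF g] .
    have "(Inr (length os), Inr 0) \<in> ?S'" unfolding eq[symmetric] by (rule UnI2) simp
    then have len: "length os = length os'" by auto
    have "(a \<in> os ! i) = (a \<in> os' ! i)" if "i < length os" for a i
    proof -
      have "((Inl a, Inr i) \<in> ?S) = ((Inl a, Inr i) \<in> ?S')" unfolding eq ..
      then show ?thesis using that len by auto
    qed
    then show "os = os'" using len by (intro nth_equalityI) auto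
  qed
  then show ?thesis by blast
qed

text \<open>
  If every neighbourhood of \<open>y\<close> contains \<open>z\<close>, then the map on \<open>[0, 1]\<close>
  that takes the value \<open>y\<close> at \<open>0\<close> and \<open>z\<close> elsewhere is continuous. So it
  serves as a test for \<open>V\<close>.
\<close>

lemma k_open_upward_closed:
  assumes V: "k_open Y V" and y: "y \<in> V" and z: "z \<in> topspace Y"
    and yz: "\<And>U. openin Y U \<Longrightarrow> y \<in> U \<Longrightarrow> z \<in> U"
  shows "z \<in> V"
proof (rule ccontr)
  assume zV: "z \<notin> V"
  let ?I = "top_of_set {0..1::real}"
  let ?u = "\<lambda>t::real. if t = 0 then y else z"
  obtain e :: "real \<Rightarrow> ('a + nat) set set set" where e: "inj e"
    using real_embeds by blast
  have "continuous_map ?I Y ?u"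
    unfolding continuous_map_def
  proof (intro conjI allI impI)
    show "?u \<in> topspace ?I \<rightarrow> topspace Y"
      using V y z by (auto simp: k_open_def)
    fix U assume U: "openin Y U"
    consider "y \<in> U" "z \<in> U" | "y \<notin> U" "z \<in> U" | "y \<notin> U" "z \<notin> U"
      using U yz by blast
    then show "openin ?I {x \<in> topspace ?I. ?u x \<in> U}"
    proof cases
      case 1
      then have "{x \<in> topspace ?I. ?u x \<in> U} = {0..1}" by auto
      then show ?thesis by simp
    next
      case 2
      then have "{x \<in> topspace ?I. ?u x \<in> U} = {0..1} \<inter> {0<..}" by auto
      then show ?thesis by (metis open_greaterThan openin_open)
    next
      case 3
      then have "{x \<in> topspace ?I. ?u x \<in> U} = {}" by auto
      then show ?thesis by (simp only: openin_empty)
    qed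
  qed
  then have "openin ?I {x \<in> topspace ?I. ?u x \<in> V}"
    using k_open_preimage_if_inj[OF V, of ?I ?u e] e
    by (simp add: compact_space_subtopology Hausdorff_space_subtopology inj_on_def)
  moreover have "{x \<in> topspace ?I. ?u x \<in> V} = {0}"
    using y zV by auto
  ultimately have "openin ?I {0}" by simp
  then obtain d where "d > 0" and d: "ball 0 d \<inter> {0..1} \<subseteq> {0::real}"
    unfolding openin_contains_ball by blast
  have "min 1 (d/2) \<in> ball 0 d \<inter> {0..1::real}"
    using \<open>d > 0\<close> by (auto simp: dist_real_def)
  then have "min 1 (d/2) = 0" using d by blast
  then show False using \<open>d > 0\<close> by (auto simp: min_def split: if_splits)
qed

text \<open>
  A test space of arbitrary size can be replaced by a small one. If the preimage of \<open>V\<close> is not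
  open, it contains a point \<open>x\<close> in the closure of its complement \<open>W\<close>. Each
  neighbourhood \<open>U\<close> of \<open>u x\<close> pulls back to a neighbourhood of \<open>x\<close>; choose
  a point of \<open>W\<close> in every finite intersection of (shrunken) such neighbourhoods. These points are
  indexed by lists of subsets of \<open>Y\<close>, so the closure \<open>L\<close> of the set of them is small:
  a point of \<open>L\<close> is determined by the traces of its neighbourhoods. By compactness \<open>L\<close>
  contains a point \<open>x'\<close> whose image lies in every neighbourhood of \<open>u x\<close>. Then
  \<open>u x'\<close> lies in \<open>V\<close> although \<open>x'\<close> is a limit of points of
  \<open>W\<close>, and \<open>V\<close> fails the test given by \<open>u\<close> on \<open>L\<close>.
\<close>

lemma k_open_preimage:
  fixes K :: "'k topology" and Y :: "'a topology"
  assumes V: "k_open Y V" and K: "compact_space K" "Hausdorff_space K"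
    and u: "continuous_map K Y u"
  shows "openin K {x \<in> topspace K. u x \<in> V}"
proof (rule ccontr)
  assume not_open: "\<not> openin K {x \<in> topspace K. u x \<in> V}"
  define W where "W = {x \<in> topspace K. u x \<notin> V}"
  obtain x where x: "x \<in> topspace K" "u x \<in> V" "x \<in> (K closure_of W)"
  proof -
    have "\<not> closedin K W"
    proof
      assume "closedin K W"
      then have "openin K (topspace K - W)" by (rule openin_diff[OF openin_topspace])
      moreover have "topspace K - W = {x \<in> topspace K. u x \<in> V}" by (auto simp: W_def)
      ultimately show False using not_open by simp
    qed
    then have "\<not> K closure_of W \<subseteq> W"
      using closure_of_subset_eq[of W K] by (auto simp: W_def)
    then show ?thesis
      using that closure_of_subset_topspace[of K W] unfolding W_def by fastforce
  qed
  define \<O> where "\<O> = {U. openin Y U \<and> u x \<in> U}"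
  define G where "G U N C \<longleftrightarrow> openin K N \<and> closedin K C \<and> x \<in> N \<and> N \<subseteq> C \<and>
    C \<subseteq> {z \<in> topspace K. u z \<in> U}" for U N C
  have "\<exists>N C. G U N C"
    if "U \<in> \<O>" for U
  proof -
    have "openin K {z \<in> topspace K. u z \<in> U} \<and> x \<in> {z \<in> topspace K. u z \<in> U}"
      using that u x by (auto simp: \<O>_def openin_continuous_map_preimage)
    moreover have "neighbourhood_base_of (closedin K) K"
      using compact_Hausdorff_imp_regular_space[OF K] neighbourhood_base_of_closedin by blast
    ultimately show ?thesis
      unfolding neighbourhood_base_of G_def
      by (elim allE[of _ "{z \<in> topspace K. u z \<in> U}"] allE[of _ x]) blast
  qed
  then obtain N C where "\<And>U. U \<in> \<O> \<Longrightarrow> G U (N U) (C U)"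
    by metis
  then have NC: "openin K (N U)" "closedin K (C U)" "x \<in> N U" "N U \<subseteq> C U"
    "C U \<subseteq> {z \<in> topspace K. u z \<in> U}" if "U \<in> \<O>" for U
    using that unfolding G_def by blast+
  have "\<exists>w. w \<in> W \<and> (\<forall>U\<in>set os. w \<in> N U)" if "os \<in> lists \<O>" for os
  proof -
    have "openin K (topspace K \<inter> \<Inter>(N ` set os))"
      using that
    proof (induction os)
      case (Cons U os)
      then have "openin K (N U)" "openin K (topspace K \<inter> \<Inter>(N ` set os))"
        by (simp_all add: NC(1))
      then have "openin K (N U \<inter> (topspace K \<inter> \<Inter>(N ` set os)))"
        by (rule openin_Int)
      moreover have "topspace K \<inter> \<Inter>(N ` set (U # os)) = N U \<inter> (topspace K \<inter> \<Inter>(N ` set os))"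
        by auto
      ultimately show ?case by simp
    qed simp
    moreover have "x \<in> topspace K \<inter> \<Inter>(N ` set os)"
      using that NC(3) x(1) by auto
    ultimately have "\<exists>w. w \<in> W \<and> w \<in> topspace K \<inter> \<Inter>(N ` set os)"
      using x(3) unfolding in_closure_of by metis
    then show ?thesis by auto
  qed
  then have "\<forall>os\<in>lists \<O>. \<exists>w. w \<in> W \<and> (\<forall>U\<in>set os. w \<in> N U)"
    by blast
  then obtain d where "\<forall>os\<in>lists \<O>. d os \<in> W \<and> (\<forall>U\<in>set os. d os \<in> N U)"
    using bchoice[of "lists \<O>" "\<lambda>os w. w \<in> W \<and> (\<forall>U\<in>set os. w \<in> N U)"] by blast
  then have d: "d os \<in> W" "\<And>U. U \<in> set os \<Longrightarrow> d os \<in> N U" if "os \<in> lists \<O>" for os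
    using that by blast+
  define L where "L = K closure_of (d ` lists \<O>)"
  have dK: "d ` lists \<O> \<subseteq> topspace K" using d by (auto simp: W_def)
  \<comment> \<open>with the lists ordered by inclusion \<open>d\<close> is a net, and \<open>x'\<close> is a cluster point of it\<close>
  define S where "S os = K closure_of (d ` {os' \<in> lists \<O>. set os \<subseteq> set os'})" for os
  have "\<exists>x'. x' \<in> topspace K \<and> (\<forall>os\<in>lists \<O>. x' \<in> S os)"
  proof -
    have *: "\<Inter>\<F> \<noteq> {}" if \<F>: "finite \<F>" "\<F> \<subseteq> S ` lists \<O>" "\<F> \<noteq> {}" for \<F>
    proof -
      obtain oss where oss: "finite oss" "oss \<subseteq> lists \<O>" "\<F> = S ` oss"
        using finite_subset_image[OF \<F>(1,2)] by blast
      obtain osl where osl: "set osl = oss" using finite_list oss(1) by blast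
      have "concat osl \<in> lists \<O>" using osl oss(2) by fastforce
      have "d (concat osl) \<in> S os" if "os \<in> oss" for os
      proof -
        have "set os \<subseteq> set (concat osl)" using that osl by auto
        then have "d (concat osl) \<in> d ` {os' \<in> lists \<O>. set os \<subseteq> set os'}"
          using \<open>concat osl \<in> lists \<O>\<close> by blast
        then show ?thesis
          unfolding S_def using dK by (intro subsetD[OF closure_of_subset]) auto
      qed
      then show ?thesis using oss(3) by blast
    qed
    have "(\<forall>C\<in>S ` lists \<O>. closedin K C) \<and>
        (\<forall>\<F>. finite \<F> \<and> \<F> \<subseteq> S ` lists \<O> \<longrightarrow> \<Inter>\<F> \<noteq> {})"
    proof (intro conjI allI impI ballI)
      show "closedin K C" if "C \<in> S ` lists \<O>" for C
        using that by (auto simp: S_def)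
      show "\<Inter>\<F> \<noteq> {}" if "finite \<F> \<and> \<F> \<subseteq> S ` lists \<O>" for \<F>
        using * that by (cases "\<F> = {}") auto
    qed
    then have "\<Inter>(S ` lists \<O>) \<noteq> {}"
      using K(1) unfolding compact_space_fip by blast
    then obtain x' where "\<forall>os\<in>lists \<O>. x' \<in> S os" by blast
    moreover have "S [] \<subseteq> topspace K"
      by (simp add: S_def closure_of_subset_topspace)
    ultimately show ?thesis by (metis lists.Nil subsetD)
  qed
  then obtain x' where x': "x' \<in> topspace K" "\<And>os. os \<in> lists \<O> \<Longrightarrow> x' \<in> S os"
    by blast
  have "u x' \<in> U" if U: "openin Y U" "u x \<in> U" for U
  proof -
    have UO: "U \<in> \<O>" using U by (simp add: \<O>_def)
    have "d ` {os' \<in> lists \<O>. set [U] \<subseteq> set os'} \<subseteq> C U"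
      using d(2) NC(4)[OF UO] by auto
    then have "S [U] \<subseteq> C U"
      unfolding S_def using NC(2)[OF UO] by (intro closure_of_minimal)
    then show ?thesis
      using x'(2)[of "[U]"] UO NC(5)[OF UO] by auto
  qed
  then have x'V: "u x' \<in> V"
    using k_open_upward_closed[OF V x(2), of "u x'"] x'(1) u by (auto simp: continuous_map_def)
  have x'L: "x' \<in> L" using x'(2)[of "[]"] by (simp add: S_def L_def)
  \<comment> \<open>code points of \<open>L\<close> by the traces of their neighbourhoods on the index set of \<open>d\<close>\<close>
  obtain \<iota> :: "'a set list \<Rightarrow> ('a + nat) set" where \<iota>: "inj \<iota>"
    using lists_embed by blast
  define e :: "'k \<Rightarrow> ('a + nat) set set set" where
    "e z = {\<iota> ` {os \<in> lists \<O>. d os \<in> A} | A. openin K A \<and> z \<in> A}" for z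
  have LK: "L \<subseteq> topspace K" by (simp add: L_def closure_of_subset_topspace)
  have "inj_on e L"
  proof (rule inj_onI, rule ccontr)
    fix z z' assume z: "z \<in> L" "z' \<in> L" "e z = e z'" "z \<noteq> z'"
    then obtain A A' where A: "openin K A" "openin K A'" "z \<in> A" "z' \<in> A'" "disjnt A A'"
      using K(2) LK unfolding Hausdorff_space_def by (meson subsetD)
    have "\<iota> ` {os \<in> lists \<O>. d os \<in> A'} \<in> e z" using z(3) A by (auto simp: e_def)
    then obtain A2 where A2: "openin K A2" "z \<in> A2"
      "\<iota> ` {os \<in> lists \<O>. d os \<in> A'} = \<iota> ` {os \<in> lists \<O>. d os \<in> A2}"
      unfolding e_def by blast
    then have eq: "{os \<in> lists \<O>. d os \<in> A'} = {os \<in> lists \<O>. d os \<in> A2}"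
      using \<iota> by (simp add: inj_image_eq_iff)
    have "openin K (A \<inter> A2)" "z \<in> A \<inter> A2" using A A2 by auto
    then obtain os where "os \<in> lists \<O>" "d os \<in> A \<inter> A2"
      using z(1) unfolding L_def in_closure_of by blast
    then have "d os \<in> A'" "d os \<in> A" using eq by auto
    then show False using A(5) by (auto simp: disjnt_def)
  qed
  moreover have "compact_space (subtopology K L)" "Hausdorff_space (subtopology K L)"
    using K by (auto simp: L_def compact_space_subtopology closedin_compact_space Hausdorff_space_subtopology)
  moreover have "topspace (subtopology K L) = L" using LK by auto
  ultimately have "openin (subtopology K L) {z \<in> L. u z \<in> V}"
    using k_open_preimage_if_inj[OF V, of "subtopology K L" u e] u
    by (simp add: continuous_map_from_subtopology)
  then obtain A where A: "openin K A" "{z \<in> L. u z \<in> V} = A \<inter> L"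
    unfolding openin_subtopology by blast
  have "x' \<in> A" using A(2) x'V x'L by blast
  then obtain os where os: "os \<in> lists \<O>" "d os \<in> A"
    using A(1) x'L unfolding L_def in_closure_of by blast
  moreover have "d os \<in> L"
    unfolding L_def using os dK closure_of_subset by fastforce
  ultimately have "u (d os) \<in> V" using A(2) by blast
  then show False using d(1)[OF os(1)] by (simp add: W_def)
qed

lemma continuous_map_kify_compact_Hausdorff:
  assumes "compact_space K" "Hausdorff_space K" "continuous_map K Y u"
  shows "continuous_map K (kify Y) u"
  unfolding continuous_map_def
proof (intro conjI allI impI)
  show "u \<in> topspace K \<rightarrow> topspace (kify Y)"
    unfolding topspace_kify by (rule continuous_map_funspace[OF assms(3)])
  fix U assume "openin (kify Y) U"
  then show "openin K {x \<in> topspace K. u x \<in> U}"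
    using k_open_preimage[OF _ assms] by (simp add: openin_kify)
qed

lemma compactly_generated_kify: "compactly_generated (kify Y)"
proof -
  have "k_open Y U" if "k_open (kify Y) U" for U
    unfolding k_open_def
  proof (intro conjI allI impI)
    show "U \<subseteq> topspace Y" using that by (simp add: k_open_def)
    fix K :: "('a + nat) set set set topology" and u
    assume "compact_space K \<and> Hausdorff_space K \<and> continuous_map K Y u"
    then show "openin K {x \<in> topspace K. u x \<in> U}"
      using k_open_preimage[OF that] continuous_map_kify_compact_Hausdorff by blast
  qed
  then have "openin (kify (kify Y)) U = openin (kify Y) U" for U
    using openin_imp_openin_kify[of "kify Y" U] unfolding openin_kify[of _ U] by blast
  then show ?thesis
    by (simp add: compactly_generated_def topology_eq)
qed

lemma compactly_generated_compact_Hausdorff: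
  assumes "compact_space K" "Hausdorff_space K"
  shows "compactly_generated K"
proof -
  have "openin K U" if "k_open K U" for U
  proof -
    have "{x \<in> topspace K. id x \<in> U} = U" using that by (auto simp: k_open_def)
    then show ?thesis using k_open_preimage[OF that assms, of id] by simp
  qed
  then have "openin (kify K) U = openin K U" for U
    using openin_imp_openin_kify by (auto simp: openin_kify)
  then show ?thesis
    by (simp add: compactly_generated_def topology_eq)
qed

lemma continuous_map_compactly_generatedI:
  fixes Z :: "'a topology"
  assumes Z: "compactly_generated Z" and im: "f \<in> topspace Z \<rightarrow> topspace Y"
    and test: "\<And>(K :: ('a + nat) set set set topology) u. compact_space K \<Longrightarrow> Hausdorff_space K \<Longrightarrow>
      continuous_map K Z u \<Longrightarrow> continuous_map K Y (f \<circ> u)"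
  shows "continuous_map Z Y f"
  unfolding continuous_map_def
proof (intro conjI allI impI)
  show "f \<in> topspace Z \<rightarrow> topspace Y" by fact
  fix U assume U: "openin Y U"
  have "k_open Z {x \<in> topspace Z. f x \<in> U}"
    unfolding k_open_def
  proof (intro conjI allI impI)
    fix K :: "('a + nat) set set set topology" and u
    assume K: "compact_space K \<and> Hausdorff_space K \<and> continuous_map K Z u"
    then have "openin K {x \<in> topspace K. (f \<circ> u) x \<in> U}"
      using test U openin_continuous_map_preimage by blast
    moreover have "{x \<in> topspace K. (f \<circ> u) x \<in> U} = {x \<in> topspace K. u x \<in> {x \<in> topspace Z. f x \<in> U}}"
      using K by (auto simp: continuous_map_def)
    ultimately show "openin K {x \<in> topspace K. u x \<in> {x \<in> topspace Z. f x \<in> U}}"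
      by simp
  qed auto
  then show "openin Z {x \<in> topspace Z. f x \<in> U}"
    using Z by (metis compactly_generated_def openin_kify)
qed

lemma continuous_map_into_kify:
  fixes Z :: "'a topology"
  assumes "compactly_generated Z" "continuous_map Z Y f"
  shows "continuous_map Z (kify Y) f"
proof (rule continuous_map_compactly_generatedI[OF assms(1)])
  show "f \<in> topspace Z \<rightarrow> topspace (kify Y)"
    unfolding topspace_kify by (rule continuous_map_funspace[OF assms(2)])
  fix K :: "('a + nat) set set set topology" and u
  assume "compact_space K" "Hausdorff_space K" "continuous_map K Z u"
  then show "continuous_map K (kify Y) (f \<circ> u)"
    using continuous_map_kify_compact_Hausdorff[of K Y "f \<circ> u"] continuous_map_compose[of K Z u Y f] assms(2)
    by simp
qed

section \<open>Path components and maps from the 0-sphere\<close>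

definition antipode :: "nat \<Rightarrow> real" where
  "antipode = (\<lambda>i. if i = 0 then -1 else 0)"

lemma antipode_neq [simp]: "antipode \<noteq> sphere_base" "sphere_base \<noteq> antipode"
  by (auto simp: antipode_def sphere_base_def fun_eq_iff)

lemma topspace_nsphere_0: "topspace (nsphere 0) = {sphere_base, antipode}"
proof -
  have "x \<in> {sphere_base, antipode}" if "(x 0)\<^sup>2 = 1" "\<And>i. i > 0 \<Longrightarrow> x i = 0" for x :: "nat \<Rightarrow> real"
  proof -
    have "x 0 = 1 \<or> x 0 = -1" using that(1) by (simp add: power2_eq_1_iff)
    then show ?thesis using that(2) by (auto simp: antipode_def sphere_base_def fun_eq_iff)
  qed
  then show ?thesis
    by (auto simp: nsphere antipode_def sphere_base_def)
qed

lemma nsphere_0: "nsphere 0 = discrete_topology {sphere_base, antipode}"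
proof -
  have "Hausdorff_space (nsphere 0)"
    unfolding nsphere_def by (intro Hausdorff_space_subtopology Hausdorff_Euclidean_space)
  then show ?thesis
    by (metis Hausdorff_imp_t1_space finite.emptyI finite.insertI
        finite_t1_space_imp_discrete_topology topspace_nsphere_0)
qed

lemma pointed_map_0:
  "pointed_map 0 Y y g \<longleftrightarrow> g sphere_base = y \<and> y \<in> topspace Y \<and> g antipode \<in> topspace Y"
  by (auto simp: pointed_map_def nsphere_0)

text \<open>
  A pointed map from the \<open>0\<close>-sphere is a point of \<open>Y\<close>, and a pointed homotopy is a
  path between two such points.
\<close>

lemma pointed_homotopic_0:
  assumes g: "pointed_map 0 Y y g" and h: "pointed_map 0 Y y h"
  shows "pointed_homotopic 0 Y y g h \<longleftrightarrow> path_component_of Y (g antipode) (h antipode)"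
proof -
  have hom: "pointed_homotopic 0 Y y g h \<longleftrightarrow>
      (\<exists>H. continuous_map (prod_topology (top_of_set {0..1::real}) (nsphere 0)) Y H \<and>
        (\<forall>x\<in>topspace (nsphere 0). H (0, x) = g x) \<and> (\<forall>x\<in>topspace (nsphere 0). H (1, x) = h x) \<and>
        (\<forall>t\<in>{0..1}. H (t, sphere_base) = y))"
    by (rule homotopic_with) (simp add: topspace_nsphere_0)
  show ?thesis
  proof
    assume "pointed_homotopic 0 Y y g h"
    then obtain H where H: "continuous_map (prod_topology (top_of_set {0..1::real}) (nsphere 0)) Y H"
        "H (0, antipode) = g antipode" "H (1, antipode) = h antipode"
      unfolding hom by (auto simp: topspace_nsphere_0)
    have "continuous_map (top_of_set {0..1}) (prod_topology (top_of_set {0..1::real}) (nsphere 0))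
        (\<lambda>t. (t, antipode))"
      by (simp add: continuous_map_pairwise o_def topspace_nsphere_0)
    then have "continuous_map (top_of_set {0..1}) Y (H \<circ> (\<lambda>t. (t, antipode)))"
      using H(1) continuous_map_compose by blast
    then show "path_component_of Y (g antipode) (h antipode)"
      unfolding path_component_of_def pathin_def using H(2,3)
      by (intro exI[of _ "H \<circ> (\<lambda>t. (t, antipode))"]) auto
  next
    assume "path_component_of Y (g antipode) (h antipode)"
    then obtain p where p: "continuous_map (top_of_set {0..1::real}) Y p" "p 0 = g antipode" "p 1 = h antipode"
      unfolding path_component_of_def pathin_def by auto
    define H where "H = (\<lambda>(t::real, x). if x = antipode then p t else y)"
    have y: "y \<in> topspace Y" using g by (simp add: pointed_map_0)
    have "continuous_map (prod_topology (top_of_set {0..1}) (nsphere 0)) Y H"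
      unfolding continuous_map_def
    proof (intro conjI allI impI)
      show "H \<in> topspace (prod_topology (top_of_set {0..1}) (nsphere 0)) \<rightarrow> topspace Y"
        using y continuous_map_funspace[OF p(1)] by (auto simp: H_def)
      fix U assume U: "openin Y U"
      have "{z \<in> topspace (prod_topology (top_of_set {0..1}) (nsphere 0)). H z \<in> U} =
          {t \<in> topspace (top_of_set {0..1}). p t \<in> U} \<times> {antipode} \<union>
          (if y \<in> U then topspace (top_of_set {0..1}) else {}) \<times> {sphere_base}"
        by (auto simp: H_def topspace_nsphere_0)
      moreover have "openin (top_of_set {0..1}) {t \<in> topspace (top_of_set {0..1}). p t \<in> U}"
        using p(1) U openin_continuous_map_preimage by blast
      ultimately show "openin (prod_topology (top_of_set {0..1}) (nsphere 0))
          {z \<in> topspace (prod_topology (top_of_set {0..1}) (nsphere 0)). H z \<in> U}"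
        by (simp add: openin_Un openin_prod_Times_iff nsphere_0)
    qed
    then show "pointed_homotopic 0 Y y g h"
      unfolding hom using g h p(2,3)
      by (intro exI[of _ H]) (auto simp: H_def topspace_nsphere_0 pointed_map_0)
  qed
qed

lemma k_connected_space_imp_path_connected:
  assumes "k_connected_space k Y" "0 \<le> k"
  shows "path_connected_space Y"
  unfolding path_connected_space_iff_path_component
proof (intro ballI)
  fix a b assume ab: "a \<in> topspace Y" "b \<in> topspace Y"
  define g where "g = (\<lambda>x. if x = antipode then a else b)"
  have "pointed_map 0 Y b g" "pointed_map 0 Y b (\<lambda>_. b)" "g antipode = a"
    using ab by (auto simp: pointed_map_0 g_def)
  moreover from this have "pointed_homotopic 0 Y b g (\<lambda>_. b)"
    using assms ab unfolding k_connected_space_def by auto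
  ultimately show "path_component_of Y a b"
    using pointed_homotopic_0 by force
qed

text \<open>
  Path connectedness is a statement about \<open>\<pi>\<^sub>0\<close>, that is, about the case
  \<open>i = 0\<close> of the definition; the base point of the \<open>0\<close>-sphere goes to one of two given
  points and the other one to the second.
\<close>

lemma weak_homotopy_equivalence_path_connected_iff:
  assumes f: "weak_homotopy_equivalence X Y f"
  shows "path_connected_space X \<longleftrightarrow> path_connected_space Y"
proof -
  have fm: "f x \<in> topspace Y" if "x \<in> topspace X" for x
    using f that continuous_map_funspace unfolding weak_homotopy_equivalence_def by blast
  show ?thesis
  proof
    assume Y: "path_connected_space Y"
    show "path_connected_space X"
      unfolding path_connected_space_iff_path_component
    proof (intro ballI)
      fix a b assume ab: "a \<in> topspace X" "b \<in> topspace X"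
      define g where "g = (\<lambda>x. if x = antipode then a else b)"
      have g: "pointed_map 0 X b g" "pointed_map 0 X b (\<lambda>_. b)" "g antipode = a"
        "pointed_map 0 Y (f b) (f \<circ> g)" "pointed_map 0 Y (f b) (f \<circ> (\<lambda>_. b))"
        using ab fm by (auto simp: pointed_map_0 g_def)
      have "path_component_of Y (f a) (f b)"
        using Y ab fm by (simp add: path_connected_space_iff_path_component)
      then have "pointed_homotopic 0 Y (f b) (f \<circ> g) (f \<circ> (\<lambda>_. b))"
        using pointed_homotopic_0[OF g(4,5)] g(3) by simp
      then have "pointed_homotopic 0 X b g (\<lambda>_. b)"
        using f g(1,2) ab unfolding weak_homotopy_equivalence_def by blast
      then show "path_component_of X a b"
        using pointed_homotopic_0[OF g(1,2)] g(3) by simp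
    qed
  next
    assume X: "path_connected_space X"
    show "path_connected_space Y"
    proof (cases "topspace X = {}")
      case True
      then have "topspace Y = {}" using f by (simp add: weak_homotopy_equivalence_def)
      then show ?thesis by (simp add: path_connected_space_iff_path_component)
    next
      case False
      then obtain x where x: "x \<in> topspace X" by blast
      have "path_component_of Y (f x) y" if y: "y \<in> topspace Y" for y
      proof -
        define h where "h = (\<lambda>z. if z = antipode then y else f x)"
        have h: "pointed_map 0 Y (f x) h" "h antipode = y"
          using x y fm by (auto simp: pointed_map_0 h_def)
        obtain g where g: "pointed_map 0 X x g" "pointed_homotopic 0 Y (f x) (f \<circ> g) h"
          using f h(1) x unfolding weak_homotopy_equivalence_def by blast
        have ga: "g antipode \<in> topspace X" using g(1) by (simp add: pointed_map_0)
        have "pointed_map 0 Y (f x) (f \<circ> g)"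
          using g(1) fm by (auto simp: pointed_map_0)
        then have "path_component_of Y (f (g antipode)) y"
          using pointed_homotopic_0 h g(2) by fastforce
        moreover have "path_component_of X x (g antipode)"
          using X x ga by (simp add: path_connected_space_iff_path_component)
        then have "path_component_of Y (f x) (f (g antipode))"
          using f path_component_of_continuous_image unfolding weak_homotopy_equivalence_def by fastforce
        ultimately show ?thesis using path_component_of_trans by fast
      qed
      then show ?thesis
        unfolding path_connected_space_iff_path_component
        by (meson path_component_of_sym path_component_of_trans)
    qed
  qed
qed

section \<open>Connectedness of the spaces of little discs\<close>

lemma path_component_of_tuple:
  fixes \<phi> :: "'i \<Rightarrow> real \<Rightarrow> 'b :: topological_space"
  assumes "continuous_on {0..1} s" "\<And>i. i \<in> I \<Longrightarrow> continuous_on {0..1} (\<phi> i)"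
    and "\<And>t. t \<in> {0..1} \<Longrightarrow> (s t, \<lambda>i\<in>I. \<phi> i t) \<in> S"
  shows "path_component_of
    (subtopology (prod_topology euclideanreal (product_topology (\<lambda>_. euclidean) I)) S)
    (s 0, \<lambda>i\<in>I. \<phi> i 0) (s 1, \<lambda>i\<in>I. \<phi> i 1)"
  unfolding path_component_of_def pathin_def
  using assms
  by (intro exI[of _ "\<lambda>t. (s t, \<lambda>i\<in>I. \<phi> i t)"])
     (auto simp: continuous_map_in_subtopology continuous_map_pairwise o_def
        continuous_map_componentwise)

lemma eventually_at_right_0_imp_ex:
  assumes "eventually Q (at_right (0::real))"
  obtains e where "e > 0" "Q e"
proof -
  have "eventually (\<lambda>e. Q e \<and> e > 0) (at_right (0::real))"
    using assms eventually_at_right_less by (rule eventually_conj)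
  then show ?thesis
    using that eventually_happens trivial_limit_at_right_real by blast
qed

lemma eventually_at_right_0_le: "c > 0 \<Longrightarrow> eventually (\<lambda>e. e \<le> c) (at_right (0::real))"
  by (metis eventually_at_right_field less_imp_le)

text \<open>
  Consider the complex line \<open>v + \<tau> (w - v)\<close> through the two configurations. Two of its
  coordinates collide for at most one parameter \<open>\<tau>\<close>, so the parameters without collision for
  which all points remain in \<open>D\<close> form an open convex set of complex numbers with finitely many
  points removed. This set is path connected and contains \<open>0\<close> and \<open>1\<close>. The freedom to
  go around a collision is the reason for the use of complex parameters.
\<close>

lemma configurations_path:
  fixes v w :: "'i \<Rightarrow> complex"
  assumes I: "finite I" and D: "open D" "convex D"
    and v: "inj_on v I" "v ` I \<subseteq> D" and w: "inj_on w I" "w ` I \<subseteq> D"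
  obtains p where "\<And>i. i \<in> I \<Longrightarrow> continuous_on {0..1} (p i)"
    and "\<And>i. i \<in> I \<Longrightarrow> p i 0 = v i" and "\<And>i. i \<in> I \<Longrightarrow> p i 1 = w i"
    and "\<And>i t. i \<in> I \<Longrightarrow> t \<in> {0..1::real} \<Longrightarrow> p i t \<in> D"
    and "\<And>i j t. i \<in> I \<Longrightarrow> j \<in> I \<Longrightarrow> i \<noteq> j \<Longrightarrow> t \<in> {0..1} \<Longrightarrow> p i t \<noteq> p j t"
proof -
  define l where "l i \<tau> = v i + \<tau> * (w i - v i)" for i \<tau>
  define T where "T = (\<Inter>i\<in>I. l i -` D)"
  define B where "B = (\<Union>i\<in>I. \<Union>j\<in>I - {i}. {\<tau>. l i \<tau> = l j \<tau>})"
  have cl: "continuous_on UNIV (l i)" for i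
    unfolding l_def by (intro continuous_intros)
  have openT: "open T"
    unfolding T_def using I D(1) cl by (auto intro!: open_INT open_vimage)
  have convT: "convex T"
    unfolding T_def
  proof (rule convex_INT)
    fix i
    show "convex (l i -` D)"
    proof (rule convexI)
      fix x y and a b :: real
      assume "x \<in> l i -` D" "y \<in> l i -` D" "0 \<le> a" "0 \<le> b" "a + b = 1"
      then have "a *\<^sub>R l i x + b *\<^sub>R l i y \<in> D" using D(2) by (auto intro: convexD)
      moreover have "l i (a *\<^sub>R x + b *\<^sub>R y) = a *\<^sub>R l i x + b *\<^sub>R l i y"
      proof -
        have b: "b = 1 - a" using \<open>a + b = 1\<close> by simp
        show ?thesis
          unfolding l_def b by (simp add: scaleR_conv_of_real algebra_simps)
      qed
      ultimately show "a *\<^sub>R x + b *\<^sub>R y \<in> l i -` D" by simp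
    qed
  qed
  have countB: "countable B"
    unfolding B_def
  proof (intro countable_UN countable_finite)
    show "finite I" "\<And>i. finite (I - {i})" using I by auto
    fix i j assume ij: "i \<in> I" "j \<in> I - {i}"
    define a b where "a = v i - v j" and "b = (w i - v i) - (w j - v j)"
    have "a \<noteq> 0" using ij v(1) by (auto simp: a_def inj_on_def)
    have eq: "l i \<tau> = l j \<tau> \<longleftrightarrow> a + \<tau> * b = 0" for \<tau>
      by (auto simp: l_def a_def b_def algebra_simps)
    have "{\<tau>. l i \<tau> = l j \<tau>} \<subseteq> {- a / b}"
    proof
      fix \<tau> assume "\<tau> \<in> {\<tau>. l i \<tau> = l j \<tau>}"
      then have *: "a + \<tau> * b = 0" using eq by simp
      then have "b \<noteq> 0" using \<open>a \<noteq> 0\<close> by auto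
      then show "\<tau> \<in> {- a / b}" using * by (simp add: field_simps add_eq_0_iff)
    qed
    then show "finite {\<tau>. l i \<tau> = l j \<tau>}" using finite_subset by blast
  qed
  have "path_connected (T - B)"
    by (rule path_connected_open_diff_countable[OF _ openT convex_connected[OF convT] countB]) simp
  moreover have "0 \<in> T - B" "1 \<in> T - B"
    using v w by (auto simp: T_def B_def l_def inj_on_def)
  ultimately obtain g where g: "path g" "path_image g \<subseteq> T - B" "pathstart g = 0" "pathfinish g = 1"
    unfolding path_connected_def by metis
  have gT: "g t \<in> T - B" if "t \<in> {0..1}" for t
    using g(2) that unfolding path_image_def by blast
  show ?thesis
  proof (rule that[of "\<lambda>i t. l i (g t)"])
    show "continuous_on {0..1} (\<lambda>t. l i (g t))" for i
      using g(1) unfolding path_def l_def by (intro continuous_intros)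
    show "l i (g 0) = v i" "l i (g 1) = w i" for i
      using g(3,4) by (auto simp: l_def pathstart_def pathfinish_def)
    show "l i (g t) \<in> D" if "i \<in> I" "t \<in> {0..1}" for i t
      using gT[OF that(2)] that(1) by (auto simp: T_def)
    show "l i (g t) \<noteq> l j (g t)" if "i \<in> I" "j \<in> I" "i \<noteq> j" "t \<in> {0..1}" for i j t
      using gT[OF that(4)] that(1-3) by (auto simp: B_def)
  qed
qed

text \<open>
  By compactness the moving points stay away from each other and from the boundary of \<open>D\<close>, so they
  can be thickened to discs of any sufficiently small radius.
\<close>

lemma equal_radius_discs_path:
  fixes v w :: "'i \<Rightarrow> complex"
  assumes I: "finite I" and D: "open D" "convex D"
    and v: "inj_on v I" "v ` I \<subseteq> D" and w: "inj_on w I" "w ` I \<subseteq> D"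
  shows "\<forall>\<^sub>F e in at_right 0. \<exists>p. (\<forall>i\<in>I. continuous_on {0..1} (p i) \<and> p i 0 = v i \<and> p i 1 = w i \<and>
    (\<forall>t\<in>{0..1::real}. cball (p i t) e \<subseteq> D \<and> (\<forall>j\<in>I - {i}. ball (p i t) e \<inter> ball (p j t) e = {})))"
proof -
  obtain p where p: "\<And>i. i \<in> I \<Longrightarrow> continuous_on {0..1} (p i)"
    "\<And>i. i \<in> I \<Longrightarrow> p i 0 = v i" "\<And>i. i \<in> I \<Longrightarrow> p i 1 = w i"
    "\<And>i t. i \<in> I \<Longrightarrow> t \<in> {0..1::real} \<Longrightarrow> p i t \<in> D"
    "\<And>i j t. i \<in> I \<Longrightarrow> j \<in> I \<Longrightarrow> i \<noteq> j \<Longrightarrow> t \<in> {0..1} \<Longrightarrow> p i t \<noteq> p j t"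
    by (rule configurations_path[OF assms]) (rule that)
  have 1: "\<forall>\<^sub>F e in at_right 0. \<forall>t\<in>{0..1}. cball (p i t) e \<subseteq> D" if i: "i \<in> I" for i
  proof -
    have "compact (p i ` {0..1})" "p i ` {0..1} \<subseteq> D"
      using p(1,4) i by (auto intro: compact_continuous_image)
    then obtain \<epsilon> where \<epsilon>: "\<epsilon> > 0" "(\<Union>x\<in>p i ` {0..1}. ball x \<epsilon>) \<subseteq> D"
      using D(1) compact_subset_open_imp_ball_epsilon_subset by metis
    show ?thesis
    proof (rule eventually_mono[OF eventually_at_right_0_le[of "\<epsilon> / 2"]])
      fix e assume "e \<le> \<epsilon> / 2"
      then have "cball (p i t) e \<subseteq> ball (p i t) \<epsilon>" for t using \<epsilon>(1) by auto
      then show "\<forall>t\<in>{0..1}. cball (p i t) e \<subseteq> D" using \<epsilon>(2) by blast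
    qed (use \<epsilon> in auto)
  qed
  have 2: "\<forall>\<^sub>F e in at_right 0. \<forall>t\<in>{0..1}. ball (p i t) e \<inter> ball (p j t) e = {}"
    if ij: "i \<in> I" "j \<in> I - {i}" for i j
  proof -
    let ?q = "\<lambda>t. p i t - p j t"
    have "compact (?q ` {0..1})" "?q ` {0..1} \<subseteq> - {0}"
      using p(1,5) ij by (auto intro!: compact_continuous_image continuous_intros)
    then obtain \<epsilon> where \<epsilon>: "\<epsilon> > 0" "(\<Union>x\<in>?q ` {0..1}. ball x \<epsilon>) \<subseteq> - {0}"
      using compact_subset_open_imp_ball_epsilon_subset[of "?q ` {0..1}" "- {0}"] by auto
    show ?thesis
    proof (rule eventually_mono[OF eventually_at_right_0_le[of "\<epsilon> / 2"]])
      fix e assume e: "e \<le> \<epsilon> / 2"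
      show "\<forall>t\<in>{0..1}. ball (p i t) e \<inter> ball (p j t) e = {}"
      proof (intro ballI disjoint_ballI)
        fix t :: real assume t: "t \<in> {0..1}"
        have "0 \<notin> ball (?q t) \<epsilon>" using \<epsilon>(2) t by blast
        then show "e + e \<le> dist (p i t) (p j t)" using e by (simp add: dist_norm)
      qed
    qed (use \<epsilon> in auto)
  qed
  have "\<forall>\<^sub>F e in at_right 0. \<forall>i\<in>I. (\<forall>t\<in>{0..1}. cball (p i t) e \<subseteq> D) \<and>
      (\<forall>j\<in>I - {i}. \<forall>t\<in>{0..1}. ball (p i t) e \<inter> ball (p j t) e = {})"
    using I by (intro eventually_ball_finite[OF I] eventually_ball_finite[of "I - _"] ballI eventually_conj 1 2) auto
  then show ?thesis
  proof (rule eventually_mono)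
    fix e assume e: "\<forall>i\<in>I. (\<forall>t\<in>{0..1}. cball (p i t) e \<subseteq> D) \<and>
      (\<forall>j\<in>I - {i}. \<forall>t\<in>{0..1}. ball (p i t) e \<inter> ball (p j t) e = {})"
    show "\<exists>p. (\<forall>i\<in>I. continuous_on {0..1} (p i) \<and> p i 0 = v i \<and> p i 1 = w i \<and>
      (\<forall>t\<in>{0..1::real}. cball (p i t) e \<subseteq> D \<and> (\<forall>j\<in>I - {i}. ball (p i t) e \<inter> ball (p j t) e = {})))"
      using e p(1-3) by (intro exI[of _ p]) blast
  qed
qed

definition strip :: "real \<Rightarrow> complex set" where
  "strip s = {z. 0 < Re z \<and> Re z < s \<and> -1 < Im z \<and> Im z < 1}"

lemma open_strip: "open (strip s)"
  unfolding strip_def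
  by (intro open_Collect_conj open_Collect_less continuous_intros)

lemma convex_strip: "convex (strip s)"
proof -
  have "strip s = {z. Re z > 0} \<inter> {z. Re z < s} \<inter> {z. Im z > -1} \<inter> {z. Im z < 1}"
    by (auto simp: strip_def)
  then show ?thesis
    by (simp add: convex_Int convex_halfspace_Re_gt convex_halfspace_Re_lt
        convex_halfspace_Im_gt convex_halfspace_Im_lt)
qed

lemma strip_mono: "s \<le> s' \<Longrightarrow> strip s \<subseteq> strip s'"
  by (auto simp: strip_def)

definition strip_discs :: "nat set \<Rightarrow> sc set" where
  "strip_discs I = {(s, \<phi>). 0 \<le> s \<and> \<phi> \<in> little_discs_in (strip s) I}"

abbreviation strip_disc_space :: "nat set \<Rightarrow> sc topology" where
  "strip_disc_space I \<equiv>
     subtopology (prod_topology euclideanreal (product_topology (\<lambda>_. euclidean) I)) (strip_discs I)"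

lemma strip_discs_mem_iff:
  "(s, \<lambda>i\<in>I. (r i, v i)) \<in> strip_discs I \<longleftrightarrow> 0 \<le> s \<and>
     (\<forall>i\<in>I. 0 < r i \<and> cball (v i) (r i) \<subseteq> strip s \<and>
        (\<forall>j\<in>I - {i}. ball (v i) (r i) \<inter> ball (v j) (r j) = {}))"
  unfolding strip_discs_def little_discs_in_def disjoint_family_on_def by simp blast

lemma strip_discs_shrink:
  assumes "(s, \<lambda>i\<in>I. (r i, v i)) \<in> strip_discs I" "s \<le> s'" "\<And>i. i \<in> I \<Longrightarrow> 0 < r' i \<and> r' i \<le> r i"
  shows "(s', \<lambda>i\<in>I. (r' i, v i)) \<in> strip_discs I"
proof -
  have 1: "ball (v i) (r' i) \<subseteq> ball (v i) (r i)" "cball (v i) (r' i) \<subseteq> cball (v i) (r i)" if "i \<in> I" for i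
    using assms(3)[OF that] by auto
  show ?thesis
    using assms 1 strip_mono[OF assms(2)] unfolding strip_discs_mem_iff by (smt (verit) DiffD1 disjoint_iff subset_iff)
qed

lemma strip_discs_shrink_path:
  assumes "(s, \<lambda>i\<in>I. (r i, v i)) \<in> strip_discs I" "s \<le> s'" "0 < e" "\<And>i. i \<in> I \<Longrightarrow> e \<le> r i"
  shows "path_component_of (strip_disc_space I) (s, \<lambda>i\<in>I. (r i, v i)) (s', \<lambda>i\<in>I. (e, v i))"
proof -
  have "path_component_of (strip_disc_space I)
    (s + 0 * (s' - s), \<lambda>i\<in>I. (r i + 0 * (e - r i), v i)) (s + 1 * (s' - s), \<lambda>i\<in>I. (r i + 1 * (e - r i), v i))"
  proof (rule path_component_of_tuple)
    fix t :: real assume t: "t \<in> {0..1}"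
    have "0 < r i + t * (e - r i) \<and> r i + t * (e - r i) \<le> r i" if "i \<in> I" for i
    proof -
      have "e \<le> r i" using assms(4) that by simp
      then have "t * (r i - e) \<le> r i - e" "0 \<le> t * (r i - e)"
        using t mult_right_mono[of t 1 "r i - e"] by auto
      moreover have "t * (e - r i) = - (t * (r i - e))" by (simp add: algebra_simps)
      ultimately show ?thesis using assms(3) by linarith
    qed
    then show "(s + t * (s' - s), \<lambda>i\<in>I. (r i + t * (e - r i), v i)) \<in> strip_discs I"
      using t assms(1,2) by (intro strip_discs_shrink[OF assms(1)]) auto
  qed (intro continuous_intros)+
  then show ?thesis by simp
qed

text \<open>
  Enlarge the two strips to a common one, shrink all discs to a common small radius, and move their centres.
\<close>

lemma path_connected_strip_discs:
  assumes I: "finite I"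
  shows "path_connected_space (strip_disc_space I)"
  unfolding path_connected_space_iff_path_component
proof (intro ballI)
  fix x y assume xy: "x \<in> topspace (strip_disc_space I)" "y \<in> topspace (strip_disc_space I)"
  have repr: "\<exists>s r v. z = (s, \<lambda>i\<in>I. (r i, v i))" if "z \<in> topspace (strip_disc_space I)" for z
  proof -
    have "z = (fst z, \<lambda>i\<in>I. (fst (snd z i), snd (snd z i)))"
      using that by (auto simp: PiE_iff extensional_restrict prod_eq_iff)
    then show ?thesis
      by (intro exI[of _ "fst z"] exI[of _ "\<lambda>i. fst (snd z i)"] exI[of _ "\<lambda>i. snd (snd z i)"])
  qed
  obtain s r v where x: "x = (s, \<lambda>i\<in>I. (r i, v i))" using repr[OF xy(1)] by blast
  obtain s' r' w where y: "y = (s', \<lambda>i\<in>I. (r' i, w i))" using repr[OF xy(2)] by blast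
  have xy': "(s, \<lambda>i\<in>I. (r i, v i)) \<in> strip_discs I" "(s', \<lambda>i\<in>I. (r' i, w i)) \<in> strip_discs I"
    using xy x y by auto
  have centres: "inj_on v I" "v ` I \<subseteq> strip s" if "(s, \<lambda>i\<in>I. (r i, v i)) \<in> strip_discs I" for s r v
  proof -
    have *: "0 < r i" "cball (v i) (r i) \<subseteq> strip s" "j \<in> I \<Longrightarrow> i \<noteq> j \<Longrightarrow> ball (v i) (r i) \<inter> ball (v j) (r j) = {}"
      if "i \<in> I" for i j
      using that \<open>(s, \<lambda>i\<in>I. (r i, v i)) \<in> strip_discs I\<close> unfolding strip_discs_mem_iff by auto
    show "inj_on v I"
      using * by (intro inj_onI) (metis IntI centre_in_ball empty_iff)
    show "v ` I \<subseteq> strip s"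
      using * by (force intro: less_imp_le)
  qed
  define S where "S = max s s'"
  have "v ` I \<subseteq> strip S" "w ` I \<subseteq> strip S"
    using centres(2)[OF xy'(1)] centres(2)[OF xy'(2)] strip_mono[of s S] strip_mono[of s' S]
    by (auto simp: S_def)
  then have "\<forall>\<^sub>F e in at_right 0. \<exists>p. (\<forall>i\<in>I. continuous_on {0..1} (p i) \<and> p i 0 = v i \<and> p i 1 = w i \<and>
    (\<forall>t\<in>{0..1::real}. cball (p i t) e \<subseteq> strip S \<and> (\<forall>j\<in>I - {i}. ball (p i t) e \<inter> ball (p j t) e = {})))"
    using centres(1)[OF xy'(1)] centres(1)[OF xy'(2)] I open_strip convex_strip
    by (intro equal_radius_discs_path) auto
  moreover have "\<forall>\<^sub>F e in at_right 0. \<forall>i\<in>I. e \<le> r i \<and> e \<le> r' i"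
    using xy' I unfolding strip_discs_mem_iff
    by (intro eventually_ball_finite ballI eventually_conj eventually_at_right_0_le) auto
  ultimately have "\<forall>\<^sub>F e in at_right 0. (\<exists>p. (\<forall>i\<in>I. continuous_on {0..1} (p i) \<and> p i 0 = v i \<and> p i 1 = w i \<and>
    (\<forall>t\<in>{0..1::real}. cball (p i t) e \<subseteq> strip S \<and> (\<forall>j\<in>I - {i}. ball (p i t) e \<inter> ball (p j t) e = {})))) \<and>
    (\<forall>i\<in>I. e \<le> r i \<and> e \<le> r' i)"
    by (rule eventually_conj)
  then obtain e where e0: "e > 0" and *: "(\<exists>p. (\<forall>i\<in>I. continuous_on {0..1} (p i) \<and> p i 0 = v i \<and> p i 1 = w i \<and>
    (\<forall>t\<in>{0..1::real}. cball (p i t) e \<subseteq> strip S \<and> (\<forall>j\<in>I - {i}. ball (p i t) e \<inter> ball (p j t) e = {})))) \<and>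
    (\<forall>i\<in>I. e \<le> r i \<and> e \<le> r' i)"
    by (rule eventually_at_right_0_imp_ex)
  from *[THEN conjunct1] obtain p where p': "\<forall>i\<in>I. continuous_on {0..1} (p i) \<and> p i 0 = v i \<and> p i 1 = w i \<and>
    (\<forall>t\<in>{0..1::real}. cball (p i t) e \<subseteq> strip S \<and> (\<forall>j\<in>I - {i}. ball (p i t) e \<inter> ball (p j t) e = {}))"
    by (rule exE)
  have p: "continuous_on {0..1} (p i)" "p i 0 = v i" "p i 1 = w i" if "i \<in> I" for i
    using p'[rule_format, OF that] by simp_all
  have q: "\<forall>i\<in>I. cball (p i t) e \<subseteq> strip S \<and> (\<forall>j\<in>I - {i}. ball (p i t) e \<inter> ball (p j t) e = {})"
    if "t \<in> {0..1}" for t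
    using p' that by blast
  have e: "e > 0" "\<And>i. i \<in> I \<Longrightarrow> e \<le> r i" "\<And>i. i \<in> I \<Longrightarrow> e \<le> r' i"
    using e0 *[THEN conjunct2] by simp_all
  have "path_component_of (strip_disc_space I) (S, \<lambda>i\<in>I. (e, p i 0)) (S, \<lambda>i\<in>I. (e, p i 1))"
  proof (rule path_component_of_tuple)
    fix t :: real assume "t \<in> {0..1}"
    then show "(S, \<lambda>i\<in>I. (e, p i t)) \<in> strip_discs I"
      using q e(1) xy' unfolding strip_discs_mem_iff by (auto simp: S_def)
  qed (use p(1) in \<open>auto intro!: continuous_intros\<close>)
  moreover have "(\<lambda>i\<in>I. (e, p i 0)) = (\<lambda>i\<in>I. (e, v i))" "(\<lambda>i\<in>I. (e, p i 1)) = (\<lambda>i\<in>I. (e, w i))"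
    using p by (auto intro: restrict_ext)
  moreover have "path_component_of (strip_disc_space I) x (S, \<lambda>i\<in>I. (e, v i))"
    unfolding x using e xy' by (intro strip_discs_shrink_path) (auto simp: S_def)
  moreover have "path_component_of (strip_disc_space I) y (S, \<lambda>i\<in>I. (e, w i))"
    unfolding y using e xy' by (intro strip_discs_shrink_path) (auto simp: S_def)
  ultimately show "path_component_of (strip_disc_space I) x y"
    using path_component_of_trans[OF path_component_of_trans] path_component_of_sym by fastforce
qed

lemma path_connected_SC2: "path_connected_space (ops SC2 (mprof k) \<mm>)"
proof -
  have "sc_set (mprof k) \<mm> = strip_discs (alg_inputs (mprof k))"
    by (simp add: sc_set_def mprof_def count_list_0_iff strip_discs_def strip_def)
  moreover have "finite (alg_inputs (mprof k))"
    by (simp add: alg_inputs_def)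
  ultimately show ?thesis
    using path_connected_strip_discs by (simp add: SC2_def)
qed

lemma path_connected_ops_mprof:
  assumes "E12_operad TYPE('z) P"
  shows "path_connected_space (ops P (mprof k) \<mm>)"
proof -
  have linked: "path_connected_space (ops A (mprof k) \<mm>) \<longleftrightarrow> path_connected_space (ops B (mprof k) \<mm>)"
    if "we_linked A B" for A :: "'p operad_data" and B :: "'q operad_data"
    using that unfolding we_linked_def operad_weak_equivalence_def
    by (auto dest!: spec[of _ "mprof k"] dest: spec[of _ \<mm>] weak_homotopy_equivalence_path_connected_iff)
  obtain Q Q' :: "'z operad_data" where Q: "we_linked P Q"
    "(\<lambda>A B. operad B \<and> we_linked A B)\<^sup>*\<^sup>* Q Q'" "we_linked Q' SC2"
    using assms unfolding E12_operad_def by blast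
  from Q(2) have "path_connected_space (ops Q (mprof k) \<mm>) \<longleftrightarrow> path_connected_space (ops Q' (mprof k) \<mm>)"
    by induction (auto simp: linked)
  then show ?thesis
    using linked[OF Q(1)] linked[OF Q(3)] path_connected_SC2 by simp
qed

section \<open>Spaces of operations and their action\<close>

lemma continuous_map_mem: "continuous_map X Y f \<Longrightarrow> x \<in> topspace X \<Longrightarrow> f x \<in> topspace Y"
  using continuous_map_funspace by blast

lemma topspace_quotient_topology: "topspace (quotient_topology X r) = topspace X // r"
proof (rule antisym)
  show "topspace (quotient_topology X r) \<subseteq> topspace X // r"
    using openin_topspace[of "quotient_topology X r"] unfolding openin_quotient_topology by blast
  have "{x \<in> topspace X. r `` {x} \<in> topspace X // r} = topspace X"
    by (auto intro: quotientI)
  then have "openin (quotient_topology X r) (topspace X // r)"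
    by (simp add: openin_quotient_topology)
  then show "topspace X // r \<subseteq> topspace (quotient_topology X r)"
    by (rule openin_subset)
qed

lemma length_mprof [simp]: "length (mprof k) = Suc k"
  by (simp add: mprof_def)

lemma nth_mprof: "i \<le> k \<Longrightarrow> mprof k ! i = (if i = 0 then \<mm> else \<aa>)"
  by (cases i) (auto simp: mprof_def)

lemma mprof_concat: "concat (mprof j # replicate k [\<aa>]) = mprof (j + k)"
proof -
  have "concat (replicate k [\<aa>]) = replicate k \<aa>"
    by (induction k) auto
  then show ?thesis
    by (simp add: mprof_def replicate_add)
qed

lemma permutes_mprof:
  assumes "\<sigma> permutes {1..k}"
  shows "\<sigma> permutes {..<Suc k}" "permute_list \<sigma> (mprof k) = mprof k"
proof -
  show 1: "\<sigma> permutes {..<Suc k}"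
    using assms by (rule permutes_subset) auto
  have "mprof k ! \<sigma> i = mprof k ! i" if i: "i \<le> k" for i
  proof (cases "i = 0")
    case True
    then show ?thesis using assms by (simp add: permutes_not_in)
  next
    case False
    then have "\<sigma> i \<in> {1..k}" using i permutes_in_image[OF assms, of i] by auto
    then show ?thesis using i False by (simp add: nth_mprof)
  qed
  then show "permute_list \<sigma> (mprof k) = mprof k"
    using 1 by (intro nth_equalityI) (auto simp: permute_list_nth)
qed

abbreviation inputs :: "nat \<Rightarrow> 'x \<Rightarrow> 'x \<Rightarrow> nat \<Rightarrow> 'x" where
  "inputs k A X \<equiv> (\<lambda>i\<in>{..k}. if i = 0 then A else X)"

lemma self_mem_orbit:
  assumes "operad P" "x \<in> topspace (ops P (mprof k) \<mm>)"
  shows "x \<in> orbit P k x"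
proof -
  have "perm P id (mprof k) \<mm> x = x"
    using assms unfolding operad_def operad_symmetric_def by blast
  then have "(x, x) \<in> orbit_rel P k"
    unfolding orbit_rel_def using assms(2) permutes_id[of "{1..k}"]
    by (intro CollectI exI[of _ x] exI[of _ id]) simp
  then show ?thesis by (simp add: orbit_def)
qed

lemma orbit_subset:
  assumes P: "operad P" and x: "x \<in> topspace (ops P (mprof k) \<mm>)"
  shows "orbit P k x \<subseteq> topspace (ops P (mprof k) \<mm>)"
proof
  fix y assume "y \<in> orbit P k x"
  then obtain \<sigma> where \<sigma>: "\<sigma> permutes {1..k}" "y = perm P \<sigma> (mprof k) \<mm> x"
    by (auto simp: orbit_def orbit_rel_def)
  have "continuous_map (ops P (mprof k) \<mm>) (ops P (permute_list \<sigma> (mprof k)) \<mm>) (perm P \<sigma> (mprof k) \<mm>)"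
    using P permutes_mprof(1)[OF \<sigma>(1)] unfolding operad_def operad_symmetric_def by simp
  then show "y \<in> topspace (ops P (mprof k) \<mm>)"
    using x \<sigma>(2) permutes_mprof(2)[OF \<sigma>(1)] continuous_map_funspace by fastforce
qed

lemma topspace_orbit_space:
  "topspace (orbit_space P k) = orbit P k ` topspace (ops P (mprof k) \<mm>)"
  by (auto simp: orbit_space_def topspace_quotient_topology quotient_def orbit_def)

lemma some_in_orbit_space:
  assumes P: "operad P" and d: "d \<in> topspace (orbit_space P k)"
  shows "(SOME x. x \<in> d) \<in> topspace (ops P (mprof k) \<mm>)" "(SOME x. x \<in> d) \<in> d"
proof -
  obtain x where x: "x \<in> topspace (ops P (mprof k) \<mm>)" "d = orbit P k x"
    using d unfolding topspace_orbit_space by blast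
  then show 1: "(SOME x. x \<in> d) \<in> d"
    using self_mem_orbit[OF P x(1)] by (simp add: some_in_eq) blast
  then show "(SOME x. x \<in> d) \<in> topspace (ops P (mprof k) \<mm>)"
    using orbit_subset[OF P x(1)] x(2) by blast
qed

lemma gam_left_in_ops:
  assumes P: "operad P" and e: "e \<in> topspace (ops P (mprof k) \<mm>)" and d: "d \<in> topspace (ops P (mprof j) \<mm>)"
  shows "gam_left P j k e d \<in> topspace (ops P (mprof (j + k)) \<mm>)"
    and "(\<lambda>i\<in>{..k}. if i = 0 then d else opid P \<aa>) \<in>
      topspace (op_tuples P (mprof j # replicate k [\<aa>]) (mprof k))"
proof -
  let ?dss = "mprof j # replicate k [\<aa>]"
  let ?y = "\<lambda>i\<in>{..k}. if i = 0 then d else opid P \<aa>"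
  have o: "opid P \<aa> \<in> topspace (ops P [\<aa>] \<aa>)"
    using P by (simp add: operad_def operad_unital_def)
  have "?y i \<in> topspace (ops P (?dss ! i) (mprof k ! i))" if "i \<le> k" for i
    using that o d by (cases i) (auto simp: nth_mprof)
  then show y: "?y \<in> topspace (op_tuples P ?dss (mprof k))"
    unfolding op_tuples_def topspace_kify topspace_product_topology length_mprof lessThan_Suc_atMost
    by (intro PiE_I) auto
  have "continuous_map (kprod (ops P (mprof k) \<mm>) (op_tuples P ?dss (mprof k))) (ops P (concat ?dss) \<mm>)
      (\<lambda>(x, y). gam P (mprof k) \<mm> ?dss x y)"
    using P unfolding operad_def by (simp del: concat.simps)
  then have "(\<lambda>(x, y). gam P (mprof k) \<mm> ?dss x y) (e, ?y) \<in> topspace (ops P (concat ?dss) \<mm>)"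
    by (rule continuous_map_mem) (use e y in simp)
  then show "gam_left P j k e d \<in> topspace (ops P (mprof (j + k)) \<mm>)"
    by (simp add: gam_left_def mprof_concat del: concat.simps)
qed

lemma cpow_in_ops:
  assumes "operad P" "c \<in> topspace (ops P (mprof 1) \<mm>)"
  shows "cpow P c k \<in> topspace (ops P (mprof k) \<mm>)"
proof (induction k)
  case 0
  then show ?case using assms(1) by (simp add: operad_def operad_unital_def mprof_def)
next
  case (Suc k)
  then show ?case using gam_left_in_ops(1)[OF assms(1,2) Suc] by simp
qed

lemma theta_in_space:
  assumes M: "graded_algebra P M" and e: "e \<in> topspace (ops P (mprof k) \<mm>)"
    and A: "A \<in> topspace (sp M \<mm>)" and X: "X \<in> topspace (sp M \<aa>)"
  shows "inputs k A X \<in> topspace (sp_tuples M (mprof k))"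
    and "theta M (mprof k) \<mm> e (inputs k A X) \<in> topspace (sp M \<mm>)"
proof -
  show 1: "inputs k A X \<in> topspace (sp_tuples M (mprof k))"
    unfolding sp_tuples_def topspace_kify topspace_product_topology length_mprof lessThan_Suc_atMost
    using A X by (intro PiE_I) (auto simp: nth_mprof)
  have "continuous_map (kprod (ops P (mprof k) \<mm>) (sp_tuples M (mprof k))) (sp M \<mm>)
      (\<lambda>(d, x). theta M (mprof k) \<mm> d x)"
    using M unfolding graded_algebra_def by blast
  then have "(\<lambda>(d, x). theta M (mprof k) \<mm> d x) (e, inputs k A X) \<in> topspace (sp M \<mm>)"
    by (rule continuous_map_mem) (use e 1 in simp)
  then show "theta M (mprof k) \<mm> e (inputs k A X) \<in> topspace (sp M \<mm>)"
    by simp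
qed

lemma continuous_map_theta:
  assumes M: "graded_algebra P M" and X: "X \<in> topspace (sp M \<aa>)" and Z: "compactly_generated Z"
    and g: "continuous_map Z (ops P (mprof k) \<mm>) g" and h: "continuous_map Z (sp M \<mm>) h"
  shows "continuous_map Z (sp M \<mm>) (\<lambda>z. theta M (mprof k) \<mm> (g z) (inputs k (h z) X))"
proof -
  have "continuous_map Z (product_topology (\<lambda>i. sp M (mprof k ! i)) {..<length (mprof k)})
      (\<lambda>z. inputs k (h z) X)"
    unfolding continuous_map_componentwise length_mprof lessThan_Suc_atMost
    using h X by (auto simp: nth_mprof)
  then have "continuous_map Z (sp_tuples M (mprof k)) (\<lambda>z. inputs k (h z) X)"
    unfolding sp_tuples_def by (rule continuous_map_into_kify[OF Z])
  then have "continuous_map Z (prod_topology (ops P (mprof k) \<mm>) (sp_tuples M (mprof k)))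
      (\<lambda>z. (g z, inputs k (h z) X))"
    using g by (simp add: continuous_map_pairwise o_def)
  then have 1: "continuous_map Z (kprod (ops P (mprof k) \<mm>) (sp_tuples M (mprof k)))
      (\<lambda>z. (g z, inputs k (h z) X))"
    by (rule continuous_map_into_kify[OF Z])
  have 2: "continuous_map (kprod (ops P (mprof k) \<mm>) (sp_tuples M (mprof k))) (sp M \<mm>)
      (\<lambda>(d, x). theta M (mprof k) \<mm> d x)"
    using M unfolding graded_algebra_def by blast
  show ?thesis
    using continuous_map_compose[OF 1 2] by (simp add: o_def)
qed

text \<open>
  The associativity axiom for the composition with \<open>d\<close> in the input of colour \<open>\<mm>\<close>
  and units elsewhere.
\<close>

lemma theta_gam_left:
  assumes P: "operad P" and M: "graded_algebra P M"
    and e: "e \<in> topspace (ops P (mprof k) \<mm>)" and d: "d \<in> topspace (ops P (mprof j) \<mm>)"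
    and A: "A \<in> topspace (sp M \<mm>)" and X: "X \<in> topspace (sp M \<aa>)"
  shows "theta M (mprof (j + k)) \<mm> (gam_left P j k e d) (inputs (j + k) A X) =
    theta M (mprof k) \<mm> e (inputs k (theta M (mprof j) \<mm> d (inputs j A X)) X)"
proof -
  let ?dss = "mprof j # replicate k [\<aa>]"
  let ?y = "\<lambda>i\<in>{..k}. if i = 0 then d else opid P \<aa>"
  let ?z = "inputs (j + k) A X"
  have z: "?z \<in> topspace (sp_tuples M (concat ?dss))"
    using theta_in_space(1)[OF M gam_left_in_ops(1)[OF P e d] A X] by (simp only: mprof_concat)
  have unit: "theta M [\<aa>] \<aa> (opid P \<aa>) (\<lambda>i\<in>{..<1}. X) = X"
    using M X unfolding graded_algebra_def by blast
  have inner: "(\<lambda>i\<in>{..<Suc k}. theta M (?dss ! i) (mprof k ! i) (?y i)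
      (\<lambda>l\<in>{..<length (?dss ! i)}. ?z (pos ?dss i l))) =
      inputs k (theta M (mprof j) \<mm> d (inputs j A X)) X"
    unfolding lessThan_Suc_atMost
  proof (rule restrict_ext)
    fix i assume "i \<in> {..k}"
    then have i: "i \<le> k" by simp
    show "theta M (?dss ! i) (mprof k ! i) (?y i) (\<lambda>l\<in>{..<length (?dss ! i)}. ?z (pos ?dss i l)) =
      (if i = 0 then theta M (mprof j) \<mm> d (inputs j A X) else X)"
    proof (cases i)
      case 0
      have "(\<lambda>l\<in>{..<Suc j}. ?z (pos ?dss 0 l)) = inputs j A X"
        unfolding lessThan_Suc_atMost by (intro restrict_ext) (auto simp: pos_def)
      then show ?thesis using 0 by (simp add: nth_mprof)
    next
      case (Suc i')
      have "(\<Sum>l<i. length (?dss ! l)) = Suc j + i'"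
        using i unfolding Suc sum.lessThan_Suc_shift by simp
      then have "(\<lambda>l\<in>{..<1}. ?z (pos ?dss i l)) = (\<lambda>l\<in>{..<1}. X)"
        using i Suc by (intro restrict_ext) (simp add: pos_def)
      then show ?thesis using i Suc unit by (simp add: nth_mprof)
    qed
  qed
  have "theta M (concat ?dss) \<mm> (gam P (mprof k) \<mm> ?dss e ?y) ?z =
      theta M (mprof k) \<mm> e (\<lambda>i\<in>{..<length (mprof k)}. theta M (?dss ! i) (mprof k ! i) (?y i)
        (\<lambda>l\<in>{..<length (?dss ! i)}. ?z (pos ?dss i l)))"
  proof -
    have "length ?dss = length (mprof k)" by simp
    then show ?thesis
      using M e gam_left_in_ops(2)[OF P e d] z unfolding graded_algebra_def by blast
  qed
  then show ?thesis
    unfolding inner length_mprof mprof_concat by (simp add: gam_left_def)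
qed

lemma theta_perm:
  assumes "graded_algebra P M" "\<sigma> permutes {..<length cs}" "x \<in> topspace (ops P cs c)"
    "z \<in> topspace (sp_tuples M cs)"
  shows "theta M (permute_list \<sigma> cs) c (perm P \<sigma> cs c x) (\<lambda>i\<in>{..<length cs}. z (\<sigma> i)) = theta M cs c x z"
  using assms unfolding graded_algebra_def by blast

text \<open>
  Permuting the inputs of colour \<open>\<aa>\<close> has no effect when all of them are \<open>X\<close>, so
  any representative of the orbit may be used.
\<close>

lemma theta_orbit_orbit:
  assumes P: "operad P" and M: "graded_algebra P M"
    and e: "e \<in> topspace (ops P (mprof k) \<mm>)"
    and A: "A \<in> topspace (sp M \<mm>)" and X: "X \<in> topspace (sp M \<aa>)"
  shows "theta_orbit M X k (orbit P k e) A = theta M (mprof k) \<mm> e (inputs k A X)"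
proof -
  define e' where "e' = (SOME x. x \<in> orbit P k e)"
  have "e' \<in> orbit P k e"
    using someI[of "\<lambda>x. x \<in> orbit P k e", OF self_mem_orbit[OF P e]] by (simp add: e'_def)
  then obtain \<sigma> where \<sigma>: "\<sigma> permutes {1..k}" "e' = perm P \<sigma> (mprof k) \<mm> e"
    by (auto simp: orbit_def orbit_rel_def)
  have "(\<lambda>i\<in>{..<length (mprof k)}. inputs k A X (\<sigma> i)) = inputs k A X"
    unfolding length_mprof lessThan_Suc_atMost
  proof (rule restrict_ext)
    fix i assume i: "i \<in> {..k}"
    show "inputs k A X (\<sigma> i) = (if i = 0 then A else X)"
    proof (cases "i = 0")
      case True
      then show ?thesis using \<sigma>(1) by (simp add: permutes_not_in)
    next
      case False
      then have "\<sigma> i \<in> {1..k}" using i permutes_in_image[OF \<sigma>(1), of i] by auto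
      then show ?thesis using False by simp
    qed
  qed
  moreover have "theta M (permute_list \<sigma> (mprof k)) \<mm> (perm P \<sigma> (mprof k) \<mm> e)
      (\<lambda>i\<in>{..<length (mprof k)}. inputs k A X (\<sigma> i)) = theta M (mprof k) \<mm> e (inputs k A X)"
    using permutes_mprof(1)[OF \<sigma>(1)] by (intro theta_perm[OF M _ e theta_in_space(1)[OF M e A X]]) simp
  ultimately show ?thesis
    unfolding theta_orbit_def e'_def[symmetric] using \<sigma>(2) permutes_mprof(2)[OF \<sigma>(1)] by simp
qed

lemma theta_orbit_in_space:
  assumes "operad P" "graded_algebra P M" "d \<in> topspace (orbit_space P k)"
    "A \<in> topspace (sp M \<mm>)" "X \<in> topspace (sp M \<aa>)"
  shows "theta_orbit M X k d A \<in> topspace (sp M \<mm>)"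
  unfolding theta_orbit_def using some_in_orbit_space[OF assms(1,3)] assms
  by (intro theta_in_space(2)) auto

lemma theta_orbit_gam_orbit:
  assumes P: "operad P" and M: "graded_algebra P M"
    and e: "e \<in> topspace (orbit_space P k)" and d: "d \<in> topspace (orbit_space P j)"
    and A: "A \<in> topspace (sp M \<mm>)" and X: "X \<in> topspace (sp M \<aa>)"
  shows "theta_orbit M X (j + k) (gam_orbit P j k e d) A = theta_orbit M X k e (theta_orbit M X j d A)"
proof -
  note reps = some_in_orbit_space(1)[OF P e] some_in_orbit_space(1)[OF P d]
  show ?thesis
    unfolding gam_orbit_def theta_orbit_orbit[OF P M gam_left_in_ops(1)[OF P reps] A X]
      theta_gam_left[OF P M reps A X]
    by (simp only: theta_orbit_def)
qed

lemma continuous_map_if_neighbourhoods: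
  assumes "\<And>x. x \<in> topspace K \<Longrightarrow>
    \<exists>N C. openin K N \<and> x \<in> N \<and> N \<subseteq> C \<and> continuous_map (subtopology K C) Y f"
  shows "continuous_map K Y f"
  unfolding continuous_map_def
proof (intro conjI allI impI)
  have *: "f x \<in> topspace Y" if x: "x \<in> topspace K" for x
  proof -
    obtain N C where "x \<in> N" "N \<subseteq> C" "continuous_map (subtopology K C) Y f"
      using assms[OF x] by blast
    then show ?thesis using x continuous_map_funspace by fastforce
  qed
  then show "f \<in> topspace K \<rightarrow> topspace Y" by blast
  fix U assume U: "openin Y U"
  show "openin K {x \<in> topspace K. f x \<in> U}"
  proof (subst openin_subopen, intro ballI)
    fix x assume x: "x \<in> {x \<in> topspace K. f x \<in> U}"
    then obtain N C where N: "openin K N" "x \<in> N" "N \<subseteq> C" "continuous_map (subtopology K C) Y f"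
      using assms by blast
    then have "continuous_map (subtopology K N) Y f"
      using continuous_map_from_subtopology_mono by blast
    then have "openin (subtopology K N) {x \<in> topspace (subtopology K N). f x \<in> U}"
      using U openin_continuous_map_preimage by blast
    then have "openin K {x \<in> topspace (subtopology K N). f x \<in> U}"
      using N(1) openin_trans_full by blast
    then show "\<exists>T. openin K T \<and> x \<in> T \<and> T \<subseteq> {x \<in> topspace K. f x \<in> U}"
      using x N(2) by (intro exI[of _ "{x \<in> topspace (subtopology K N). f x \<in> U}"]) auto
  qed
qed

text \<open>
  Since the orbit map is a covering, it has local sections; composed with these, the action of orbits becomes
  the continuous action of operations. Sections exist only over open subsets, on which compact generation need
  not be available, so the argument takes place on closed neighbourhoods in compact Hausdorff test spaces.
\<close>

lemma continuous_map_theta_orbit: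
  fixes Z :: "'a topology"
  assumes P: "operad P" and cov: "orbit_maps_covering P" and M: "graded_algebra P M"
    and X: "X \<in> topspace (sp M \<aa>)" and Z: "compactly_generated Z"
    and g: "continuous_map Z (orbit_space P k) g" and h: "continuous_map Z (sp M \<mm>) h"
  shows "continuous_map Z (sp M \<mm>) (\<lambda>z. theta_orbit M X k (g z) (h z))"
proof (rule continuous_map_compactly_generatedI[OF Z])
  show "(\<lambda>z. theta_orbit M X k (g z) (h z)) \<in> topspace Z \<rightarrow> topspace (sp M \<mm>)"
    using continuous_map_funspace[OF g] continuous_map_funspace[OF h]
    by (auto intro!: theta_orbit_in_space[OF P M _ _ X])
  fix K :: "('a + nat) set set set topology" and u
  assume K: "compact_space K" "Hausdorff_space K" and u: "continuous_map K Z u"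
  have gu: "continuous_map K (orbit_space P k) (g \<circ> u)" and hu: "continuous_map K (sp M \<mm>) (h \<circ> u)"
    using g h u continuous_map_compose by blast+
  show "continuous_map K (sp M \<mm>) ((\<lambda>z. theta_orbit M X k (g z) (h z)) \<circ> u)"
  proof (rule continuous_map_if_neighbourhoods)
    fix x assume x: "x \<in> topspace K"
    have d: "g (u x) \<in> topspace (orbit_space P k)"
      using gu x continuous_map_funspace by fastforce
    have "covering_map (ops P (mprof k) \<mm>) (orbit_space P k) (orbit P k)"
      using cov by (simp add: orbit_maps_covering_def)
    then obtain U \<V> where U: "openin (orbit_space P k) U" "g (u x) \<in> U"
      and \<V>: "\<Union>\<V> = {e \<in> topspace (ops P (mprof k) \<mm>). orbit P k e \<in> U}"
        "\<And>V. V \<in> \<V> \<Longrightarrow> homeomorphic_map (subtopology (ops P (mprof k) \<mm>) V)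
          (subtopology (orbit_space P k) U) (orbit P k)"
      using d unfolding covering_map_def by meson
    obtain e where "e \<in> topspace (ops P (mprof k) \<mm>)" "g (u x) = orbit P k e"
      using d unfolding topspace_orbit_space by blast
    then obtain V where V: "V \<in> \<V>" using \<V>(1) U(2) by auto
    obtain s where s: "homeomorphic_maps (subtopology (ops P (mprof k) \<mm>) V)
        (subtopology (orbit_space P k) U) (orbit P k) s"
      using \<V>(2)[OF V] unfolding homeomorphic_map_maps by blast
    have s_cont: "continuous_map (subtopology (orbit_space P k) U) (ops P (mprof k) \<mm>) s"
      and orbit_s: "\<And>d. d \<in> U \<Longrightarrow> orbit P k (s d) = d"
      using s openin_subset[OF U(1)] unfolding homeomorphic_maps_def continuous_map_in_subtopology by auto
    let ?W = "{y \<in> topspace K. (g \<circ> u) y \<in> U}"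
    have "openin K ?W \<and> x \<in> ?W"
      using openin_continuous_map_preimage[OF gu U(1)] x U(2) by simp
    moreover have "neighbourhood_base_of (closedin K) K"
      using compact_Hausdorff_imp_regular_space[OF K] neighbourhood_base_of_closedin by blast
    ultimately obtain N C where NC: "openin K N" "closedin K C" "x \<in> N" "N \<subseteq> C" "C \<subseteq> ?W"
      unfolding neighbourhood_base_of by (elim allE[of _ ?W] allE[of _ x]) blast
    have "compact_space (subtopology K C)" "Hausdorff_space (subtopology K C)"
      using K NC(2) by (auto intro: compact_space_subtopology closedin_compact_space Hausdorff_space_subtopology)
    then have cgC: "compactly_generated (subtopology K C)"
      by (rule compactly_generated_compact_Hausdorff)
    have topC: "topspace (subtopology K C) = C"
      using closedin_subset[OF NC(2)] by auto
    have "continuous_map (subtopology K C) (subtopology (orbit_space P k) U) (g \<circ> u)"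
      unfolding continuous_map_in_subtopology
      using continuous_map_from_subtopology[OF gu] NC(5) topC by auto
    then have "continuous_map (subtopology K C) (ops P (mprof k) \<mm>) (s \<circ> (g \<circ> u))"
      using s_cont continuous_map_compose by blast
    then have cont: "continuous_map (subtopology K C) (sp M \<mm>)
        (\<lambda>y. theta M (mprof k) \<mm> ((s \<circ> (g \<circ> u)) y) (inputs k ((h \<circ> u) y) X))"
      by (intro continuous_map_theta[OF M X cgC] continuous_map_from_subtopology[OF hu])
    have "continuous_map (subtopology K C) (sp M \<mm>) ((\<lambda>z. theta_orbit M X k (g z) (h z)) \<circ> u)"
    proof (rule continuous_map_eq[OF cont])
      fix y assume "y \<in> topspace (subtopology K C)"
      then have y: "y \<in> topspace K" "g (u y) \<in> U" using topC NC(5) by auto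
      have hy: "h (u y) \<in> topspace (sp M \<mm>)" using continuous_map_mem[OF hu y(1)] by simp
      have sy: "s (g (u y)) \<in> topspace (ops P (mprof k) \<mm>)"
        using y(2) openin_subset[OF U(1)] by (intro continuous_map_mem[OF s_cont]) auto
      have "theta_orbit M X k (g (u y)) (h (u y)) = theta M (mprof k) \<mm> (s (g (u y))) (inputs k (h (u y)) X)"
        using theta_orbit_orbit[OF P M sy hy X] unfolding orbit_s[OF y(2)] .
      then show "theta M (mprof k) \<mm> ((s \<circ> (g \<circ> u)) y) (inputs k ((h \<circ> u) y) X) =
          ((\<lambda>z. theta_orbit M X k (g z) (h z)) \<circ> u) y"
        by (simp only: o_apply cong: if_cong)
    qed
    then show "\<exists>N C. openin K N \<and> x \<in> N \<and> N \<subseteq> C \<and>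
        continuous_map (subtopology K C) (sp M \<mm>) ((\<lambda>z. theta_orbit M X k (g z) (h z)) \<circ> u)"
      using NC by blast
  qed
qed

text \<open>
  The object \<open>s\<^sup>p(A) = A \<oplus> X\<^sup>p\<close>, expressed by the operation
  \<open>c\<^sub>p\<close> so that it can be moved along paths of operations.
\<close>

definition stab_iter :: "'o operad_data \<Rightarrow> ('o, 'x) algebra_data \<Rightarrow> 'o \<Rightarrow> 'x \<Rightarrow> nat \<Rightarrow> 'x \<Rightarrow> 'x" where
  "stab_iter P M c X p A = theta M (mprof p) \<mm> (cpow P c p) (inputs p A X)"

lemma stab_iter_0:
  assumes "graded_algebra P M" "A \<in> topspace (sp M \<mm>)"
  shows "stab_iter P M c X 0 A = A"
proof -
  have "theta M [\<mm>] \<mm> (opid P \<mm>) (\<lambda>i\<in>{..<1}. A) = A"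
    using assms unfolding graded_algebra_def by blast
  moreover have "inputs 0 A X = (\<lambda>i\<in>{..<1}. A)"
    by (auto simp: fun_eq_iff)
  ultimately show ?thesis by (simp add: stab_iter_def mprof_def)
qed

lemma continuous_map_stab_iter:
  assumes "operad P" "graded_algebra P M" "X \<in> topspace (sp M \<aa>)" "c \<in> topspace (ops P (mprof 1) \<mm>)"
  shows "continuous_map (sp M \<mm>) (sp M \<mm>) (stab_iter P M c X p)"
proof -
  have "compactly_generated (sp M \<mm>)"
    using assms(2) by (simp add: graded_algebra_def)
  then show ?thesis
    unfolding stab_iter_def using cpow_in_ops[OF assms(1,4)]
    by (intro continuous_map_theta[OF assms(2,3)]) auto
qed

text \<open>
  The right-hand side is \<open>\<theta>(e; A, X\<^sup>p)\<close> for
  \<open>e = \<gamma>(c\<^sub>q; d, 1\<^sub>\<aa>\<^sup>q)\<close>, and \<open>c\<^sub>p\<close> and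
  \<open>e\<close> are joined by a path of operations.
\<close>

lemma path_component_stab_iter:
  assumes P: "operad P" and M: "graded_algebra P M" and X: "X \<in> topspace (sp M \<aa>)"
    and c: "c \<in> topspace (ops P (mprof 1) \<mm>)"
    and conn: "path_connected_space (ops P (mprof p) \<mm>)"
    and q: "q \<le> p" and d: "d \<in> topspace (orbit_space P (p - q))" and A: "A \<in> topspace (sp M \<mm>)"
  shows "path_component_of (sp M \<mm>) (stab_iter P M c X p A) (stab_iter P M c X q (theta_orbit M X (p - q) d A))"
proof -
  define d' where "d' = (SOME x. x \<in> d)"
  have d': "d' \<in> topspace (ops P (mprof (p - q)) \<mm>)"
    unfolding d'_def by (rule some_in_orbit_space(1)[OF P d])
  define e where "e = gam_left P (p - q) q (cpow P c q) d'"
  have e: "e \<in> topspace (ops P (mprof p) \<mm>)"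
    using gam_left_in_ops(1)[OF P cpow_in_ops[OF P c] d', of q] q by (simp add: e_def)
  have "stab_iter P M c X q (theta_orbit M X (p - q) d A) = theta M (mprof p) \<mm> e (inputs p A X)"
    using theta_gam_left[OF P M cpow_in_ops[OF P c] d' A X, of q] q
    unfolding stab_iter_def theta_orbit_def e_def d'_def[symmetric] by simp
  moreover obtain \<alpha> where \<alpha>: "continuous_map (top_of_set {0..1::real}) (ops P (mprof p) \<mm>) \<alpha>"
      "\<alpha> 0 = cpow P c p" "\<alpha> 1 = e"
    using conn cpow_in_ops[OF P c, of p] e
    unfolding path_connected_space_def pathin_def by blast
  moreover have "compactly_generated (top_of_set {0..1::real})"
    by (intro compactly_generated_compact_Hausdorff)
       (auto simp: compact_space_subtopology Hausdorff_space_subtopology)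
  then have "continuous_map (top_of_set {0..1::real}) (sp M \<mm>)
      (\<lambda>t. theta M (mprof p) \<mm> (\<alpha> t) (inputs p A X))"
    using \<alpha>(1) A by (intro continuous_map_theta[OF M X]) auto
  ultimately show ?thesis
    unfolding path_component_of_def pathin_def
    by (intro exI[of _ "\<lambda>t. theta M (mprof p) \<mm> (\<alpha> t) (inputs p A X)"]) (auto simp: stab_iter_def)
qed

section \<open>Paths in realisations\<close>

lemma path_component_of_set_eq:
  "path_component_of Y x y \<Longrightarrow> path_component_of_set Y x = path_component_of_set Y y"
  using path_component_of_sym path_component_of_trans by (metis Collect_cong)

text \<open>
  The relation by which \<^const>\<open>realisation\<close> divides.
\<close>

definition glue :: "(nat \<Rightarrow> 'b topology) \<Rightarrow> (nat \<Rightarrow> nat \<Rightarrow> 'b \<Rightarrow> 'b) \<Rightarrow>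
    (nat \<times> 'b \<times> (nat \<Rightarrow> real)) rel" where
  "glue B fc = (face_rel B fc \<union> (face_rel B fc)\<inverse>)\<^sup>*"

lemma realisation_eq: "realisation B fc = quotient_topology (simplices B) (glue B fc)"
  by (simp add: realisation_def glue_def)

lemma equiv_glue: "equiv UNIV (glue B fc)"
  unfolding glue_def equiv_def
  by (auto intro: refl_rtrancl trans_rtrancl sym_rtrancl simp: sym_Un_converse)

lemma glue_class_eq_iff: "glue B fc `` {z} = glue B fc `` {z'} \<longleftrightarrow> (z, z') \<in> glue B fc"
  using eq_equiv_class_iff[OF equiv_glue] by blast

lemma self_mem_glue_class: "z \<in> glue B fc `` {z}"
  by (simp add: glue_def)

lemma glue_invariant:
  assumes "\<And>n i x t. x \<in> topspace (B (Suc n)) \<Longrightarrow> t \<in> standard_simplex n \<Longrightarrow> i \<le> Suc n \<Longrightarrow>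
      F (Suc n, x, simplical_face i t) = F (n, fc (Suc n) i x, t)"
    and "(z, z') \<in> glue B fc"
  shows "F z = F z'"
  using assms(2) unfolding glue_def
proof induction
  case (step y z)
  have "F a = F b" if "(a, b) \<in> face_rel B fc" for a b
    using that assms(1) by (auto simp: face_rel_def)
  from this[of y z] this[of z y] show ?case using step.hyps(2) step.IH by (elim UnE) simp_all
qed simp

lemma topspace_simplices: "topspace (simplices B) = (SIGMA n:UNIV. topspace (B n) \<times> standard_simplex n)"
  by (auto simp: simplices_def simplex_topology_def)

text \<open>
  Face maps of simplices insert a coordinate \<open>0\<close>, so for \<open>a > 0\<close> they commute with
  this choice of a vertex.
\<close>

definition heavy :: "real \<Rightarrow> (nat \<Rightarrow> real) \<Rightarrow> nat" where
  "heavy a t = (LEAST j. a < t j)"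

definition avoids :: "real \<Rightarrow> (nat \<Rightarrow> real) \<Rightarrow> bool" where
  "avoids a t \<longleftrightarrow> (\<forall>i. t i \<noteq> a) \<and> (\<exists>i. a < t i)"

lemma heavyI: "avoids a t \<Longrightarrow> a < t (heavy a t)"
  unfolding heavy_def avoids_def by (rule LeastI_ex) blast

lemma heavy_le:
  assumes "avoids a t" "0 < a" "t \<in> standard_simplex n"
  shows "heavy a t \<le> n"
  using heavyI[OF assms(1)] assms(2,3)
  by (force simp: standard_simplex_def not_le[symmetric])

lemma heavy_eq_iff:
  assumes "avoids a t"
  shows "heavy a t = j \<longleftrightarrow> a < t j \<and> (\<forall>i<j. t i < a)"
proof
  assume "heavy a t = j"
  then show "a < t j \<and> (\<forall>i<j. t i < a)"
    using heavyI[OF assms] assms not_less_Least[of _ "\<lambda>j. a < t j"]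
    unfolding heavy_def avoids_def by (metis linorder_neqE_linordered_idom)
next
  assume *: "a < t j \<and> (\<forall>i<j. t i < a)"
  show "heavy a t = j"
    unfolding heavy_def by (rule Least_equality) (use * in \<open>auto simp: not_le[symmetric] dest: less_asym\<close>)
qed

lemma simplical_face_coface: "simplical_face i t (coface i j) = t j"
  by (auto simp: simplical_face_def coface_def)

lemma simplical_face_cases:
  "simplical_face i t j = 0 \<or> (\<exists>j'. j = coface i j' \<and> simplical_face i t j = t j')"
proof (cases "j = i")
  case True
  then show ?thesis by (simp add: simplical_face_def)
next
  case False
  define j' where "j' = (if j < i then j else j - 1)"
  have "j = coface i j'" using False by (auto simp: j'_def coface_def)
  then show ?thesis using simplical_face_coface by blast
qed

lemma avoids_simplical_face:
  assumes "0 < a"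
  shows "avoids a (simplical_face i t) \<longleftrightarrow> avoids a t"
proof
  assume l: "avoids a (simplical_face i t)"
  have "t j \<noteq> a" for j
    using l simplical_face_coface[of i t j] unfolding avoids_def by metis
  moreover obtain j where j: "a < simplical_face i t j"
    using l unfolding avoids_def by blast
  then have "\<exists>j. a < t j"
    using assms simplical_face_cases[of i t j] by auto
  ultimately show "avoids a t" unfolding avoids_def by blast
next
  assume r: "avoids a t"
  have "simplical_face i t j \<noteq> a" for j
    using assms r simplical_face_cases[of i t j] by (auto simp: avoids_def)
  moreover have "\<exists>j. a < simplical_face i t j"
    using r simplical_face_coface unfolding avoids_def by metis
  ultimately show "avoids a (simplical_face i t)" unfolding avoids_def by blast
qed

lemma heavy_simplical_face:
  assumes "0 < a" "avoids a t"
  shows "heavy a (simplical_face i t) = coface i (heavy a t)"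
proof -
  have av: "avoids a (simplical_face i t)" using assms avoids_simplical_face by blast
  have *: "a < t (heavy a t)" "\<And>j. j < heavy a t \<Longrightarrow> t j < a"
    using heavy_eq_iff[OF assms(2)] by blast+
  have "simplical_face i t j < a" if "j < coface i (heavy a t)" for j
    using simplical_face_cases[of i t j]
  proof (elim disjE exE conjE)
    fix j' assume j': "j = coface i j'" "simplical_face i t j = t j'"
    then have "j' < heavy a t" using that by (auto simp: coface_def split: if_splits)
    then show ?thesis using j' * by simp
  qed (use assms in simp)
  then show ?thesis
    using heavy_eq_iff[OF av] * by (simp add: simplical_face_coface)
qed

lemma openin_simplex_topology:
  assumes "\<And>i. i \<le> n \<Longrightarrow> open (W i)"
  shows "openin (simplex_topology n) {t \<in> standard_simplex n. \<forall>i\<le>n. t i \<in> W i}"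
proof -
  have "openin (simplex_topology n) {t \<in> topspace (simplex_topology n). t i \<in> W i}" if "i \<le> n" for i
  proof -
    have "continuous_map (simplex_topology n) euclideanreal (\<lambda>t. t i)"
      unfolding simplex_topology_def
      by (intro continuous_map_from_subtopology continuous_map_product_projection) simp
    then show ?thesis
      using assms[OF that] openin_continuous_map_preimage by fastforce
  qed
  then have "openin (simplex_topology n) (\<Inter>i\<in>{..n}. {t \<in> topspace (simplex_topology n). t i \<in> W i})"
    by (intro openin_INT2) auto
  moreover have "(\<Inter>i\<in>{..n}. {t \<in> topspace (simplex_topology n). t i \<in> W i}) =
      {t \<in> standard_simplex n. \<forall>i\<le>n. t i \<in> W i}"
    by (auto simp: simplex_topology_def)
  ultimately show ?thesis by simp
qed

text \<open>
  On the set of points of which no coordinate is \<open>a\<close> and some coordinate exceeds \<open>a\<close>,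
  the index of the first such coordinate is locally constant, so the vertex with that index depends continuously
  on the point.
\<close>

lemma openin_heavy_vertex:
  assumes a: "0 < a" and V: "openin Y V"
    and cont: "\<And>n j. j \<le> n \<Longrightarrow> continuous_map (B n) Y (vert n j)"
  shows "openin (simplices B)
    {(n, x, t). (n, x, t) \<in> topspace (simplices B) \<and> avoids a t \<and> vert n (heavy a t) x \<in> V}"
    (is "openin _ ?S")
proof (subst simplices_def, unfold openin_sum_topology, intro conjI ballI)
  show "?S \<subseteq> Sigma UNIV (topspace \<circ> (\<lambda>n. kprod (B n) (simplex_topology n)))"
    unfolding topspace_simplices by (auto simp: simplex_topology_def)
  fix n :: nat
  define T where "T j = {t \<in> standard_simplex n. \<forall>i\<le>n. t i \<in> (if i < j then {..<a} else if i = j then {a<..} else - {a})}" for j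
  have "openin (simplex_topology n) (T j)" for j
    unfolding T_def by (intro openin_simplex_topology) (auto simp: open_delete)
  moreover have "openin (B n) {x \<in> topspace (B n). vert n j x \<in> V}" if "j \<le> n" for j
    using cont[OF that] V openin_continuous_map_preimage by blast
  ultimately have "openin (prod_topology (B n) (simplex_topology n))
      (\<Union>j\<in>{..n}. {x \<in> topspace (B n). vert n j x \<in> V} \<times> T j)"
    by (intro openin_Union ballI) (auto simp: openin_prod_Times_iff)
  moreover have "(\<Union>j\<in>{..n}. {x \<in> topspace (B n). vert n j x \<in> V} \<times> T j) = {x. (n, x) \<in> ?S}"
  proof -
    have zero: "t i = 0" if "t \<in> standard_simplex n" "\<not> i \<le> n" for t i
      using that by (simp add: standard_simplex_def)
    have T: "t \<in> T j \<longleftrightarrow> t \<in> standard_simplex n \<and> avoids a t \<and> heavy a t = j" if j: "j \<le> n" for t j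
    proof
      assume t: "t \<in> T j"
      have "t i \<noteq> a" for i
        using t a zero[of t i] unfolding T_def by (cases "i \<le> n") (auto split: if_splits)
      moreover have "a < t j" using t j unfolding T_def by auto
      ultimately have av: "avoids a t" unfolding avoids_def by blast
      moreover have "t i < a" if "i < j" for i
      proof -
        have "i \<le> n" using j that by simp
        then have "t i \<in> (if i < j then {..<a} else if i = j then {a<..} else - {a})"
          using t unfolding T_def by blast
        then show ?thesis using that by simp
      qed
      ultimately show "t \<in> standard_simplex n \<and> avoids a t \<and> heavy a t = j"
        using t \<open>a < t j\<close> heavy_eq_iff[OF av] unfolding T_def by auto
    next
      assume t: "t \<in> standard_simplex n \<and> avoids a t \<and> heavy a t = j"
      then have "a < t j" "\<And>i. i < j \<Longrightarrow> t i < a" "\<And>i. t i \<noteq> a"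
        using heavy_eq_iff[of a t j] unfolding avoids_def by blast+
      then show "t \<in> T j" using t unfolding T_def by auto
    qed
    show ?thesis
      using heavy_le[OF _ a] by (auto simp: topspace_simplices T)
  qed
  ultimately have "openin (prod_topology (B n) (simplex_topology n)) {x. (n, x) \<in> ?S}" by simp
  then show "openin (kprod (B n) (simplex_topology n)) {x. (n, x) \<in> ?S}"
    by (rule openin_imp_openin_kify)
qed

text \<open>
  Think of \<open>vert n j x\<close> as a point attached to the \<open>j\<close>-th vertex of the simplex
  \<open>x\<close>. At any time \<open>s\<^sub>0\<close> choose \<open>a > 0\<close> below the largest
  barycentric coordinate of the point and different from all of them. On the open set of points of the
  realisation of which no coordinate is \<open>a\<close> and some coordinate exceeds \<open>a\<close>, the map
  \<open>\<rho>\<close> to the first vertex with coordinate above \<open>a\<close> is well defined and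
  continuous, because the face maps of the simplices insert a coordinate \<open>0\<close>, which is below
  \<open>a\<close>. Composing with \<open>\<rho>\<close> turns the given path near \<open>s\<^sub>0\<close> into
  a path in \<open>Y\<close>. Therefore the path component of the vertices is locally constant in time, although
  path components of \<open>Y\<close> need not be open.
\<close>

lemma path_component_of_realisation:
  assumes cont: "\<And>n j. j \<le> n \<Longrightarrow> continuous_map (B n) Y (vert n j)"
    and face: "\<And>n i j x. x \<in> topspace (B (Suc n)) \<Longrightarrow> i \<le> Suc n \<Longrightarrow> j \<le> n \<Longrightarrow>
      vert n j (fc (Suc n) i x) = vert (Suc n) (coface i j) x"
    and same: "\<And>n j x. x \<in> topspace (B n) \<Longrightarrow> j \<le> n \<Longrightarrow> path_component_of Y (vert n 0 x) (vert n j x)"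
    and path: "path_component_of (realisation B fc) (glue B fc `` {(n0, x0, t0)}) (glue B fc `` {(n1, x1, t1)})"
    and z0: "(n0, x0, t0) \<in> topspace (simplices B)"
    and z1: "(n1, x1, t1) \<in> topspace (simplices B)"
  shows "path_component_of Y (vert n0 0 x0) (vert n1 0 x1)"
proof -
  define \<kappa> where "\<kappa> = (\<lambda>(n, x, t :: nat \<Rightarrow> real). path_component_of_set Y (vert n 0 x))"
  have \<kappa>_inv: "\<kappa> z = \<kappa> z'" if "(z, z') \<in> glue B fc" for z z'
    using that
  proof (rule glue_invariant[rotated])
    fix n i x and t :: "nat \<Rightarrow> real"
    assume x: "x \<in> topspace (B (Suc n))" "i \<le> Suc n"
    then have "path_component_of Y (vert (Suc n) 0 x) (vert (Suc n) (coface i 0) x)"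
      by (intro same) (auto simp: coface_def)
    then show "\<kappa> (Suc n, x, simplical_face i t) = \<kappa> (n, fc (Suc n) i x, t)"
      using face[OF x, of 0] path_component_of_set_eq unfolding \<kappa>_def by fastforce
  qed
  define \<kappa>' where "\<kappa>' \<xi> = \<kappa> (SOME z. z \<in> \<xi>)" for \<xi>
  have \<kappa>': "\<kappa>' (glue B fc `` {z}) = \<kappa> z" for z
  proof -
    have "(SOME z'. z' \<in> glue B fc `` {z}) \<in> glue B fc `` {z}"
      using self_mem_glue_class by (rule someI)
    then show ?thesis unfolding \<kappa>'_def using \<kappa>_inv by fastforce
  qed
  obtain \<gamma> where \<gamma>: "continuous_map (top_of_set {0..1::real}) (realisation B fc) \<gamma>"
    "\<gamma> 0 = glue B fc `` {(n0, x0, t0)}" "\<gamma> 1 = glue B fc `` {(n1, x1, t1)}"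
    using path unfolding path_component_of_def pathin_def by blast
  have "(\<kappa>' \<circ> \<gamma>) constant_on {0..1}"
  proof (rule locally_constant_imp_constant)
    show "connected {0..1::real}" by simp
    fix s0 :: real assume s0: "s0 \<in> {0..1}"
    have "\<gamma> s0 \<in> topspace (realisation B fc)"
      using continuous_map_funspace[OF \<gamma>(1)] s0 by auto
    then obtain n x t where z: "(n, x, t) \<in> topspace (simplices B)" "\<gamma> s0 = glue B fc `` {(n, x, t)}"
      unfolding realisation_eq topspace_quotient_topology quotient_def by fastforce
    have t: "t \<in> standard_simplex n" using z(1) by (simp add: topspace_simplices)
    obtain a where a: "0 < a" "avoids a t"
    proof -
      have "\<exists>j. 0 < t j"
      proof (rule ccontr)
        assume "\<nexists>j. 0 < t j"
        then have "(\<Sum>i\<le>n. t i) \<le> 0" by (intro sum_nonpos) (simp add: not_less)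
        then show False using t by (simp add: standard_simplex_def)
      qed
      then obtain j where j: "0 < t j" by blast
      have "t i \<in> t ` {..n} \<union> {0}" for i
        using t by (cases "i \<le> n") (auto simp: standard_simplex_def)
      then have "range t \<subseteq> t ` {..n} \<union> {0}" by blast
      then have "finite (range t)" using finite_subset by blast
      moreover have "infinite {0<..<t j}" using j by simp
      ultimately have "{0<..<t j} - range t \<noteq> {}"
        by (metis Diff_eq_empty_iff finite_subset)
      then obtain a where "a \<in> {0<..<t j}" "a \<notin> range t" by blast
      then show ?thesis using that[of a] unfolding avoids_def by (metis greaterThanLessThan_iff rangeI)
    qed
    define G where "G V = {(n, x, t). (n, x, t) \<in> topspace (simplices B) \<and> avoids a t \<and> vert n (heavy a t) x \<in> V}" for V
    define F where "F = (\<lambda>(n, x, t). (avoids a t, if avoids a t then vert n (heavy a t) x else undefined))"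
    have F_inv: "F z = F z'" if "(z, z') \<in> glue B fc" for z z'
      using that
    proof (rule glue_invariant[rotated])
      fix n i x and t :: "nat \<Rightarrow> real"
      assume x: "x \<in> topspace (B (Suc n))" "i \<le> Suc n" and t: "t \<in> standard_simplex n"
      show "F (Suc n, x, simplical_face i t) = F (n, fc (Suc n) i x, t)"
      proof (cases "avoids a t")
        case True
        then show ?thesis
          using face[OF x heavy_le[OF True a(1) t]] a(1)
          by (simp add: F_def avoids_simplical_face heavy_simplical_face)
      next
        case False
        then show ?thesis using a(1) by (simp add: F_def avoids_simplical_face)
      qed
    qed
    define \<rho> where "\<rho> \<xi> = snd (F (SOME z. z \<in> \<xi>))" for \<xi>
    have \<rho>: "\<rho> (glue B fc `` {z}) = snd (F z)" for z
    proof -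
      have "(SOME z'. z' \<in> glue B fc `` {z}) \<in> glue B fc `` {z}"
        using self_mem_glue_class by (rule someI)
      then show ?thesis unfolding \<rho>_def using F_inv by fastforce
    qed
    define W where "W V = (\<lambda>z. glue B fc `` {z}) ` G V" for V
    have GF: "z \<in> G V \<longleftrightarrow> z \<in> topspace (simplices B) \<and> fst (F z) \<and> snd (F z) \<in> V" for z V
      by (auto simp: G_def F_def)
    have pre_W: "{z \<in> topspace (simplices B). glue B fc `` {z} \<in> W V} = G V" for V
    proof (intro equalityI subsetI)
      fix z assume "z \<in> {z \<in> topspace (simplices B). glue B fc `` {z} \<in> W V}"
      then obtain z' where "z \<in> topspace (simplices B)" "z' \<in> G V" "(z, z') \<in> glue B fc"
        unfolding W_def by (auto simp: glue_class_eq_iff)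
      then show "z \<in> G V" using F_inv[of z z'] by (simp add: GF)
    qed (auto simp: GF W_def)
    have open_W: "openin (realisation B fc) (W V)" if "openin Y V" for V
      unfolding realisation_eq openin_quotient_topology
    proof
      show "W V \<subseteq> topspace (simplices B) // glue B fc"
        unfolding W_def by (auto simp: GF intro: quotientI)
      show "openin (simplices B) {z \<in> topspace (simplices B). glue B fc `` {z} \<in> W V}"
        unfolding pre_W G_def by (rule openin_heavy_vertex[OF a(1) that cont])
    qed
    have W_mem: "\<xi> \<in> W V \<longleftrightarrow> \<xi> \<in> W (topspace Y) \<and> \<rho> \<xi> \<in> V" if "V \<subseteq> topspace Y" for \<xi> V
    proof -
      have "\<rho> \<xi> \<in> V" "\<xi> \<in> W (topspace Y)" if "\<xi> \<in> W V"
        using that \<open>V \<subseteq> topspace Y\<close> unfolding W_def by (auto simp: \<rho> GF)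
      moreover have "\<xi> \<in> W V" if "\<xi> \<in> W (topspace Y)" "\<rho> \<xi> \<in> V"
        using that unfolding W_def by (auto simp: \<rho> GF)
      ultimately show ?thesis by blast
    qed
    have z_W: "\<gamma> s0 \<in> W (topspace Y)"
    proof -
      have "vert n (heavy a t) x \<in> topspace Y"
        using continuous_map_funspace[OF cont[OF heavy_le[OF a(2,1) t]]] z(1)
        by (auto simp: topspace_simplices)
      then show ?thesis
        unfolding W_def z(2) using z(1) a(2) by (auto simp: G_def)
    qed
    have "openin (top_of_set {0..1}) {s \<in> {0..1}. \<gamma> s \<in> W (topspace Y)}"
      using openin_continuous_map_preimage[OF \<gamma>(1) open_W[OF openin_topspace]] by simp
    then obtain \<delta> where \<delta>: "\<delta> > 0" "ball s0 \<delta> \<inter> {0..1} \<subseteq> {s \<in> {0..1}. \<gamma> s \<in> W (topspace Y)}"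
      using s0 z_W unfolding openin_contains_ball by blast
    define J where "J = {0..1} \<inter> ball s0 \<delta>"
    have J: "J \<subseteq> {0..1}" "\<And>s. s \<in> J \<Longrightarrow> \<gamma> s \<in> W (topspace Y)"
      using \<delta>(2) by (auto simp: J_def)
    have s0J: "s0 \<in> J" using s0 \<delta>(1) by (simp add: J_def)
    have "path_connected J"
      unfolding J_def by (intro convex_imp_path_connected convex_Int convex_ball convex_real_interval)
    have \<gamma>J: "continuous_map (top_of_set J) (realisation B fc) \<gamma>"
      using \<gamma>(1) J(1) continuous_map_from_subtopology_mono by blast
    have "continuous_map (top_of_set J) Y (\<rho> \<circ> \<gamma>)"
      unfolding continuous_map_def
    proof (intro conjI allI impI)
      show "\<rho> \<circ> \<gamma> \<in> topspace (top_of_set J) \<rightarrow> topspace Y"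
      proof
        fix s assume "s \<in> topspace (top_of_set J)"
        then have "\<gamma> s \<in> W (topspace Y)" using J(2) by simp
        then show "(\<rho> \<circ> \<gamma>) s \<in> topspace Y" using W_mem[OF order_refl, of "\<gamma> s"] by simp
      qed
      fix V assume V: "openin Y V"
      have "{s \<in> topspace (top_of_set J). (\<rho> \<circ> \<gamma>) s \<in> V} = {s \<in> topspace (top_of_set J). \<gamma> s \<in> W V}"
        using J(2) W_mem[OF openin_subset[OF V]] by auto
      then show "openin (top_of_set J) {s \<in> topspace (top_of_set J). (\<rho> \<circ> \<gamma>) s \<in> V}"
        using openin_continuous_map_preimage[OF \<gamma>J open_W[OF V]] by simp
    qed
    then have conn: "path_connectedin Y ((\<rho> \<circ> \<gamma>) ` J)"
      using path_connectedin_continuous_map_image \<open>path_connected J\<close> by (metis path_connectedin_euclidean path_connectedin_subtopology subset_refl)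
    have comp: "\<kappa>' (\<gamma> s) = path_component_of_set Y (\<rho> (\<gamma> s))" if s: "s \<in> J" for s
    proof -
      obtain m y u where y: "\<gamma> s = glue B fc `` {(m, y, u)}" "(m, y, u) \<in> G (topspace Y)"
        using J(2)[OF s] unfolding W_def by auto
      then have "y \<in> topspace (B m)" "heavy a u \<le> m" "avoids a u"
        using heavy_le[OF _ a(1)] by (auto simp: G_def topspace_simplices)
      then show ?thesis
        using path_component_of_set_eq[OF same[of y m "heavy a u"]] unfolding y(1) \<kappa>' \<rho>
        by (simp add: \<kappa>_def F_def)
    qed
    have const: "(\<kappa>' \<circ> \<gamma>) s = (\<kappa>' \<circ> \<gamma>) s0" if s: "s \<in> J" for s
    proof -
      have "path_component_of Y (\<rho> (\<gamma> s)) (\<rho> (\<gamma> s0))"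
        using conn s s0J unfolding path_component_of by (intro exI[of _ "(\<rho> \<circ> \<gamma>) ` J"]) auto
      then show ?thesis
        using comp[OF s] comp[OF s0J] path_component_of_set_eq by fastforce
    qed
    have "openin (top_of_set {0..1}) J"
      unfolding J_def by (rule openin_open_Int) simp
    then show "\<exists>T. openin (top_of_set {0..1}) T \<and> s0 \<in> T \<and> (\<forall>s\<in>T. (\<kappa>' \<circ> \<gamma>) s = (\<kappa>' \<circ> \<gamma>) s0)"
      using s0J const by (intro exI[of _ J] conjI ballI)
  qed
  then obtain \<kappa>0 where "\<forall>s\<in>{0..1}. (\<kappa>' \<circ> \<gamma>) s = \<kappa>0"
    unfolding constant_on_def by blast
  then have "\<kappa>' (\<gamma> 0) = \<kappa>' (\<gamma> 1)" by simp
  then have "path_component_of_set Y (vert n0 0 x0) = path_component_of_set Y (vert n1 0 x1)"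
    unfolding \<gamma>(2,3) \<kappa>' by (simp add: \<kappa>_def)
  moreover have "vert n1 0 x1 \<in> topspace Y"
    using z1 continuous_map_funspace[OF cont[of 0 n1]] by (auto simp: topspace_simplices)
  then have "vert n1 0 x1 \<in> path_component_of_set Y (vert n1 0 x1)"
    by (simp add: path_component_of_refl)
  ultimately show ?thesis by blast
qed

section \<open>The vertices of a simplex of the bar construction\<close>

lemma continuous_map_from_sum_topology:
  assumes "\<And>i. i \<in> I \<Longrightarrow> continuous_map (X i) Y (\<lambda>x. f (i, x))"
  shows "continuous_map (sum_topology X I) Y f"
  unfolding continuous_map_def
proof (intro conjI allI impI)
  show "f \<in> topspace (sum_topology X I) \<rightarrow> topspace Y"
    using continuous_map_mem[OF assms] by auto
  fix U assume U: "openin Y U"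
  show "openin (sum_topology X I) {z \<in> topspace (sum_topology X I). f z \<in> U}"
    unfolding openin_sum_topology
  proof (intro conjI ballI)
    fix i assume i: "i \<in> I"
    have "openin (X i) {x \<in> topspace (X i). f (i, x) \<in> U}"
      using openin_continuous_map_preimage[OF assms[OF i] U] .
    moreover have "{x. (i, x) \<in> {z \<in> topspace (sum_topology X I). f z \<in> U}} = {x \<in> topspace (X i). f (i, x) \<in> U}"
      using i by auto
    ultimately show "openin (X i) {x. (i, x) \<in> {z \<in> topspace (sum_topology X I). f z \<in> U}}"
      by simp
  qed auto
qed

lemma topspace_Path:
  "topspace (Path Y) = {(l, f). 0 \<le> l \<and> continuous_map euclideanreal Y f \<and>
     (\<forall>t\<le>0. f t = f 0) \<and> (\<forall>t\<ge>l. f t = f l)}"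
proof -
  have "topspace (compact_open_line Y) = {f. continuous_map euclideanreal Y f}"
    unfolding compact_open_line_def topology_generated_by_topspace
    by (auto intro!: exI[of _ "{}"])
  then show ?thesis
    by (auto simp: Path_def)
qed

lemma continuous_map_UO_fst: "continuous_map (UO P c q p) (orbit_space P (p - q)) fst"
  unfolding UO_def
  by (intro continuous_map_from_kify continuous_map_from_subtopology continuous_map_fst)

lemma continuous_map_Delta_tilde_fst:
  "continuous_map (Delta_tilde P c \<Phi> q p) (orbit_space P (p - q)) fst"
  unfolding Delta_tilde_def
  by (intro continuous_map_from_kify continuous_map_from_subtopology continuous_map_UO_fst)

lemma Delta_tilde_le: "f \<in> topspace (Delta_tilde P c \<Phi> q p) \<Longrightarrow> q \<le> p"
  by (auto simp: Delta_tilde_def UO_def)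

lemma continuous_map_res_space_fst: "continuous_map (res_space M c X p) (sp M \<mm>) fst"
  unfolding res_space_def
  by (intro continuous_map_from_kify continuous_map_from_subtopology continuous_map_fst)

text \<open>
  The component in \<open>\<M>\<close> of the point of the resolution at the \<open>j\<close>-th vertex of a
  simplex. Only this component of the action is iterated, so that continuity in the simplex follows from that of
  \<open>\<theta>\<close> alone.
\<close>

primrec vertex_object :: "('o, 'x) algebra_data \<Rightarrow> 'x \<Rightarrow> nat \<Rightarrow> ('o, 'x) bar \<Rightarrow> 'x" where
  "vertex_object M X 0 b = fst (fst (snd b))"
| "vertex_object M X (Suc j) b =
     theta_orbit M X (fst b ! j - fst b ! Suc j) (fst (snd (snd b) j)) (vertex_object M X j b)"

definition vertex_stab_iter :: "'o operad_data \<Rightarrow> ('o, 'x) algebra_data \<Rightarrow> 'o \<Rightarrow> 'x \<Rightarrow> nat \<Rightarrow> ('o, 'x) bar \<Rightarrow> 'x" where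
  "vertex_stab_iter P M c X j b = stab_iter P M c X (fst b ! j) (vertex_object M X j b)"

definition start_point :: "nat \<times> ('o, 'x) bar \<times> (nat \<Rightarrow> real) \<Rightarrow> 'x" where
  "start_point z = mstart (snd (fst (snd (fst (snd z)))))"

text \<open>
  The \<open>0\<close>-simplex given by a point of the resolution at \<open>[0]\<close>; the value
  \<^const>\<open>undefined\<close> is that of the empty tuple of morphisms.
\<close>

definition vertex :: "'x \<Rightarrow> 'x moore \<Rightarrow> nat \<times> ('o, 'x) bar \<times> (nat \<Rightarrow> real)" where
  "vertex A \<zeta> = (0, ([0], (A, \<zeta>), \<lambda>_. undefined), \<lambda>i. if i = 0 then 1 else 0)"

context
  fixes P :: "'o operad_data" and M :: "('o, 'x) algebra_data" and c :: 'o and X :: 'x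
    and \<Phi> :: "nat \<Rightarrow> nat \<Rightarrow> 'o umor set \<Rightarrow> braid set"
  assumes P: "operad P" and cov: "orbit_maps_covering P" and M: "graded_algebra P M"
    and X: "X \<in> topspace (sp M \<aa>)" and c: "c \<in> topspace (ops P (mprof 1) \<mm>)"
    and conn: "\<And>k. path_connected_space (ops P (mprof k) \<mm>)"
begin

abbreviation "bar \<equiv> bar_space P M c X \<Phi>"
abbreviation "fc \<equiv> bar_face P M X"
abbreviation "obj \<equiv> vertex_object M X"

lemma bar_spaceD:
  assumes "(C, r, f) \<in> topspace (bar n)"
  shows "length C = Suc n" "fst r \<in> topspace (sp M \<mm>)" "0 \<le> fst (snd r)"
    and "\<And>i. i < n \<Longrightarrow> C ! Suc i \<le> C ! i"
    and "\<And>i. i < n \<Longrightarrow> fst (f i) \<in> topspace (orbit_space P (C ! i - C ! Suc i))"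
proof -
  show "length C = Suc n"
    using assms by (simp add: bar_space_def)
  have r: "r \<in> topspace (res_space M c X (C ! 0))"
    and f: "\<And>i. i < n \<Longrightarrow> f i \<in> topspace (Delta_tilde P c \<Phi> (C ! Suc i) (C ! i))"
    using assms by (auto simp: bar_space_def PiE_iff)
  show "fst r \<in> topspace (sp M \<mm>)"
    by (rule continuous_map_mem[OF continuous_map_res_space_fst r])
  show "0 \<le> fst (snd r)"
    using r by (auto simp: res_space_def topspace_Path)
  show "C ! Suc i \<le> C ! i" if "i < n" for i
    using f[OF that] by (rule Delta_tilde_le)
  show "fst (f i) \<in> topspace (orbit_space P (C ! i - C ! Suc i))" if "i < n" for i
    by (rule continuous_map_mem[OF continuous_map_Delta_tilde_fst f[OF that]])
qed

lemma vertex_object_in_space: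
  assumes b: "b \<in> topspace (bar n)" and "j \<le> n"
  shows "obj j b \<in> topspace (sp M \<mm>)"
  using assms(2)
proof (induction j)
  case 0
  then show ?case using bar_spaceD(2) b by (cases b) auto
next
  case (Suc j)
  then show ?case using bar_spaceD(5) b by (cases b) (auto intro!: theta_orbit_in_space[OF P M _ _ X])
qed

lemma continuous_map_vertex_object:
  assumes "j \<le> n"
  shows "continuous_map
    (kprod (res_space M c X (C ! 0)) (kPi (\<lambda>i. Delta_tilde P c \<Phi> (C ! Suc i) (C ! i)) {..<n}))
    (sp M \<mm>) (\<lambda>z. obj j (C, z))"
  using assms
proof (induction j)
  case 0
  have "continuous_map
    (kprod (res_space M c X (C ! 0)) (kPi (\<lambda>i. Delta_tilde P c \<Phi> (C ! Suc i) (C ! i)) {..<n}))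
    (sp M \<mm>) (fst \<circ> fst)"
    by (intro continuous_map_from_kify continuous_map_compose[OF continuous_map_fst continuous_map_res_space_fst])
  then show ?case by (simp add: o_def)
next
  case (Suc j)
  have "continuous_map
    (kprod (res_space M c X (C ! 0)) (kPi (\<lambda>i. Delta_tilde P c \<Phi> (C ! Suc i) (C ! i)) {..<n}))
    (orbit_space P (C ! j - C ! Suc j)) (fst \<circ> ((\<lambda>f. f j) \<circ> snd))"
  proof (rule continuous_map_compose[OF _ continuous_map_Delta_tilde_fst])
    show "continuous_map
      (kprod (res_space M c X (C ! 0)) (kPi (\<lambda>i. Delta_tilde P c \<Phi> (C ! Suc i) (C ! i)) {..<n}))
      (Delta_tilde P c \<Phi> (C ! Suc j) (C ! j)) ((\<lambda>f. f j) \<circ> snd)"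
      using Suc.prems
      by (intro continuous_map_from_kify continuous_map_compose[OF continuous_map_snd]
          continuous_map_product_projection) auto
  qed
  then show ?case
    using Suc continuous_map_theta_orbit[OF P cov M X compactly_generated_kify]
    by (simp add: o_def)
qed

lemma continuous_map_vertex_stab_iter:
  assumes "j \<le> n"
  shows "continuous_map (bar n) (sp M \<mm>) (vertex_stab_iter P M c X j)"
  unfolding bar_space_def
proof (rule continuous_map_from_sum_topology)
  fix C :: "nat list"
  show "continuous_map
    (kprod (res_space M c X (C ! 0)) (kPi (\<lambda>i. Delta_tilde P c \<Phi> (C ! Suc i) (C ! i)) {..<n}))
    (sp M \<mm>) (\<lambda>z. vertex_stab_iter P M c X j (C, z))"
    using continuous_map_compose[OF continuous_map_vertex_object[OF assms] continuous_map_stab_iter[OF P M X c]]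
    by (simp add: vertex_stab_iter_def o_def)
qed

lemma path_component_vertex_stab_iter:
  assumes b: "b \<in> topspace (bar n)" and "j \<le> n"
  shows "path_component_of (sp M \<mm>) (vertex_stab_iter P M c X 0 b) (vertex_stab_iter P M c X j b)"
  using assms(2)
proof (induction j)
  case 0
  then show ?case
    using continuous_map_mem[OF continuous_map_vertex_stab_iter b, of 0] by (simp add: path_component_of_refl)
next
  case (Suc j)
  obtain C r f where bC: "b = (C, r, f)" by (cases b) auto
  have "path_component_of (sp M \<mm>) (vertex_stab_iter P M c X j b) (vertex_stab_iter P M c X (Suc j) b)"
    using path_component_stab_iter[OF P M X c conn bar_spaceD(4,5)[OF b[unfolded bC], of j]
        vertex_object_in_space[OF b, of j]] Suc.prems
    by (simp add: vertex_stab_iter_def bC)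
  then show ?case using Suc path_component_of_trans by fastforce
qed

lemma bar_face_objects:
  assumes "b \<in> topspace (bar (Suc n))" "i \<le> Suc n" "j \<le> n"
  shows "fst (fc (Suc n) i b) ! j = fst b ! coface i j"
proof -
  obtain C r f where b: "b = (C, r, f)" by (cases b) auto
  have "length C = Suc (Suc n)" using bar_spaceD(1) assms(1) b by blast
  then show ?thesis
    using assms(2,3) by (auto simp: b bar_face_def coface_def nth_append min_def)
qed

text \<open>
  An outer face removes the first or last object together with the adjacent morphism, and an inner face composes
  two morphisms, whose effect on objects is that of one morphism after the other.
\<close>

lemma vertex_object_bar_face:
  assumes b: "b \<in> topspace (bar (Suc n))" and i: "i \<le> Suc n" and "j \<le> n"
  shows "obj j (fc (Suc n) i b) = obj (coface i j) b"
  using assms(3)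
proof (induction j)
  case 0
  obtain C r f where "b = (C, r, f)" by (cases b) auto
  then show ?case
    by (auto simp: bar_face_def coface_def res_act_def split: prod.splits)
next
  case (Suc j)
  obtain C r f where bC: "b = (C, r, f)" by (cases b) auto
  note D = bar_spaceD[OF b[unfolded bC]]
  have IH: "obj j (fc (Suc n) i b) = obj (coface i j) b"
    using Suc by simp
  have objs: "fst (fc (Suc n) i b) ! j = C ! coface i j"
    "fst (fc (Suc n) i b) ! Suc j = C ! coface i (Suc j)"
    using bar_face_objects[OF b i] Suc.prems by (simp_all add: bC)
  consider "Suc j < i" | "Suc j = i" | "i \<le> j" by linarith
  then show ?case
  proof cases
    case 1
    then have "snd (snd (fc (Suc n) i b)) j = f j"
      using Suc.prems by (simp add: bC bar_face_def)
    then show ?thesis using 1 IH objs by (simp add: bC coface_def)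
  next
    case 2
    then have i_eq: "i = Suc j" by simp
    have "snd (snd (fc (Suc n) i b)) j =
        UO_comp P (C ! Suc (Suc j)) (C ! Suc j) (C ! j) (f (Suc j)) (f j)"
      using 2 Suc.prems by (simp add: bC bar_face_def)
    moreover have "C ! j - C ! Suc (Suc j) = (C ! j - C ! Suc j) + (C ! Suc j - C ! Suc (Suc j))"
      using D(4)[of j] D(4)[of "Suc j"] Suc.prems by simp
    moreover have "theta_orbit M X ((C ! j - C ! Suc j) + (C ! Suc j - C ! Suc (Suc j)))
        (gam_orbit P (C ! j - C ! Suc j) (C ! Suc j - C ! Suc (Suc j)) (fst (f (Suc j))) (fst (f j))) (obj j b) =
        theta_orbit M X (C ! Suc j - C ! Suc (Suc j)) (fst (f (Suc j)))
          (theta_orbit M X (C ! j - C ! Suc j) (fst (f j)) (obj j b))"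
      using D(5)[of j] D(5)[of "Suc j"] Suc.prems vertex_object_in_space[OF b, of j]
      by (intro theta_orbit_gam_orbit[OF P M _ _ _ X]) auto
    ultimately show ?thesis
      using IH objs by (simp add: i_eq bC coface_def UO_comp_def)
  next
    case 3
    then have "snd (snd (fc (Suc n) i b)) j = f (Suc j)"
      using Suc.prems by (simp add: bC bar_face_def)
    then show ?thesis using 3 IH objs by (simp add: bC coface_def)
  qed
qed

lemma vertex_stab_iter_bar_face:
  assumes "b \<in> topspace (bar (Suc n))" "i \<le> Suc n" "j \<le> n"
  shows "vertex_stab_iter P M c X j (fc (Suc n) i b) = vertex_stab_iter P M c X (coface i j) b"
  using assms by (simp add: vertex_stab_iter_def bar_face_objects vertex_object_bar_face)

text \<open>
  A morphism acts on \<open>(A, \<zeta>)\<close> by extending \<open>\<zeta>\<close> at its end, which leaves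
  the starting point alone.
\<close>

lemma augmentation_glue_class:
  "augmentation (glue bar fc `` {z}) = start_point z"
proof -
  have inv: "start_point z = start_point z'" if "(z, z') \<in> glue bar fc" for z z'
    using that
  proof (rule glue_invariant[rotated])
    fix n i b and t :: "nat \<Rightarrow> real"
    assume b: "b \<in> topspace (bar (Suc n))"
    obtain C A \<zeta> f where "b = (C, (A, \<zeta>), f)" by (cases b) auto
    then show "start_point (Suc n, b, simplical_face i t) = start_point (n, fc (Suc n) i b, t)"
      using bar_spaceD(3)[of C "(A, \<zeta>)" f] b
      by (auto simp: start_point_def bar_face_def res_act_def mstart_def mcat_def split: prod.splits)
  qed
  have "(SOME z'. z' \<in> glue bar fc `` {z}) \<in> glue bar fc `` {z}"
    using self_mem_glue_class by (rule someI)
  then have "start_point (SOME z'. z' \<in> glue bar fc `` {z}) = start_point z"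
    using inv by fastforce
  moreover have "augmentation \<xi> = start_point (SOME z. z \<in> \<xi>)" for \<xi> :: "(nat \<times> ('o, 'x) bar \<times> (nat \<Rightarrow> real)) set"
    by (simp add: augmentation_def start_point_def case_prod_beta)
  ultimately show ?thesis by simp
qed

lemma vertex_in_simplices:
  assumes "A \<in> topspace (sp M \<mm>)" "\<zeta> \<in> topspace (Path (sp M \<mm>))" "mend \<zeta> = stab M c X A"
  shows "vertex A \<zeta> \<in> topspace (simplices bar)"
  using assms by (auto simp: vertex_def topspace_simplices bar_space_def res_space_def)

lemma path_component_if_vertices_connected:
  assumes "path_component_of (canonical_resolution P M c X \<Phi>)
      (glue bar fc `` {vertex A \<zeta>}) (glue bar fc `` {vertex A' \<zeta>'})"
    and A: "A \<in> topspace (sp M \<mm>)" "\<zeta> \<in> topspace (Path (sp M \<mm>))" "mend \<zeta> = stab M c X A"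
    and A': "A' \<in> topspace (sp M \<mm>)" "\<zeta>' \<in> topspace (Path (sp M \<mm>))" "mend \<zeta>' = stab M c X A'"
  shows "path_component_of (sp M \<mm>) A A'"
proof -
  have tot: "vertex_stab_iter P M c X 0 ([0], (A, \<zeta>), f) = A" if "A \<in> topspace (sp M \<mm>)" for A \<zeta> f
    using that by (simp add: vertex_stab_iter_def stab_iter_0[OF M])
  have "path_component_of (sp M \<mm>) (vertex_stab_iter P M c X 0 ([0], (A, \<zeta>), \<lambda>_. undefined))
      (vertex_stab_iter P M c X 0 ([0], (A', \<zeta>'), \<lambda>_. undefined))"
    by (rule path_component_of_realisation[where B = bar and fc = fc and vert = "\<lambda>_. vertex_stab_iter P M c X",
          OF continuous_map_vertex_stab_iter vertex_stab_iter_bar_face path_component_vertex_stab_iter])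
       (use assms(1) vertex_in_simplices[OF A] vertex_in_simplices[OF A'] in
         \<open>auto simp: canonical_resolution_def vertex_def\<close>)
  then show ?thesis using tot A(1) A'(1) by simp
qed

end

section \<open>Isomorphisms in the fundamental groupoid\<close>

definition path_join :: "(real \<Rightarrow> 'a) \<Rightarrow> (real \<Rightarrow> 'a) \<Rightarrow> real \<Rightarrow> 'a" where
  "path_join p q = (\<lambda>t. if t \<le> 1/2 then p (2 * t) else q (2 * t - 1))"

abbreviation path_homotopic :: "'a topology \<Rightarrow> 'a \<Rightarrow> 'a \<Rightarrow> (real \<Rightarrow> 'a) \<Rightarrow> (real \<Rightarrow> 'a) \<Rightarrow> bool" where
  "path_homotopic X a b \<equiv> homotopic_with (\<lambda>r. r 0 = a \<and> r 1 = b) (top_of_set {0..1}) X"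

lemma path_homotopic_iff:
  "path_homotopic X a b p q \<longleftrightarrow>
    (\<exists>h. continuous_map (top_of_set ({0..1::real} \<times> {0..1::real})) X h \<and>
      (\<forall>t\<in>{0..1}. h (0, t) = p t \<and> h (1, t) = q t) \<and> (\<forall>s\<in>{0..1}. h (s, 0) = a \<and> h (s, 1) = b))"
proof -
  have "path_homotopic X a b p q \<longleftrightarrow>
      (\<exists>h. continuous_map (prod_topology (top_of_set {0..1::real}) (top_of_set {0..1::real})) X h \<and>
        (\<forall>x \<in> topspace (top_of_set {0..1}). h (0, x) = p x) \<and>
        (\<forall>x \<in> topspace (top_of_set {0..1}). h (1, x) = q x) \<and>
        (\<forall>t \<in> {0..1}. h (t, 0) = a \<and> h (t, 1) = b))"
    by (rule homotopic_with) simp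
  then show ?thesis by (auto simp: prod_topology_subtopology_eu)
qed

lemma path_between_reverse: "path_between X a b p \<Longrightarrow> path_between X b a (\<lambda>t. p (1 - t))"
proof -
  assume p: "path_between X a b p"
  have "continuous_map (top_of_set {0..1::real}) (top_of_set {0..1}) (\<lambda>t. 1 - t)"
    by (auto intro!: continuous_intros)
  then have "continuous_map (top_of_set {0..1}) X (p \<circ> (\<lambda>t. 1 - t))"
    using p continuous_map_compose unfolding path_between_def pathin_def by blast
  then show ?thesis using p by (simp add: path_between_def pathin_def o_def)
qed

lemma path_homotopic_join:
  assumes p: "path_homotopic X a b p p'" and q: "path_homotopic X b d q q'"
  shows "path_homotopic X a d (path_join p q) (path_join p' q')"
proof -
  let ?S = "{0..1} \<times> {0..1} :: (real \<times> real) set"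
  obtain h where h: "continuous_map (top_of_set ?S) X h" "\<And>t. t \<in> {0..1} \<Longrightarrow> h (0, t) = p t"
    "\<And>t. t \<in> {0..1} \<Longrightarrow> h (1, t) = p' t" "\<And>s. s \<in> {0..1} \<Longrightarrow> h (s, 0) = a" "\<And>s. s \<in> {0..1} \<Longrightarrow> h (s, 1) = b"
    using p unfolding path_homotopic_iff by blast
  obtain k where k: "continuous_map (top_of_set ?S) X k" "\<And>t. t \<in> {0..1} \<Longrightarrow> k (0, t) = q t"
    "\<And>t. t \<in> {0..1} \<Longrightarrow> k (1, t) = q' t" "\<And>s. s \<in> {0..1} \<Longrightarrow> k (s, 0) = b" "\<And>s. s \<in> {0..1} \<Longrightarrow> k (s, 1) = d"
    using q unfolding path_homotopic_iff by blast
  define H where "H z = (if snd z \<le> 1/2 then h (fst z, 2 * snd z) else k (fst z, 2 * snd z - 1))" for z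
  have "continuous_map (top_of_set ?S) X H"
    unfolding H_def
  proof (rule continuous_map_cases_le)
    show "continuous_map (top_of_set ?S) euclideanreal snd" "continuous_map (top_of_set ?S) euclideanreal (\<lambda>_. 1/2)"
      by (auto intro!: continuous_intros)
    have "continuous_map (subtopology (top_of_set ?S) {z \<in> topspace (top_of_set ?S). snd z \<le> 1/2})
        (top_of_set ?S) (\<lambda>z. (fst z, 2 * snd z))"
      by (auto simp: subtopology_subtopology intro!: continuous_intros)
    then show "continuous_map (subtopology (top_of_set ?S) {z \<in> topspace (top_of_set ?S). snd z \<le> 1/2})
        X (\<lambda>z. h (fst z, 2 * snd z))"
      using continuous_map_compose[OF _ h(1)] by (fastforce simp: o_def)
    have "continuous_map (subtopology (top_of_set ?S) {z \<in> topspace (top_of_set ?S). 1/2 \<le> snd z})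
        (top_of_set ?S) (\<lambda>z. (fst z, 2 * snd z - 1))"
      by (auto simp: subtopology_subtopology intro!: continuous_intros)
    then show "continuous_map (subtopology (top_of_set ?S) {z \<in> topspace (top_of_set ?S). 1/2 \<le> snd z})
        X (\<lambda>z. k (fst z, 2 * snd z - 1))"
      using continuous_map_compose[OF _ k(1)] by (fastforce simp: o_def)
    show "h (fst z, 2 * snd z) = k (fst z, 2 * snd z - 1)"
      if "z \<in> topspace (top_of_set ?S)" "snd z = 1/2" for z
    proof -
      have "2 * snd z = 1" "fst z \<in> {0..1}" using that by auto
      then show ?thesis using h(5)[of "fst z"] k(4)[of "fst z"] by simp
    qed
  qed
  then show ?thesis
    unfolding path_homotopic_iff
    by (intro exI[of _ H]) (auto simp: H_def path_join_def h(2-4) k(2,3,5))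
qed

text \<open>
  The homotopy runs along \<open>p\<close> and back, for a fraction \<open>1 - s\<close> of the way.
\<close>

lemma path_homotopic_join_reverse:
  assumes p: "path_between X a b p"
  shows "path_homotopic X a a (path_join p (\<lambda>t. p (1 - t))) (\<lambda>_. a)"
proof -
  let ?S = "{0..1} \<times> {0..1} :: (real \<times> real) set"
  define w :: "real \<times> real \<Rightarrow> real" where "w z = (1 - fst z) * (1 - \<bar>2 * snd z - 1\<bar>)" for z
  have "w z \<in> {0..1}" if "z \<in> ?S" for z
  proof -
    have "0 \<le> 1 - fst z" "1 - fst z \<le> 1" "0 \<le> 1 - \<bar>2 * snd z - 1\<bar>" "1 - \<bar>2 * snd z - 1\<bar> \<le> 1"
      using that by auto
    then show ?thesis
      unfolding w_def by (auto intro: mult_nonneg_nonneg mult_le_one)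
  qed
  then have "continuous_map (top_of_set ?S) (top_of_set {0..1}) w"
    unfolding w_def by (auto intro!: continuous_intros)
  then have "continuous_map (top_of_set ?S) X (p \<circ> w)"
    using p continuous_map_compose unfolding path_between_def pathin_def by blast
  moreover have "(p \<circ> w) (0, t) = path_join p (\<lambda>t. p (1 - t)) t" for t
    by (auto simp: w_def path_join_def algebra_simps abs_if)
  ultimately show ?thesis
    unfolding path_homotopic_iff
    using p by (intro exI[of _ "p \<circ> w"]) (auto simp: w_def path_between_def)
qed

lemma path_class_eq:
  assumes "path_homotopic X a b p q"
  shows "path_class X a b p = path_class X a b q"
  using homotopic_with_trans[OF assms] homotopic_with_trans[OF homotopic_with_symD[OF assms]]
  unfolding path_class_def by blast

lemma path_homotopic_refl: "path_between X a b p \<Longrightarrow> path_homotopic X a b p p"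
  by (simp add: path_between_def pathin_def)

text \<open>
  The composition of classes is computed with chosen representatives, so the inverse of the class of
  \<open>p\<close> is taken to be that of the reverse of the chosen representative \<open>p'\<close>; only the
  representative \<open>q\<close> of that class is then out of control.
\<close>

lemma Pi_iso_iff_path_component: "Pi_iso X a b \<longleftrightarrow> path_component_of X a b"
proof
  assume "Pi_iso X a b"
  then obtain p where "path_between X a b p"
    unfolding Pi_iso_def Pi_hom_def by blast
  then show "path_component_of X a b"
    unfolding path_between_def path_component_of_def by blast
next
  assume "path_component_of X a b"
  then obtain p where p: "path_between X a b p"
    unfolding path_between_def path_component_of_def by blast
  define f where "f = path_class X a b p"
  define p' where "p' = (SOME r. r \<in> f)"
  have "p \<in> f"
    using p path_homotopic_refl[OF p] by (simp add: f_def path_class_def)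
  then have "p' \<in> f" unfolding p'_def by (rule someI[of "\<lambda>r. r \<in> f"])
  then have p': "path_between X a b p'" by (simp add: f_def path_class_def)
  define r where "r = (\<lambda>t. p' (1 - t))"
  have r: "path_between X b a r" unfolding r_def by (rule path_between_reverse[OF p'])
  define g where "g = path_class X b a r"
  define q where "q = (SOME r. r \<in> g)"
  have "r \<in> g"
    using r path_homotopic_refl[OF r] by (simp add: g_def path_class_def)
  then have "q \<in> g" unfolding q_def by (rule someI[of "\<lambda>r. r \<in> g"])
  then have q: "path_homotopic X b a r q" by (simp add: g_def path_class_def)
  have "path_homotopic X a a (path_join p' q) (path_join p' r)"
    by (rule path_homotopic_join[OF path_homotopic_refl[OF p'] homotopic_with_symD[OF q]])
  then have "path_homotopic X a a (path_join p' q) (\<lambda>_. a)"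
    using path_homotopic_join_reverse[OF p'] unfolding r_def by (rule homotopic_with_trans)
  then have 1: "Pi_comp X a a f g = Pi_id X a"
    unfolding Pi_comp_def Pi_id_def p'_def[symmetric] q_def[symmetric] path_join_def[symmetric]
    by (rule path_class_eq)
  have "path_homotopic X b b (path_join q p') (path_join r p')"
    by (rule path_homotopic_join[OF homotopic_with_symD[OF q] path_homotopic_refl[OF p']])
  moreover have "path_homotopic X b b (path_join r p') (\<lambda>_. b)"
    using path_homotopic_join_reverse[OF r] by (simp add: r_def)
  ultimately have "path_homotopic X b b (path_join q p') (\<lambda>_. b)"
    by (rule homotopic_with_trans)
  then have 2: "Pi_comp X b b g f = Pi_id X b"
    unfolding Pi_comp_def Pi_id_def p'_def[symmetric] q_def[symmetric] path_join_def[symmetric]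
    by (rule path_class_eq)
  have "f \<in> Pi_hom X a b" "g \<in> Pi_hom X b a"
    using p r by (auto simp: f_def g_def Pi_hom_def)
  then show "Pi_iso X a b"
    unfolding Pi_iso_def using 1 2 by blast
qed

lemma path_as_Moore_path:
  assumes "path_component_of Y a b"
  obtains \<zeta> where "\<zeta> \<in> topspace (Path Y)" "mstart \<zeta> = a" "mend \<zeta> = b"
proof -
  obtain p where p: "continuous_map (top_of_set {0..1::real}) Y p" "p 0 = a" "p 1 = b"
    using assms unfolding path_component_of_def pathin_def by blast
  define clamp where "clamp t = max 0 (min 1 t)" for t :: real
  have "continuous_map euclideanreal (top_of_set {0..1}) clamp"
    unfolding continuous_map_in_subtopology continuous_map_iff_continuous2
    by (auto simp: clamp_def intro!: continuous_intros)
  then have "continuous_map euclideanreal Y (p \<circ> clamp)"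
    using p(1) continuous_map_compose by blast
  then have "(1, p \<circ> clamp) \<in> topspace (Path Y)"
    by (simp add: topspace_Path clamp_def)
  then show ?thesis
    using that[of "(1, p \<circ> clamp)"] p(2,3) by (simp add: mstart_def mend_def clamp_def)
qed

section \<open>Cancellation\<close>

theorem corollary2:
  fixes P :: "'o operad_data"
    and M :: "('o, 'x) algebra_data"
    and c :: 'o
    and X :: 'x
    and \<Phi> :: "nat \<Rightarrow> nat \<Rightarrow> 'o umor set \<Rightarrow> braid set"
    and k :: rat
  assumes "E12_operad TYPE('z) P"
    and "orbit_maps_covering P"
    and "graded_algebra P M"
    and "X \<in> topspace (sp M \<aa>)" and "grd M \<aa> X = 1"
    and "c \<in> topspace (ops P (mprof 1) \<mm>)"
    and "UO_UB_iso P c \<Phi>"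
    and "k \<ge> 2"
    and "resolution_graded_connected P M c X \<Phi>
           (\<lambda>n. case n of enat j \<Rightarrow> Some ((of_nat j - 2 + k) / k) | \<infinity> \<Rightarrow> None) 1"
  shows "\<forall>A \<in> topspace (sp M \<mm>). \<forall>A' \<in> topspace (sp M \<mm>).
           0 < grd M \<mm> A \<and> grd M \<mm> A < \<infinity> \<and> 0 < grd M \<mm> A' \<and> grd M \<mm> A' < \<infinity> \<longrightarrow>
           Pi_iso (sp M \<mm>) (stab M c X A) (stab M c X A') \<longrightarrow> Pi_iso (sp M \<mm>) A A'"
proof (intro ballI impI)
  fix A A' assume A: "A \<in> topspace (sp M \<mm>)" and A': "A' \<in> topspace (sp M \<mm>)"
    and deg: "0 < grd M \<mm> A \<and> grd M \<mm> A < \<infinity> \<and> 0 < grd M \<mm> A' \<and> grd M \<mm> A' < \<infinity>"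
    and iso: "Pi_iso (sp M \<mm>) (stab M c X A) (stab M c X A')"
  note M = assms(3) and X = assms(4) and c = assms(6)
  have P: "operad P" using assms(1) by (simp add: E12_operad_def)
  have conn: "path_connected_space (ops P (mprof l) \<mm>)" for l
    using path_connected_ops_mprof[OF assms(1)] .
  note ctx = P assms(2) M X c conn
  obtain m where m: "grd M \<mm> A = enat m" "0 < m"
    using deg by (cases "grd M \<mm> A") (auto simp: zero_enat_def)
  define n where "n = Suc m"
  define B where "B = stab M c X A"
  let ?glue = "glue (bar_space P M c X \<Phi>) (bar_face P M X)"
  let ?R = "canonical_resolution P M c X \<Phi>"
  let ?Rn = "degree_part ?R (grd M \<mm> \<circ> augmentation) n"
  let ?Mn = "degree_part (sp M \<mm>) (grd M \<mm>) n"
  have B: "B \<in> topspace (sp M \<mm>)"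
    unfolding B_def stab_def by (rule theta_in_space(2)[OF M c A X])
  have B_deg: "grd M \<mm> B = enat n"
  proof -
    have "grd M \<mm> B = (\<Sum>i<length (mprof 1). grd M (mprof 1 ! i) (inputs 1 A X i))"
      unfolding B_def stab_def using M c theta_in_space(1)[OF M c A X] unfolding graded_algebra_def by blast
    also have "\<dots> = grd M \<mm> A + grd M \<aa> X"
      by (simp add: mprof_def lessThan_Suc)
    finally show ?thesis
      using m(1) assms(5) by (simp add: n_def one_enat_def)
  qed
  then have Bn: "B \<in> topspace ?Mn"
    using B by (simp add: degree_part_def)
  have "1 \<le> n" by (simp add: n_def)
  then have "k_connected_map \<lfloor>(of_nat n - 2 + k) / k\<rfloor> ?Rn ?Mn augmentation"
    using assms(9) \<open>1 \<le> n\<close> unfolding resolution_graded_connected_def by simp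
  then have "k_connected_space (\<lfloor>(of_nat n - 2 + k) / k\<rfloor> - 1) (homotopy_fibre ?Rn ?Mn augmentation B)"
    using Bn unfolding k_connected_map_def by blast
  moreover have "0 \<le> \<lfloor>(of_nat n - 2 + k) / k\<rfloor> - 1"
  proof -
    have "(2 :: rat) \<le> of_nat n" using m(2) by (simp add: n_def)
    then have "1 \<le> (of_nat n - 2 + k) / k" using assms(8) by simp
    then show ?thesis by simp
  qed
  ultimately have fibre: "path_connected_space (homotopy_fibre ?Rn ?Mn augmentation B)"
    by (rule k_connected_space_imp_path_connected)
  have "path_component_of (sp M \<mm>) B (stab M c X A')"
    using iso by (simp add: Pi_iso_iff_path_component B_def)
  then obtain \<zeta>' where \<zeta>': "\<zeta>' \<in> topspace (Path (sp M \<mm>))" "mstart \<zeta>' = B" "mend \<zeta>' = stab M c X A'"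
    by (rule path_as_Moore_path)
  have \<zeta>: "mconst B \<in> topspace (Path (sp M \<mm>))" "mstart (mconst B) = B" "mend (mconst B) = stab M c X A"
    using B by (simp_all add: topspace_Path mconst_def mstart_def mend_def B_def)
  have in_fibre: "(?glue `` {vertex C \<zeta>}, mconst B) \<in> topspace (homotopy_fibre ?Rn ?Mn augmentation B)"
    if "C \<in> topspace (sp M \<mm>)" "\<zeta> \<in> topspace (Path (sp M \<mm>))" "mstart \<zeta> = B" "mend \<zeta> = stab M c X C" for C \<zeta>
  proof -
    have "?glue `` {vertex C \<zeta>} \<in> topspace ?R"
      using vertex_in_simplices[OF ctx that(1,2,4)]
      by (simp add: canonical_resolution_def realisation_eq topspace_quotient_topology quotientI)
    moreover have "augmentation (?glue `` {vertex C \<zeta>}) = B"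
      using that(3) augmentation_glue_class[OF ctx] by (simp add: start_point_def vertex_def)
    moreover have "mconst B \<in> topspace (Path ?Mn)"
      using Bn by (simp add: topspace_Path mconst_def)
    ultimately show ?thesis
      using \<zeta>(2) by (simp add: homotopy_fibre_def degree_part_def B_deg mconst_def mend_def)
  qed
  have "path_component_of (homotopy_fibre ?Rn ?Mn augmentation B)
      (?glue `` {vertex A (mconst B)}, mconst B) (?glue `` {vertex A' \<zeta>'}, mconst B)"
    using fibre in_fibre[OF A \<zeta>] in_fibre[OF A' \<zeta>']
    by (simp add: path_connected_space_iff_path_component)
  moreover have "continuous_map (homotopy_fibre ?Rn ?Mn augmentation B) ?R fst"
  proof -
    have "continuous_map ?Rn ?R id"
      unfolding degree_part_def by (intro continuous_map_from_kify continuous_map_from_subtopology) simp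
    then have "continuous_map (prod_topology ?Rn (Path ?Mn)) ?R (id \<circ> fst)"
      by (rule continuous_map_compose[OF continuous_map_fst])
    then show ?thesis
      unfolding homotopy_fibre_def
      by (intro continuous_map_from_kify continuous_map_from_subtopology) simp
  qed
  ultimately have "path_component_of ?R (?glue `` {vertex A (mconst B)}) (?glue `` {vertex A' \<zeta>'})"
    using path_component_of_continuous_image by fastforce
  then have "path_component_of (sp M \<mm>) A A'"
    by (rule path_component_if_vertices_connected[OF ctx _ A \<zeta>(1,3) A' \<zeta>'(1,3)])
  then show "Pi_iso (sp M \<mm>) A A'"
    by (simp add: Pi_iso_iff_path_component)
qed

end
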